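(* If $0\le m,n\le p-1$ and $q\ge0$, then $$\operatorname{Ext}^q(W_m,F_n)=\begin{cases}k&\text{if }m\ge n\text{ and }q=m-n,\\0&\text{otherwise.}\end{cases}$$
   Context: $k$ is a field of characteristic $p>0$; $\mathcal{P}_e$ is the abelian category of homogeneous strict polynomial functors of degree $e$ over $k$ (Friedlander–Suslin; functors from finite-dimensional $k$-vector spaces to finite-dimensional $k$-vector spaces). For a partition (Young diagram) $\lambda=(\lambda_1,\dots,\lambda_n)$ of $e$ with conjugate $\widetilde\lambda$, put $\Lambda^\lambda=\Lambda^{\lambda_1}\otimes\dots\otimes\Lambda^{\lambda_n}$, $S^\lambda=S^{\lambda_1}\otimes\dots\otimes S^{\lambda_n}$ (tensor products of exterior, resp. symmetric, powers). The Schur functor $S_\lambda$ is the image of the composite $\Lambda^\lambda\hookrightarrow I^{\otimes e}\to I^{\otimes e}\twoheadrightarrow S^{\widetilde\lambda}$ of the natural monomorphism, the permutation of tensor factors that passes from the row reading to the column reading of the boxes of $\lambda$, and the natural epimorphism. The Kuhn dual is $G^\#(V)=G(V^* )^*$; the Weyl functor is $W_\lambda=(S_\lambda)^\#$; the simple functor $F_\lambda$ is the image of the composite $W_\lambda\hookrightarrow\Lambda^\lambda\twoheadrightarrow S_\lambda$. For $0\le i\le p-1$ put $S_i=S_{(i+1,1^{p-i-1})}$, $W_i=W_{(i+1,1^{p-i-1})}$, $F_i=F_{(i+1,1^{p-i-1})}$ in $\mathcal{P}_p$. $\operatorname{Ext}$-groups are computed in $\mathcal{P}_p$ (equivalently in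 its block $\mathcal{P}_p^\varnothing$ corresponding to hooks). *)

theory Defs
  imports
    Jordan_Normal_Form.Determinant
    "HOL-Algebra.Module"
    "HOL-Library.Function_Algebras"
    "HOL-Library.Poly_Mapping"
    "HOL-Library.Multiset"
begin

section \<open>Vector spaces of functions\<close>

text \<open>
  The ground field is a type \<open>'k::field\<close>. A finite-dimensional vector space is a
  finite-dimensional subspace of a space of functions \<open>'b \<Rightarrow> 'k\<close>; addition and \<open>0\<close> are
  those of \<open>Function_Algebras\<close>.
\<close>

definition fscale :: "'k::field \<Rightarrow> ('b \<Rightarrow> 'k) \<Rightarrow> 'b \<Rightarrow> 'k" where
  "fscale c v = (\<lambda>x. c * v x)"

global_interpretation fvs: vector_space "fscale :: 'k::field \<Rightarrow> ('b \<Rightarrow> 'k) \<Rightarrow> 'b \<Rightarrow> 'k"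
  by unfold_locales (auto simp: fscale_def fun_eq_iff algebra_simps)

definition fd_space :: "('b \<Rightarrow> 'k::field) set \<Rightarrow> bool" where
  "fd_space V \<longleftrightarrow> (\<exists>S. finite S \<and> V = fvs.span S)"

definition linear_between ::
    "('b \<Rightarrow> 'k::field) set \<Rightarrow> ('c \<Rightarrow> 'k) set \<Rightarrow> (('b \<Rightarrow> 'k) \<Rightarrow> 'c \<Rightarrow> 'k) \<Rightarrow> bool" where
  "linear_between V W f \<longleftrightarrow>
     (\<forall>v\<in>V. f v \<in> W) \<and>
     (\<forall>v\<in>V. \<forall>w\<in>V. f (v + w) = f v + f w) \<and>
     (\<forall>c. \<forall>v\<in>V. f (fscale c v) = fscale c (f v))"


section \<open>Strict polynomial functors\<close>

text \<open>
  Following Friedlander and Suslin, a strict polynomial functor \<open>T\<close> assigns to a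
  finite-dimensional space \<open>V\<close> a finite-dimensional space \<open>T(V)\<close> and to a pair \<open>V, W\<close> a
  polynomial law from \<open>Hom(V, W)\<close> to \<open>Hom(T(V), T(W))\<close>, i.e. an element of
  \<open>S(Hom(V, W)\<^sup>*) \<otimes> Hom(T(V), T(W))\<close>, such that identities and composition are respected as
  formal polynomials.

  The source category is represented by its skeleton, the spaces \<open>k\<^sup>n\<close> with matrices as
  morphisms. An \<open>n \<times> m\<close> matrix with rows \<open>i < n\<close> and columns \<open>j < m\<close> represents a map from
  \<open>k\<^sup>m\<close> to \<open>k\<^sup>n\<close>. A monomial in the matrix entries \<open>x\<^sub>i\<^sub>j\<close> is a multiset of pairs \<open>(i, j)\<close>, and
  \<open>coef T m n M\<close> is the coefficient, in \<open>Hom(T(k\<^sup>m), T(k\<^sup>n))\<close>, of the monomial \<open>M\<close>. Only the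
  values of \<open>coef T m n M\<close> on \<open>ob T m\<close> are relevant.
\<close>

record ('k, 'b) spfun =
  ob :: "nat \<Rightarrow> ('b \<Rightarrow> 'k) set"
  coef :: "nat \<Rightarrow> nat \<Rightarrow> (nat \<times> nat) multiset \<Rightarrow> ('b \<Rightarrow> 'k) \<Rightarrow> 'b \<Rightarrow> 'k"

definition monomials :: "nat \<Rightarrow> nat \<Rightarrow> nat \<Rightarrow> (nat \<times> nat) multiset set" where
  "monomials e n m = {M. size M = e \<and> set_mset M \<subseteq> {..<n} \<times> {..<m}}"

text \<open>The polynomial ring on a set \<open>'x\<close> of variables, with multisets as monomials.\<close>

type_synonym ('x, 'k) mpol = "'x multiset \<Rightarrow>\<^sub>0 'k"

definition pvar :: "'x \<Rightarrow> ('x, 'k::field) mpol" where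
  "pvar x = Poly_Mapping.single {#x#} 1"

definition spf_eval ::
    "nat \<Rightarrow> ('k::field, 'b) spfun \<Rightarrow> nat \<Rightarrow> nat \<Rightarrow> (nat \<Rightarrow> nat \<Rightarrow> 'k) \<Rightarrow> ('b \<Rightarrow> 'k) \<Rightarrow> 'b \<Rightarrow> 'k" where
  "spf_eval e T m n A v =
     (\<Sum>M\<in>monomials e n m. fscale (\<Prod>(i, j)\<in>#M. A i j) (coef T m n M v))"

text \<open>
  The coefficient of \<open>y\<^sup>N x\<^sup>M\<close> in the monomial \<open>K\<close> of the entries of the product \<open>y x\<close>, where
  \<open>y\<close> and \<open>x\<close> are generic matrices with inner dimension \<open>m\<close>.
\<close>

definition comp_coeff ::
    "nat \<Rightarrow> (nat \<times> nat) multiset \<Rightarrow> (nat \<times> nat) multiset \<Rightarrow> (nat \<times> nat) multiset \<Rightarrow> 'k::field" where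
  "comp_coeff m N M K =
     Poly_Mapping.lookup
       (\<Prod>(i, j)\<in>#K. \<Sum>h<m. pvar (Inl (i, h)) * pvar (Inr (h, j)) ::
          ((nat \<times> nat) + (nat \<times> nat), 'k) mpol)
       (image_mset Inl N + image_mset Inr M)"

definition spf :: "nat \<Rightarrow> ('k::field, 'b) spfun \<Rightarrow> bool" where
  "spf e T \<longleftrightarrow>
     (\<forall>n. fd_space (ob T n)) \<and>
     (\<forall>m n M. linear_between (ob T m) (ob T n) (coef T m n M)) \<and>
     (\<forall>m n M. \<forall>v\<in>ob T m. M \<notin> monomials e n m \<longrightarrow> coef T m n M v = 0) \<and>
     (\<forall>n. \<forall>v\<in>ob T n. spf_eval e T n n (\<lambda>i j. if i = j then 1 else 0) v = v) \<and>
     (\<forall>l m n N M. \<forall>v\<in>ob T l.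
        coef T m n N (coef T l m M v) =
          (\<Sum>K\<in>monomials e n l. fscale (comp_coeff m N M K) (coef T l n K v)))"

text \<open>
  Morphisms of strict polynomial functors commute with the formal polynomials, i.e. with every
  coefficient. They are normalised to be \<open>0\<close> outside the source.
\<close>

type_synonym ('k, 'b, 'c) spmor = "nat \<Rightarrow> ('b \<Rightarrow> 'k) \<Rightarrow> 'c \<Rightarrow> 'k"

definition spf_hom :: "('k::field, 'b) spfun \<Rightarrow> ('k, 'c) spfun \<Rightarrow> ('k, 'b, 'c) spmor set" where
  "spf_hom S T = {f.
     (\<forall>n. linear_between (ob S n) (ob T n) (f n)) \<and>
     (\<forall>n v. v \<notin> ob S n \<longrightarrow> f n v = 0) \<and>
     (\<forall>m n M. \<forall>v\<in>ob S m. f n (coef S m n M v) = coef T m n M (f m v))}"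

definition spf_image ::
    "('k, 'b, 'c) spmor \<Rightarrow> ('k::field, 'b) spfun \<Rightarrow> ('k, 'c) spfun \<Rightarrow> ('k, 'c) spfun" where
  "spf_image f S T = \<lparr>ob = (\<lambda>n. f n ` ob S n), coef = coef T\<rparr>"

text \<open>
  The Kuhn dual \<open>V \<mapsto> G(V\<^sup>*)\<^sup>*\<close>. Under the identification of \<open>(k\<^sup>n)\<^sup>*\<close> with \<open>k\<^sup>n\<close>, a matrix acts on
  the dual spaces by its transpose, whence \<open>prod.swap\<close>. Functionals on \<open>ob G n\<close> are
  extended by \<open>0\<close>.
\<close>

definition kuhn_dual :: "('k::field, 'b) spfun \<Rightarrow> ('k, 'b \<Rightarrow> 'k) spfun" where
  "kuhn_dual G = \<lparr>
     ob = (\<lambda>n. {\<phi>. (\<forall>v\<in>ob G n. \<forall>w\<in>ob G n. \<phi> (v + w) = \<phi> v + \<phi> w) \<and>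
                  (\<forall>c. \<forall>v\<in>ob G n. \<phi> (fscale c v) = c * \<phi> v) \<and>
                  (\<forall>v. v \<notin> ob G n \<longrightarrow> \<phi> v = 0)}),
     coef = (\<lambda>m n M \<phi> v. if v \<in> ob G n then \<phi> (coef G n m (image_mset prod.swap M) v) else 0)\<rparr>"


section \<open>Extension groups in the category of functors of degree \<open>e\<close>\<close>

text \<open>
  The category of homogeneous strict polynomial functors of degree \<open>e\<close> is represented by the
  functors with values in subspaces of \<open>nat \<Rightarrow> 'k\<close>. Every finite-dimensional
  space is isomorphic to such a subspace, so every functor with values in finite-dimensional
  subspaces of some \<open>'b \<Rightarrow> 'k\<close> is isomorphic to one of these. Kernels, images, epimorphisms and
  exactness in this abelian category are computed pointwise.
\<close>

definition projective_spf :: "nat \<Rightarrow> ('k::field, nat) spfun \<Rightarrow> bool" where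
  "projective_spf e P \<longleftrightarrow> spf e P \<and>
     (\<forall>(S :: ('k, nat) spfun) (T :: ('k, nat) spfun) g f.
        spf e S \<and> spf e T \<and> g \<in> spf_hom S T \<and> (\<forall>n. g n ` ob S n = ob T n) \<and> f \<in> spf_hom P T
        \<longrightarrow> (\<exists>h\<in>spf_hom P S. \<forall>n. \<forall>v\<in>ob P n. g n (h n v) = f n v))"

definition projective_resolution ::
    "nat \<Rightarrow> ('k::field, 'b) spfun \<Rightarrow>
     (nat \<Rightarrow> ('k, nat) spfun) \<Rightarrow> (nat \<Rightarrow> ('k, nat, nat) spmor) \<Rightarrow> ('k, nat, 'b) spmor \<Rightarrow> bool" where
  "projective_resolution e A P d a \<longleftrightarrow>
     (\<forall>i. projective_spf e (P i)) \<and>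
     (\<forall>i. d i \<in> spf_hom (P (Suc i)) (P i)) \<and>
     a \<in> spf_hom (P 0) A \<and>
     (\<forall>n. a n ` ob (P 0) n = ob A n) \<and>
     (\<forall>n. d 0 n ` ob (P (Suc 0)) n = {v \<in> ob (P 0) n. a n v = 0}) \<and>
     (\<forall>i n. d (Suc i) n ` ob (P (Suc (Suc i))) n = {v \<in> ob (P (Suc i)) n. d i n v = 0})"

definition hom_scale :: "'k::field \<Rightarrow> ('k, 'b, 'c) spmor \<Rightarrow> ('k, 'b, 'c) spmor" where
  "hom_scale c f = (\<lambda>n v. fscale c (f n v))"

definition cocycles ::
    "(nat \<Rightarrow> ('k::field, nat) spfun) \<Rightarrow> (nat \<Rightarrow> ('k, nat, nat) spmor) \<Rightarrow> ('k, 'c) spfun \<Rightarrow> nat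
     \<Rightarrow> ('k, nat, 'c) spmor set" where
  "cocycles P d B q = {f \<in> spf_hom (P q) B. \<forall>n. \<forall>v\<in>ob (P (Suc q)) n. f n (d q n v) = 0}"

definition coboundaries ::
    "(nat \<Rightarrow> ('k::field, nat) spfun) \<Rightarrow> (nat \<Rightarrow> ('k, nat, nat) spmor) \<Rightarrow> ('k, 'c) spfun \<Rightarrow> nat
     \<Rightarrow> ('k, nat, 'c) spmor set" where
  "coboundaries P d B q =
     (case q of 0 \<Rightarrow> {0} | Suc r \<Rightarrow> {\<lambda>n v. g n (d r n v) | g. g \<in> spf_hom (P r) B})"

definition coset_of :: "'h::plus set \<Rightarrow> 'h \<Rightarrow> 'h set" where
  "coset_of U f = (\<lambda>u. f + u) ` U"

text \<open>
  The quotient of the space \<open>Z\<close> by its subspace \<open>U\<close>, as a record of type \<open>module\<close>; the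
  multiplicative fields of the record carry no meaning.
\<close>

definition quotient_space ::
    "('k \<Rightarrow> 'h::ab_group_add \<Rightarrow> 'h) \<Rightarrow> 'h set \<Rightarrow> 'h set \<Rightarrow> ('k, 'h set) module" where
  "quotient_space sc Z U = \<lparr>
     carrier = coset_of U ` Z,
     mult = undefined,
     one = undefined,
     zero = U,
     add = (\<lambda>X Y. {x + y | x y. x \<in> X \<and> y \<in> Y}),
     module.smult = (\<lambda>c X. {sc c x + u | x u. x \<in> X \<and> u \<in> U})\<rparr>"

text \<open>
  \<open>Ext\<^sup>q(A, B)\<close>, computed from a chosen projective resolution of \<open>A\<close>.
\<close>

definition Ext ::
    "nat \<Rightarrow> nat \<Rightarrow> ('k::field, 'b) spfun \<Rightarrow> ('k, 'c) spfun \<Rightarrow> ('k, ('k, nat, 'c) spmor set) module" where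
  "Ext e q A B =
     (case SOME (P, d, a). projective_resolution e A P d a of
        (P, d, a) \<Rightarrow> quotient_space hom_scale (cocycles P d B q) (coboundaries P d B q))"

definition iso_to_field :: "('k::field, 'x) module \<Rightarrow> bool" where
  "iso_to_field E \<longleftrightarrow>
     (\<exists>\<phi>. bij_betw \<phi> (carrier E) (UNIV :: 'k set) \<and>
          (\<forall>x\<in>carrier E. \<forall>y\<in>carrier E. \<phi> (x \<oplus>\<^bsub>E\<^esub> y) = \<phi> x + \<phi> y) \<and>
          (\<forall>c. \<forall>x\<in>carrier E. \<phi> (c \<odot>\<^bsub>E\<^esub> x) = c * \<phi> x))"

definition zero_space :: "('k::field, 'x) module \<Rightarrow> bool" where
  "zero_space E \<longleftrightarrow> carrier E = {\<zero>\<^bsub>E\<^esub>}"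


section \<open>Tensor products of exterior and of symmetric powers\<close>

text \<open>
  The functor whose value on \<open>k\<^sup>n\<close> has basis \<open>B n\<close> and which takes the generic matrix to
  the matrix of polynomials \<open>P\<close>; row index first.
\<close>

definition matrix_spfun ::
    "(nat \<Rightarrow> 'b set) \<Rightarrow> ('b \<Rightarrow> 'b \<Rightarrow> (nat \<times> nat, 'k::field) mpol) \<Rightarrow> ('k, 'b) spfun" where
  "matrix_spfun B P = \<lparr>
     ob = (\<lambda>n. {v. \<forall>b. b \<notin> B n \<longrightarrow> v b = 0}),
     coef = (\<lambda>m n M v b.
       if b \<in> B n then \<Sum>b'\<in>B m. Poly_Mapping.lookup (P b b') M * v b' else 0)\<rparr>"

text \<open>
  Partitions are weakly decreasing lists of positive numbers. The factors of \<open>I\<^bsup>\<otimes>e\<^esup>\<close> are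
  labelled by the boxes of the diagram of \<open>\<lambda>\<close>, so that the basis of \<open>I\<^bsup>\<otimes>e\<^esup>(k\<^sup>n)\<close> consists of the
  fillings of the diagram, listed row by row, with entries \<open>< n\<close>. Passing from the
  row reading to the column reading then takes a filling of \<open>\<lambda>\<close> to its transpose, a
  filling of the conjugate partition.
\<close>

definition conj_part :: "nat list \<Rightarrow> nat list" where
  "conj_part lam = map (\<lambda>j. length (filter (\<lambda>a. j < a) lam)) [0..<fold max lam 0]"

definition fillings :: "nat list \<Rightarrow> nat \<Rightarrow> nat list list set" where
  "fillings lam n = {T. map length T = lam \<and> (\<forall>r\<in>set T. set r \<subseteq> {..<n})}"

text \<open>
  \<open>\<Lambda>\<^sup>\<lambda>(k\<^sup>n)\<close> has as basis the tensor products of the \<open>e\<^sub>r = e\<^bsub>r\<^sub>1\<^esub> \<and> \<dots> \<and> e\<^bsub>r\<^sub>a\<^esub>\<close> with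
  \<open>r\<^sub>1 < \<dots> < r\<^sub>a\<close>; the matrix of an exterior power consists of the minors.
\<close>

definition ext_basis :: "nat list \<Rightarrow> nat \<Rightarrow> nat list list set" where
  "ext_basis lam n = {T \<in> fillings lam n. \<forall>r\<in>set T. sorted_wrt (<) r}"

definition minor :: "nat list \<Rightarrow> nat list \<Rightarrow> (nat \<times> nat, 'k::field) mpol" where
  "minor r s = det (mat (length r) (length s) (\<lambda>(i, j). pvar (r ! i, s ! j)))"

definition ext_pow :: "nat list \<Rightarrow> ('k::field, nat list list) spfun" where
  "ext_pow lam = matrix_spfun (ext_basis lam) (\<lambda>T U. prod_list (map2 minor T U))"

text \<open>
  \<open>S\<^sup>\<mu>(k\<^sup>n)\<close> has as basis the tensor products of monomials. The generic matrix takes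
  the monomial \<open>e\<^bsub>w\<^sub>1\<^esub> \<dots> e\<^bsub>w\<^sub>a\<^esub>\<close> to the product of the \<open>\<Sum>\<^sub>i x\<^bsub>i w\<^sub>t\<^esub> e\<^sub>i\<close>, whose coefficient at
  a monomial is a sum over the words representing that monomial.
\<close>

definition sym_basis :: "nat list \<Rightarrow> nat \<Rightarrow> nat multiset list set" where
  "sym_basis mu n = {\<alpha>. map size \<alpha> = mu \<and> (\<forall>r\<in>set \<alpha>. set_mset r \<subseteq> {..<n})}"

definition sym_entry :: "nat multiset \<Rightarrow> nat multiset \<Rightarrow> (nat \<times> nat, 'k::field) mpol" where
  "sym_entry a b =
     (\<Sum>w | mset w = a. prod_list (map2 (\<lambda>i j. pvar (i, j)) w (sorted_list_of_multiset b)))"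

definition sym_pow :: "nat list \<Rightarrow> ('k::field, nat multiset list) spfun" where
  "sym_pow mu = matrix_spfun (sym_basis mu) (\<lambda>\<alpha> \<beta>. prod_list (map2 sym_entry \<alpha> \<beta>))"


section \<open>Schur, Weyl and simple functors\<close>

text \<open>
  The natural monomorphism sends \<open>e\<^bsub>s\<^sub>1\<^esub> \<and> \<dots> \<and> e\<^bsub>s\<^sub>a\<^esub>\<close> to
  \<open>\<Sum>\<^sub>\<sigma> sgn(\<sigma>) e\<^bsub>s\<^sub>\<sigma>\<^sub>(\<^sub>1\<^sub>)\<^esub> \<otimes> \<dots> \<otimes> e\<^bsub>s\<^sub>\<sigma>\<^sub>(\<^sub>a\<^sub>)\<^esub>\<close>; the coefficient of the word \<open>r\<close> in this sum is the
  determinant of the matrix with entries \<open>\<delta>(r\<^sub>i, s\<^sub>j)\<close>.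
\<close>

definition antisym_coeff :: "nat list \<Rightarrow> nat list \<Rightarrow> 'k::field" where
  "antisym_coeff r s =
     det (mat (length r) (length s) (\<lambda>(i, j). if r ! i = s ! j then 1 else 0))"

definition ext_to_tensor ::
    "nat list \<Rightarrow> nat \<Rightarrow> (nat list list \<Rightarrow> 'k::field) \<Rightarrow> nat list list \<Rightarrow> 'k" where
  "ext_to_tensor lam n v T =
     (if T \<in> fillings lam n
      then \<Sum>U\<in>ext_basis lam n. prod_list (map2 antisym_coeff T U) * v U else 0)"

definition rows_to_columns ::
    "nat list \<Rightarrow> nat \<Rightarrow> (nat list list \<Rightarrow> 'k::field) \<Rightarrow> nat list list \<Rightarrow> 'k" where
  "rows_to_columns lam n t U =
     (if U \<in> fillings (conj_part lam) n then t (List.transpose U) else 0)"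

definition tensor_to_sym ::
    "nat list \<Rightarrow> nat \<Rightarrow> (nat list list \<Rightarrow> 'k::field) \<Rightarrow> nat multiset list \<Rightarrow> 'k" where
  "tensor_to_sym mu n t \<alpha> = (\<Sum>U | U \<in> fillings mu n \<and> map mset U = \<alpha>. t U)"

definition schur_map :: "nat list \<Rightarrow> ('k::field, nat list list, nat multiset list) spmor" where
  "schur_map lam n v =
     tensor_to_sym (conj_part lam) n (rows_to_columns lam n (ext_to_tensor lam n v))"

definition schur :: "nat list \<Rightarrow> ('k::field, nat multiset list) spfun" where
  "schur lam = spf_image (schur_map lam) (ext_pow lam) (sym_pow (conj_part lam))"

definition weyl :: "nat list \<Rightarrow> ('k::field, nat multiset list \<Rightarrow> 'k) spfun" where
  "weyl lam = kuhn_dual (schur lam)"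

text \<open>
  The monomorphism from the Weyl functor to \<open>\<Lambda>\<^sup>\<lambda>\<close> is the Kuhn dual of the epimorphism
  \<open>schur_map\<close> from \<open>\<Lambda>\<^sup>\<lambda>\<close> to the Schur functor, followed by the canonical isomorphism
  \<open>(\<Lambda>\<^sup>\<lambda>)\<^sup># \<cong> \<Lambda>\<^sup>\<lambda>\<close>, which takes the dual of the standard basis to the standard basis.
\<close>

definition weyl_to_ext ::
    "nat list \<Rightarrow> ('k::field, nat multiset list \<Rightarrow> 'k, nat list list) spmor" where
  "weyl_to_ext lam n \<phi> U =
     (if U \<in> ext_basis lam n then \<phi> (schur_map lam n (\<lambda>T. if T = U then 1 else 0)) else 0)"

definition simple_functor :: "nat list \<Rightarrow> ('k::field, nat multiset list) spfun" where
  "simple_functor lam =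
     spf_image (\<lambda>n \<phi>. schur_map lam n (weyl_to_ext lam n \<phi>)) (weyl lam) (schur lam)"

definition hook :: "nat \<Rightarrow> nat \<Rightarrow> nat list" where
  "hook p i = (i + 1) # replicate (p - i - 1) 1"

end

(*
  For m < p the Weyl functor W_m has the projective resolution
    0 -> D^p -> L^1 (x) D^(p-1) -> ... -> L^m (x) D^(p-m) -> W_m -> 0
  (D divided, L exterior powers), a truncation of the dual Koszul complex: L^j (x) D^(p-j) is a
  direct summand of I^(x)j (x) D^(p-j), because j! is invertible. Hence the theorem follows once
  Hom(L^j (x) D^(p-j), F_n) is k for j = n and 0 otherwise.

  By projectivity such a morphism lifts to L^n (x) D^(p-n), and it is determined by the image
  there of the generator e_0 ^ ... ^ e_(j-1) (x) e_j^(p-j). This image has weight (1, ..., 1, p-j)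
  and changes sign when two of the first j letters are exchanged. For j < n and for j > n + 1
  such a vector is killed by the Koszul differential, hence dies in F_n; for j = n it is unique
  up to a scalar modulo the kernel. For j = n + 1 it survives in the Schur functor only up to a
  factor j + (p - j) = p = 0.
*)

theory Submission imports Defs begin

section \<open>Linear maps and strict polynomial functors\<close>

text \<open>All functors are handled inside the tensor power: \<open>koszul_term p j\<close> is the
  space of functions on words that alternate in the first \<open>j\<close> letters and are symmetric
  in the others, and W_m and F_m both turn out to be quotients of \<open>koszul_term p m\<close>.
  The bridge is \<open>pairing_schur_map\<close>: paired with the Schur map of \<open>y\<close>, a
  tensor \<open>v\<close> of the Koszul term gives \<open>fact m\<close> times the pairing of
  \<open>kdiff p m v\<close> with \<open>y\<close>. Hence the kernel of the epimorphism onto W_m is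
  that of the Koszul differential, and exactness of the Koszul complex continues it to a resolution;
  the map onto F_m is \<open>fact m\<close> times \<open>kdiff p m\<close>, followed by a rotation
  of letters and the projection to symmetric powers, an explicit formula on which the weight
  arguments operate.

  The obstacle in the setting is that \<open>Ext\<close> is taken from a resolution picked by choice
  and valued in \<open>nat \<Rightarrow> 'k\<close>. Chain maps to and from the Koszul resolution,
  with composites homotopic to the identity, carry the answer over. The cohomology itself is
  immediate, since Hom into F_n is nonzero in at most one degree.\<close>

lemma fscale_apply [simp]: "fscale c v x = c * v x"
  by (simp add: fscale_def)

lemma sum_fun_apply: "(\<Sum>i\<in>I. f i) x = (\<Sum>i\<in>I. f i x)"
  for f :: "'i \<Rightarrow> 'x \<Rightarrow> 'y::comm_monoid_add"
  by (induction I rule: infinite_finite_induct) auto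

lemma fd_space_subspace: "fd_space V \<Longrightarrow> fvs.subspace V"
  unfolding fd_space_def using fvs.subspace_span by blast

lemma linear_between_in: "linear_between V W f \<Longrightarrow> v \<in> V \<Longrightarrow> f v \<in> W"
  and linear_between_add: "linear_between V W f \<Longrightarrow> v \<in> V \<Longrightarrow> w \<in> V \<Longrightarrow> f (v + w) = f v + f w"
  and linear_between_scale: "linear_between V W f \<Longrightarrow> v \<in> V \<Longrightarrow> f (fscale c v) = fscale c (f v)"
  unfolding linear_between_def by blast+

lemma linear_between_zero:
  assumes "linear_between V W f" "fvs.subspace V"
  shows "f 0 = 0"
proof -
  have "f (fscale 0 0) = fscale 0 (f 0)"
    by (intro linear_between_scale[OF assms(1)] fvs.subspace_0 assms(2))
  then show ?thesis by simp
qed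

lemma linear_between_diff:
  assumes "linear_between V W f" "fvs.subspace V" "v \<in> V" "w \<in> V"
  shows "f (v - w) = f v - f w"
proof -
  have "f v = f ((v - w) + w)" by simp
  also have "\<dots> = f (v - w) + f w"
    using assms fvs.subspace_diff by (intro linear_between_add[OF assms(1)]) auto
  finally show ?thesis by simp
qed

lemma linear_between_sum:
  assumes "linear_between V W f" "fvs.subspace V" "\<And>i. i \<in> I \<Longrightarrow> g i \<in> V"
  shows "f (\<Sum>i\<in>I. g i) = (\<Sum>i\<in>I. f (g i))"
  using assms(3)
proof (induction I rule: infinite_finite_induct)
  case (insert x F)
  have "(\<Sum>i\<in>F. g i) \<in> V" by (rule fvs.subspace_sum[OF assms(2)]) (use insert.prems in blast)
  then have "f (g x + (\<Sum>i\<in>F. g i)) = f (g x) + f (\<Sum>i\<in>F. g i)"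
    using linear_between_add[OF assms(1)] insert.prems by blast
  then show ?case using insert by (simp only: sum.insert insert_iff simp_thms)
qed (use linear_between_zero[OF assms(1,2)] in auto)

lemma linear_between_comp:
  "linear_between V W f \<Longrightarrow> linear_between W X g \<Longrightarrow> linear_between V X (\<lambda>v. g (f v))"
  unfolding linear_between_def by auto

lemma fd_space_subset:
  assumes "fvs.subspace V" "V \<subseteq> fvs.span S" "finite S"
  shows "fd_space V"
proof -
  obtain B where B: "B \<subseteq> V" "fvs.independent B" "V \<subseteq> fvs.span B"
    using fvs.maximal_independent_subset by blast
  have "finite B" using fvs.independent_span_bound[OF assms(3) B(2)] B(1) assms(2) by blast
  moreover have "V = fvs.span B"
    using B assms(1) fvs.span_minimal by blast
  ultimately show ?thesis unfolding fd_space_def by blast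
qed

lemma fd_space_supported:
  fixes V :: "('b \<Rightarrow> 'k::field) set"
  assumes "fvs.subspace V" "finite X" "\<And>v x. v \<in> V \<Longrightarrow> x \<notin> X \<Longrightarrow> v x = 0"
  shows "fd_space V"
proof (rule fd_space_subset[OF assms(1)])
  let ?d = "\<lambda>x y. if x = y then 1 else 0 :: 'k"
  show "finite (?d ` X)" using assms(2) by simp
  show "V \<subseteq> fvs.span (?d ` X)"
  proof
    fix v assume v: "v \<in> V"
    have "v y = (\<Sum>x\<in>X. fscale (v x) (?d x)) y" for y
      using assms(2) assms(3)[OF v, of y]
      by (cases "y \<in> X") (auto simp: sum_fun_apply if_distrib cong: if_cong)
    then have "v = (\<Sum>x\<in>X. fscale (v x) (?d x))" by blast
    then show "v \<in> fvs.span (?d ` X)"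
      by (metis (no_types, lifting) fvs.span_base fvs.span_scale fvs.span_sum imageI)
  qed
qed

lemma fd_space_image:
  assumes "fd_space V" "linear_between V W f"
  shows "fd_space (f ` V)"
proof -
  obtain S where S: "finite S" "V = fvs.span S" using assms(1) unfolding fd_space_def by blast
  have V: "fvs.subspace V" by (rule fd_space_subspace[OF assms(1)])
  show ?thesis
  proof (rule fd_space_subset)
    show "fvs.subspace (f ` V)"
    proof (rule fvs.subspaceI)
      show "0 \<in> f ` V" using linear_between_zero[OF assms(2) V] fvs.subspace_0[OF V] by (metis imageI)
      show "x + y \<in> f ` V" if "x \<in> f ` V" "y \<in> f ` V" for x y
        using that linear_between_add[OF assms(2)] fvs.subspace_add[OF V] by (auto simp: image_iff) metis
      show "fscale c x \<in> f ` V" if "x \<in> f ` V" for c x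
        using that linear_between_scale[OF assms(2)] fvs.subspace_scale[OF V] by (auto simp: image_iff) metis
    qed
    show "f ` V \<subseteq> fvs.span (f ` S)"
    proof clarify
      fix v assume "v \<in> V"
      then obtain u where u: "v = (\<Sum>s\<in>S. fscale (u s) s)"
        using S fvs.span_finite[OF S(1)] by auto
      have "S \<subseteq> V" using S fvs.span_superset by blast
      then have "f v = (\<Sum>s\<in>S. f (fscale (u s) s))" unfolding u
        by (intro linear_between_sum[OF assms(2) V] fvs.subspace_scale[OF V]) auto
      also have "\<dots> = (\<Sum>s\<in>S. fscale (u s) (f s))"
        using \<open>S \<subseteq> V\<close> linear_between_scale[OF assms(2)] by (intro sum.cong) auto
      also have "\<dots> \<in> fvs.span (f ` S)"
        by (intro fvs.span_sum fvs.span_scale fvs.span_base) auto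
      finally show "f v \<in> fvs.span (f ` S)" .
    qed
    show "finite (f ` S)" using S by simp
  qed
qed

text \<open>Coordinates in a finite basis, padded with zeros. They move a functor to values in
  \<open>nat \<Rightarrow> 'k\<close>, the only functors over which \<open>projective_spf\<close>
  quantifies.\<close>

lemma fd_space_coordinates:
  fixes V :: "('b \<Rightarrow> 'k::field) set"
  assumes "fd_space V"
  shows "\<exists>\<iota> :: ('b \<Rightarrow> 'k) \<Rightarrow> nat \<Rightarrow> 'k. linear_between V UNIV \<iota> \<and> inj_on \<iota> V"
proof -
  obtain S where S: "finite S" "V = fvs.span S" using assms unfolding fd_space_def by blast
  obtain B where B: "B \<subseteq> V" "fvs.independent B" "V \<subseteq> fvs.span B"
    using fvs.maximal_independent_subset by blast
  have fB: "finite B" using fvs.independent_span_bound[OF S(1) B(2)] B(1) S(2) by blast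
  then obtain e where e: "bij_betw e {..<card B} B"
    using ex_bij_betw_nat_finite by (metis atLeast0LessThan)
  define \<iota> where "\<iota> v = (\<lambda>i. if i < card B then fvs.representation B v (e i) else 0)" for v
  have "linear_between V UNIV \<iota>"
    unfolding linear_between_def \<iota>_def using B(3)
    by (auto simp: fun_eq_iff fvs.representation_add[OF B(2)] fvs.representation_scale[OF B(2)] subset_iff)
  moreover have "inj_on \<iota> V"
  proof (rule inj_onI)
    fix v w assume vw: "v \<in> V" "w \<in> V" "\<iota> v = \<iota> w"
    have "fvs.representation B v b = fvs.representation B w b" if b: "b \<in> B" for b
    proof -
      obtain i where "i < card B" "b = e i" using e b unfolding bij_betw_def by auto
      then show ?thesis using fun_cong[OF vw(3), of i] by (simp add: \<iota>_def)
    qed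
    then have "(\<Sum>b\<in>B. fscale (fvs.representation B v b) b) = (\<Sum>b\<in>B. fscale (fvs.representation B w b) b)"
      by (intro sum.cong) auto
    moreover have "(\<Sum>b\<in>B. fscale (fvs.representation B x b) b) = x" if "x \<in> V" for x
      using fvs.sum_representation_eq[OF B(2) subsetD[OF B(3) that] fB order_refl] .
    ultimately show "v = w" using vw by simp
  qed
  ultimately show ?thesis by blast
qed

section \<open>Strict polynomial functors and their morphisms\<close>

lemma spf_fd: "spf e T \<Longrightarrow> fd_space (ob T n)"
  and spf_linear_between: "spf e T \<Longrightarrow> linear_between (ob T m) (ob T n) (coef T m n M)"
  and spf_zero: "spf e T \<Longrightarrow> v \<in> ob T m \<Longrightarrow> M \<notin> monomials e n m \<Longrightarrow> coef T m n M v = 0"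
  and spf_id: "spf e T \<Longrightarrow> v \<in> ob T n \<Longrightarrow> spf_eval e T n n (\<lambda>i j. if i = j then 1 else 0) v = v"
  and spf_comp: "spf e T \<Longrightarrow> v \<in> ob T l \<Longrightarrow> coef T m n N (coef T l m M v) =
          (\<Sum>K\<in>monomials e n l. fscale (comp_coeff m N M K) (coef T l n K v))"
  unfolding spf_def by blast+

lemma spf_subspace: "spf e T \<Longrightarrow> fvs.subspace (ob T n)"
  by (intro fd_space_subspace spf_fd)

text \<open>Every axiom for \<open>T\<close> is checked on elements \<open>f n v'\<close>, where
  naturality reduces it to the axiom for \<open>S\<close>. Serves for images, for transport along
  bijections and for the simple functors.\<close>

lemma spf_surj:
  assumes S: "spf e S"
    and lin: "\<And>n. linear_between (ob S n) (ob T n) (f n)"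
    and surj: "\<And>n. f n ` ob S n = ob T n"
    and nat: "\<And>m n M v. v \<in> ob S m \<Longrightarrow> f n (coef S m n M v) = coef T m n M (f m v)"
  shows "spf e T"
  unfolding spf_def
proof (intro conjI allI ballI impI)
  note subS = spf_subspace[OF S]
  note coS = linear_between_in[OF spf_linear_between[OF S]]
  have pre: "\<exists>v'\<in>ob S n. v = f n v'" if "v \<in> ob T n" for n v
    using that unfolding surj[symmetric] by blast
  show fd: "fd_space (ob T n)" for n
    using fd_space_image[OF spf_fd[OF S] lin] surj by metis
  show "linear_between (ob T m) (ob T n) (coef T m n M)" for m n M
    unfolding linear_between_def
  proof (intro conjI allI ballI)
    fix v assume "v \<in> ob T m"
    then obtain v' where v: "v' \<in> ob S m" "v = f m v'" using pre by blast
    show "coef T m n M v \<in> ob T n"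
      using v nat linear_between_in[OF lin] coS by metis
    show "coef T m n M (fscale c v) = fscale c (coef T m n M v)" for c
    proof -
      have "coef T m n M (fscale c v) = coef T m n M (f m (fscale c v'))"
        using v linear_between_scale[OF lin] by simp
      also have "\<dots> = f n (coef S m n M (fscale c v'))"
        using nat[OF fvs.subspace_scale[OF subS v(1)]] by simp
      also have "\<dots> = fscale c (f n (coef S m n M v'))"
        by (simp only: linear_between_scale[OF spf_linear_between[OF S] v(1)] linear_between_scale[OF lin coS[OF v(1)]])
      finally show ?thesis using v nat by simp
    qed
    fix w assume "w \<in> ob T m"
    then obtain w' where w: "w' \<in> ob S m" "w = f m w'" using pre by blast
    show "coef T m n M (v + w) = coef T m n M v + coef T m n M w"
    proof -
      have "coef T m n M (v + w) = coef T m n M (f m (v' + w'))"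
        using v w linear_between_add[OF lin] by simp
      also have "\<dots> = f n (coef S m n M (v' + w'))"
        using nat[OF fvs.subspace_add[OF subS v(1) w(1)]] by simp
      also have "\<dots> = f n (coef S m n M v') + f n (coef S m n M w')"
        by (simp only: linear_between_add[OF spf_linear_between[OF S] v(1) w(1)] linear_between_add[OF lin coS[OF v(1)] coS[OF w(1)]])
      finally show ?thesis using v w nat by simp
    qed
  qed
  show "coef T m n M v = 0" if vm: "v \<in> ob T m" "M \<notin> monomials e n m" for m n M v
  proof -
    obtain v' where v: "v' \<in> ob S m" "v = f m v'" using pre[OF vm(1)] by blast
    then show ?thesis using nat[OF v(1)] spf_zero[OF S v(1) vm(2)] linear_between_zero[OF lin subS] by metis
  qed
  have sum: "f n (\<Sum>K\<in>X. fscale (c K) (coef S m n K v)) = (\<Sum>K\<in>X. fscale (c K) (coef T m n K (f m v)))"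
    if "v \<in> ob S m" for X c m n v
  proof -
    have "f n (\<Sum>K\<in>X. fscale (c K) (coef S m n K v)) = (\<Sum>K\<in>X. f n (fscale (c K) (coef S m n K v)))"
      using coS that fvs.subspace_scale[OF subS] by (intro linear_between_sum[OF lin subS]) auto
    then show ?thesis using linear_between_scale[OF lin] coS that nat by (metis (mono_tags, lifting) sum.cong)
  qed
  show "spf_eval e T n n (\<lambda>i j. if i = j then 1 else 0) v = v" if vn: "v \<in> ob T n" for n v
  proof -
    obtain v' where v: "v' \<in> ob S n" "v = f n v'" using pre[OF vn] by blast
    show ?thesis using arg_cong[OF spf_id[OF S v(1)], of "f n"] sum[OF v(1)] v(2)
      unfolding spf_eval_def by simp
  qed
  show "coef T m n N (coef T l m M v) =
          (\<Sum>K\<in>monomials e n l. fscale (comp_coeff m N M K) (coef T l n K v))"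
    if vl: "v \<in> ob T l" for l m n N M v
  proof -
    obtain v' where v: "v' \<in> ob S l" "v = f l v'" using pre[OF vl] by blast
    have "coef T m n N (coef T l m M v) = f n (coef S m n N (coef S l m M v'))"
      using v nat coS by metis
    then show ?thesis unfolding spf_comp[OF S v(1)] using sum[OF v(1)] v(2) by simp
  qed
qed

lemma spf_sub:
  assumes S: "spf e S"
    and sub: "\<And>n. fvs.subspace (ob T n)" "\<And>n. ob T n \<subseteq> ob S n"
    and co: "\<And>m n M v. v \<in> ob T m \<Longrightarrow> coef T m n M v = coef S m n M v"
    and cl: "\<And>m n M v. v \<in> ob T m \<Longrightarrow> coef S m n M v \<in> ob T n"
  shows "spf e T"
  unfolding spf_def
proof (intro conjI allI ballI impI)
  note inS = subsetD[OF sub(2)]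
  show "fd_space (ob T n)" for n
  proof -
    obtain X where "finite X" "ob S n = fvs.span X" using spf_fd[OF S] unfolding fd_space_def by blast
    then show ?thesis using fd_space_subset[OF sub(1)] sub(2) by metis
  qed
  show "linear_between (ob T m) (ob T n) (coef T m n M)" for m n M
    unfolding linear_between_def
    using co cl linear_between_add[OF spf_linear_between[OF S]] linear_between_scale[OF spf_linear_between[OF S]] inS
      fvs.subspace_add[OF sub(1)] fvs.subspace_scale[OF sub(1)] by metis
  show "coef T m n M v = 0" if "v \<in> ob T m" "M \<notin> monomials e n m" for m n M v
    using that co spf_zero[OF S] inS by metis
  show "spf_eval e T n n (\<lambda>i j. if i = j then 1 else 0) v = v" if "v \<in> ob T n" for n v
    using spf_id[OF S inS[OF that]] co that unfolding spf_eval_def by simp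
  show "coef T m n N (coef T l m M v) =
          (\<Sum>K\<in>monomials e n l. fscale (comp_coeff m N M K) (coef T l n K v))"
    if "v \<in> ob T l" for l m n N M v
    using spf_comp[OF S inS[OF that]] co[OF that] co[OF cl[OF that]] by simp
qed

lemma hom_linear_between: "f \<in> spf_hom S T \<Longrightarrow> linear_between (ob S n) (ob T n) (f n)"
  and hom_outside: "f \<in> spf_hom S T \<Longrightarrow> v \<notin> ob S n \<Longrightarrow> f n v = 0"
  and hom_coef: "f \<in> spf_hom S T \<Longrightarrow> v \<in> ob S m \<Longrightarrow> f n (coef S m n M v) = coef T m n M (f m v)"
  and hom_in: "f \<in> spf_hom S T \<Longrightarrow> v \<in> ob S n \<Longrightarrow> f n v \<in> ob T n"
  unfolding spf_hom_def linear_between_def by auto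

lemma hom_zero: "f \<in> spf_hom S T \<Longrightarrow> f n 0 = 0"
proof (cases "0 \<in> ob S n")
  case True
  then have "f n (fscale 0 0) = fscale 0 (f n 0)"
    if "f \<in> spf_hom S T" using that linear_between_scale[OF hom_linear_between] by blast
  then show "f \<in> spf_hom S T \<Longrightarrow> f n 0 = 0" by simp
qed (rule hom_outside)

lemma hom_eqI:
  assumes "f \<in> spf_hom S T" "g \<in> spf_hom S T" "\<And>n v. v \<in> ob S n \<Longrightarrow> f n v = g n v"
  shows "f = g"
  using assms hom_outside by (metis ext)

lemma hom_comp:
  assumes "f \<in> spf_hom S T" "g \<in> spf_hom T U"
  shows "(\<lambda>n v. g n (f n v)) \<in> spf_hom S U"
  unfolding spf_hom_def
  using linear_between_comp[OF hom_linear_between[OF assms(1)] hom_linear_between[OF assms(2)]]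
    hom_outside[OF assms(1)] hom_coef[OF assms(1)] hom_coef[OF assms(2)] hom_in[OF assms(1)]
    hom_zero[OF assms(2)]
  by simp

lemma hom_combine:
  assumes T: "spf e T" and f: "f \<in> spf_hom S T" and g: "g \<in> spf_hom S T"
  shows "f + g \<in> spf_hom S T" "f - g \<in> spf_hom S T" "hom_scale c f \<in> spf_hom S T"
proof -
  note sub = spf_subspace[OF T]
  note T' = linear_between_add[OF spf_linear_between[OF T]] linear_between_scale[OF spf_linear_between[OF T]] linear_between_diff[OF spf_linear_between[OF T] sub]
  note in' = fvs.subspace_add[OF sub] fvs.subspace_scale[OF sub] fvs.subspace_diff[OF sub]
  show "f + g \<in> spf_hom S T" "f - g \<in> spf_hom S T" "hom_scale c f \<in> spf_hom S T"
    using hom_linear_between[OF f] hom_linear_between[OF g] hom_outside[OF f] hom_outside[OF g]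
    unfolding spf_hom_def linear_between_def
    by (auto simp: hom_scale_def hom_coef[OF f] hom_coef[OF g] T' in' hom_in[OF f] hom_in[OF g]
        algebra_simps fun_eq_iff)
qed

lemma zero_hom:
  assumes "spf e T"
  shows "0 \<in> spf_hom S T"
  using fvs.subspace_0[OF spf_subspace[OF assms]] linear_between_zero[OF spf_linear_between[OF assms] spf_subspace[OF assms]]
  unfolding spf_hom_def linear_between_def by (auto simp: fun_eq_iff)

lemma id_hom:
  assumes "spf e T"
  shows "(\<lambda>n v. if v \<in> ob T n then v else 0) \<in> spf_hom T T"
  using linear_between_in[OF spf_linear_between[OF assms]] fvs.subspace_add[OF spf_subspace[OF assms]]
     fvs.subspace_scale[OF spf_subspace[OF assms]]
  unfolding spf_hom_def linear_between_def by auto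

lemma spf_image_spf:
  assumes "spf e S" "f \<in> spf_hom S T"
  shows "spf e (spf_image f S T)"
  by (rule spf_surj[OF assms(1), where f = f])
    (use hom_linear_between[OF assms(2)] hom_coef[OF assms(2)] in \<open>auto simp: spf_image_def linear_between_def\<close>)

text \<open>Coordinates are chosen for each \<open>n\<close> separately; the coefficients of the new
  functor are the old ones conjugated by them, so that naturality holds by construction.\<close>

lemma nat_model:
  fixes T :: "('k::field, 'b) spfun"
  assumes T: "spf e T"
  obtains T' :: "('k, nat) spfun" and \<iota> \<kappa> where
    "spf e T'" "\<iota> \<in> spf_hom T T'" "\<kappa> \<in> spf_hom T' T"
    "\<And>n v. v \<in> ob T n \<Longrightarrow> \<kappa> n (\<iota> n v) = v" "\<And>n v. v \<in> ob T' n \<Longrightarrow> \<iota> n (\<kappa> n v) = v"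
proof -
  have "\<exists>c :: ('b \<Rightarrow> 'k) \<Rightarrow> nat \<Rightarrow> 'k. linear_between (ob T n) UNIV c \<and> inj_on c (ob T n)" for n
    by (rule fd_space_coordinates[OF spf_fd[OF T]])
  then obtain c :: "nat \<Rightarrow> ('b \<Rightarrow> 'k) \<Rightarrow> nat \<Rightarrow> 'k" where
    c: "\<And>n. linear_between (ob T n) UNIV (c n)" "\<And>n. inj_on (c n) (ob T n)"
    by metis
  define r where "r n = inv_into (ob T n) (c n)" for n
  define T' where "T' = \<lparr>ob = (\<lambda>n. c n ` ob T n), coef = (\<lambda>m n M x. c n (coef T m n M (r m x)))\<rparr>"
  define \<iota> where "\<iota> n v = (if v \<in> ob T n then c n v else 0)" for n v
  define \<kappa> where "\<kappa> n v = (if v \<in> ob T' n then r n v else 0)" for n v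
  have r: "r n (c n v) = v" if "v \<in> ob T n" for n v
    using that c(2) unfolding r_def by (rule inv_into_f_f[rotated])
  have obT': "ob T' n = c n ` ob T n" for n by (simp add: T'_def)
  have lin: "linear_between (ob T n) (ob T' n) (c n)" for n
    using c(1)[of n] unfolding linear_between_def obT' by auto
  have nat: "c n (coef T m n M v) = coef T' m n M (c m v)" if "v \<in> ob T m" for m n M v
    using that r by (simp add: T'_def)
  have spf': "spf e T'"
    by (rule spf_surj[OF T lin obT'[symmetric] nat])
  note cl = fvs.subspace_add[OF spf_subspace[OF T]] fvs.subspace_scale[OF spf_subspace[OF T]]
  have \<iota>: "\<iota> \<in> spf_hom T T'"
    using lin cl nat linear_between_in[OF spf_linear_between[OF T]]
    unfolding spf_hom_def \<iota>_def linear_between_def by auto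
  have rlin: "linear_between (ob T' n) (ob T n) (r n)" for n
    unfolding linear_between_def obT'
    using r cl linear_between_add[OF lin] linear_between_scale[OF lin] by (auto simp: r) (metis r)+
  have \<kappa>: "\<kappa> \<in> spf_hom T' T"
  proof -
    have "r n (coef T' m n M v) = coef T m n M (r m v)" if "v \<in> ob T' m" for m n M v
      using that linear_between_in[OF spf_linear_between[OF T]] by (auto simp: obT' nat[symmetric] r)
    then show ?thesis
      using rlin fvs.subspace_add[OF spf_subspace[OF spf']] fvs.subspace_scale[OF spf_subspace[OF spf']]
        linear_between_in[OF spf_linear_between[OF spf']]
      unfolding spf_hom_def \<kappa>_def linear_between_def by auto
  qed
  show thesis
  proof
    show "spf e T'" "\<iota> \<in> spf_hom T T'" "\<kappa> \<in> spf_hom T' T" by fact+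
    show "\<kappa> n (\<iota> n v) = v" if "v \<in> ob T n" for n v
      using that by (auto simp: \<iota>_def \<kappa>_def obT' r)
    show "\<iota> n (\<kappa> n v) = v" if "v \<in> ob T' n" for n v
      using that by (auto simp: \<iota>_def \<kappa>_def obT' r)
  qed
qed

section \<open>Lifting along epimorphisms\<close>

lemma projective_spfD:
  fixes P S T :: "('k::field, nat) spfun"
  shows "projective_spf e P \<Longrightarrow> spf e S \<Longrightarrow> spf e T \<Longrightarrow> g \<in> spf_hom S T \<Longrightarrow>
    (\<And>n. g n ` ob S n = ob T n) \<Longrightarrow> f \<in> spf_hom P T \<Longrightarrow>
    \<exists>h\<in>spf_hom P S. \<forall>n. \<forall>v\<in>ob P n. g n (h n v) = f n v"
  unfolding projective_spf_def by blast

text \<open>A target over another index type is replaced by its model in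
  \<open>nat \<Rightarrow> 'k\<close>; the morphism is lifted there and the equation is pulled back
  along \<open>\<kappa>\<close>.\<close>

lemma projective_lift:
  fixes S :: "('k::field, nat) spfun" and T :: "('k, 'b) spfun"
  assumes P: "projective_spf e P" and S: "spf e S" and T: "spf e T"
    and g: "g \<in> spf_hom S T" "\<And>n. g n ` ob S n = ob T n" and f: "f \<in> spf_hom P T"
  shows "\<exists>h\<in>spf_hom P S. \<forall>n. \<forall>v\<in>ob P n. g n (h n v) = f n v"
proof -
  obtain T' :: "('k, nat) spfun" and \<iota> \<kappa> where T':
    "spf e T'" "\<iota> \<in> spf_hom T T'" "\<kappa> \<in> spf_hom T' T"
    "\<And>n v. v \<in> ob T n \<Longrightarrow> \<kappa> n (\<iota> n v) = v" "\<And>n v. v \<in> ob T' n \<Longrightarrow> \<iota> n (\<kappa> n v) = v"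
    by (rule nat_model[OF T]) (rule that)
  have "(\<lambda>v. \<iota> n (g n v)) ` ob S n = ob T' n" for n
  proof -
    have "(\<lambda>v. \<iota> n (g n v)) ` ob S n = \<iota> n ` ob T n" by (simp add: g(2)[symmetric] image_image)
    also have "\<dots> = ob T' n" using T'(5) hom_in[OF T'(2)] hom_in[OF T'(3)] by force
    finally show ?thesis .
  qed
  then obtain h where h: "h \<in> spf_hom P S" "\<forall>n. \<forall>v\<in>ob P n. \<iota> n (g n (h n v)) = \<iota> n (f n v)"
    using projective_spfD[OF P S T'(1) hom_comp[OF g(1) T'(2)] _ hom_comp[OF f T'(2)]] by blast
  have "g n (h n v) = f n v" if "v \<in> ob P n" for n v
  proof -
    have "\<kappa> n (\<iota> n (g n (h n v))) = \<kappa> n (\<iota> n (f n v))" using h(2) that by simp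
    then show ?thesis
      by (simp only: T'(4)[OF hom_in[OF g(1) hom_in[OF h(1) that]]] T'(4)[OF hom_in[OF f that]])
  qed
  with h(1) show ?thesis by blast
qed

text \<open>The form in which lifting is used for resolutions: exactness supplies the inclusion into
  the image of \<open>d\<close>, and the corestriction of \<open>d\<close> to its image is an
  epimorphism.\<close>

lemma projective_lift_image:
  fixes Q :: "('k::field, nat) spfun" and R :: "('k, 'b) spfun"
  assumes P: "projective_spf e P" and Q: "spf e Q"
    and d: "d \<in> spf_hom Q R" and u: "u \<in> spf_hom P R"
    and im: "\<And>n v. v \<in> ob P n \<Longrightarrow> u n v \<in> d n ` ob Q n"
  shows "\<exists>h\<in>spf_hom P Q. \<forall>n. \<forall>v\<in>ob P n. d n (h n v) = u n v"
proof (rule projective_lift[OF P Q spf_image_spf[OF Q d]])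
  show "d \<in> spf_hom Q (spf_image d Q R)"
    using d unfolding spf_hom_def spf_image_def linear_between_def by auto
  show "d n ` ob Q n = ob (spf_image d Q R) n" for n by (simp add: spf_image_def)
  show "u \<in> spf_hom P (spf_image d Q R)"
    using u im unfolding spf_hom_def spf_image_def linear_between_def by auto
qed

section \<open>Comparison of projective resolutions\<close>

lemma hom_diff: "f \<in> spf_hom S T \<Longrightarrow> fvs.subspace (ob S n) \<Longrightarrow> v \<in> ob S n \<Longrightarrow> w \<in> ob S n
    \<Longrightarrow> f n (v - w) = f n v - f n w"
  by (rule linear_between_diff[OF hom_linear_between])

context
  fixes e :: nat and A :: "('k::field, 'b) spfun" and P d a
  assumes res: "projective_resolution e A P d a"
begin

lemma res_proj: "projective_spf e (P i)" "spf e (P i)"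
  and res_hom: "d i \<in> spf_hom (P (Suc i)) (P i)"
  and res_aug: "a \<in> spf_hom (P 0) A"
  and res_surj: "a n ` ob (P 0) n = ob A n"
  and res_exact0: "d 0 n ` ob (P (Suc 0)) n = {v \<in> ob (P 0) n. a n v = 0}"
  and res_exact: "d (Suc i) n ` ob (P (Suc (Suc i))) n = {v \<in> ob (P (Suc i)) n. d i n v = 0}"
proof -
  note r = res[unfolded projective_resolution_def]
  show "projective_spf e (P i)" by (rule conjunct1[OF r, rule_format])
  then show "spf e (P i)" unfolding projective_spf_def by (rule conjunct1)
  show "d i \<in> spf_hom (P (Suc i)) (P i)" by (rule r[THEN conjunct2, THEN conjunct1, rule_format])
  show "a \<in> spf_hom (P 0) A" by (rule r[THEN conjunct2, THEN conjunct2, THEN conjunct1])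
  show "a n ` ob (P 0) n = ob A n"
    by (rule r[THEN conjunct2, THEN conjunct2, THEN conjunct2, THEN conjunct1, rule_format])
  show "d 0 n ` ob (P (Suc 0)) n = {v \<in> ob (P 0) n. a n v = 0}"
    by (rule r[THEN conjunct2, THEN conjunct2, THEN conjunct2, THEN conjunct2, THEN conjunct1, rule_format])
  show "d (Suc i) n ` ob (P (Suc (Suc i))) n = {v \<in> ob (P (Suc i)) n. d i n v = 0}"
    by (rule r[THEN conjunct2, THEN conjunct2, THEN conjunct2, THEN conjunct2, THEN conjunct2, rule_format])
qed

lemma res_aug_zero: "v \<in> ob (P (Suc 0)) n \<Longrightarrow> a n (d 0 n v) = 0"
  using res_exact0[of n] by blast

lemma res_dd: "v \<in> ob (P (Suc (Suc i))) n \<Longrightarrow> d i n (d (Suc i) n v) = 0"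
  using res_exact[of i n] by blast

end

definition chain_map ::
    "(nat \<Rightarrow> ('k::field, nat) spfun) \<Rightarrow> (nat \<Rightarrow> ('k, nat, nat) spmor) \<Rightarrow> ('k, nat, 'b) spmor \<Rightarrow>
     (nat \<Rightarrow> ('k, nat) spfun) \<Rightarrow> (nat \<Rightarrow> ('k, nat, nat) spmor) \<Rightarrow> ('k, nat, 'b) spmor \<Rightarrow>
     (nat \<Rightarrow> ('k, nat, nat) spmor) \<Rightarrow> bool" where
  "chain_map P d a Q c b f \<longleftrightarrow>
     (\<forall>i. f i \<in> spf_hom (P i) (Q i)) \<and>
     (\<forall>n. \<forall>v\<in>ob (P 0) n. b n (f 0 n v) = a n v) \<and>
     (\<forall>i n. \<forall>v\<in>ob (P (Suc i)) n. c i n (f (Suc i) n v) = f i n (d i n v))"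

lemma chain_map_hom: "chain_map P d a Q c b f \<Longrightarrow> f i \<in> spf_hom (P i) (Q i)"
  and chain_map_aug: "chain_map P d a Q c b f \<Longrightarrow> v \<in> ob (P 0) n \<Longrightarrow> b n (f 0 n v) = a n v"
  and chain_map_comm: "chain_map P d a Q c b f \<Longrightarrow> v \<in> ob (P (Suc i)) n \<Longrightarrow>
    c i n (f (Suc i) n v) = f i n (d i n v)"
  by (simp_all add: chain_map_def)

lemma chain_map_comp:
  assumes "chain_map P d a Q c b f" "chain_map Q c b R k x g"
  shows "chain_map P d a R k x (\<lambda>i n v. g i n (f i n v))"
  unfolding chain_map_def
  using hom_comp[OF chain_map_hom[OF assms(1)] chain_map_hom[OF assms(2)]]
    hom_in[OF chain_map_hom[OF assms(1)]] chain_map_aug[OF assms(1)] chain_map_aug[OF assms(2)]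
    chain_map_comm[OF assms(1)] chain_map_comm[OF assms(2)]
  by simp

text \<open>A chain homotopy between \<open>f\<close> and the identity; the usual notion of
  contraction is, up to sign, the case \<open>f = 0\<close>.\<close>

definition contraction ::
    "(nat \<Rightarrow> ('k::field, nat) spfun) \<Rightarrow> (nat \<Rightarrow> ('k, nat, nat) spmor) \<Rightarrow>
     (nat \<Rightarrow> ('k, nat, nat) spmor) \<Rightarrow> (nat \<Rightarrow> ('k, nat, nat) spmor) \<Rightarrow> bool" where
  "contraction P d f s \<longleftrightarrow>
     (\<forall>i. s i \<in> spf_hom (P i) (P (Suc i))) \<and>
     (\<forall>n. \<forall>v\<in>ob (P 0) n. f 0 n v - v = d 0 n (s 0 n v)) \<and>
     (\<forall>i n. \<forall>v\<in>ob (P (Suc i)) n.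
        f (Suc i) n v - v = d (Suc i) n (s (Suc i) n v) + s i n (d i n v))"

lemma chain_map_exists:
  fixes A :: "('k::field, 'b) spfun"
  assumes P: "projective_resolution e A P d a" and Q: "projective_resolution e A Q c b"
  shows "\<exists>f. chain_map P d a Q c b f"
proof -
  \<comment> \<open>Invariant of the recursion: the second clause, that boundaries go to boundaries,
    is what the next lift needs; the third ties the start to the augmentations.\<close>
  let ?R = "\<lambda>i f. f \<in> spf_hom (P i) (Q i) \<and>
    (\<forall>n. \<forall>v\<in>ob (P (Suc i)) n. f n (d i n v) \<in> c i n ` ob (Q (Suc i)) n) \<and>
    (i = 0 \<longrightarrow> (\<forall>n. \<forall>v\<in>ob (P 0) n. b n (f n v) = a n v))"
  have "\<exists>f. \<forall>i. ?R i (f i) \<and> (\<forall>n. \<forall>v\<in>ob (P (Suc i)) n. c i n (f (Suc i) n v) = f i n (d i n v))"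
  proof (rule dependent_nat_choice)
    have "\<exists>h\<in>spf_hom (P 0) (Q 0). \<forall>n. \<forall>v\<in>ob (P 0) n. b n (h n v) = a n v"
    proof (rule projective_lift_image[OF res_proj(1)[OF P] res_proj(2)[OF Q] res_aug[OF Q] res_aug[OF P]])
      show "a n v \<in> b n ` ob (Q 0) n" if "v \<in> ob (P 0) n" for n v
        using hom_in[OF res_aug[OF P] that] res_surj[OF Q] by simp
    qed
    then obtain h where h: "h \<in> spf_hom (P 0) (Q 0)" "\<And>n v. v \<in> ob (P 0) n \<Longrightarrow> b n (h n v) = a n v"
      by blast
    have "h n (d 0 n v) \<in> c 0 n ` ob (Q (Suc 0)) n" if "v \<in> ob (P (Suc 0)) n" for n v
      unfolding res_exact0[OF Q]
      using hom_in[OF res_hom[OF P] that] hom_in[OF h(1)] h(2) res_aug_zero[OF P that] by simp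
    with h show "\<exists>f. ?R 0 f" by blast
  next
    fix f i assume f: "?R i f"
    have fd: "(\<lambda>n v. f n (d i n v)) \<in> spf_hom (P (Suc i)) (Q i)"
      using f hom_comp[OF res_hom[OF P]] by blast
    have "\<exists>g\<in>spf_hom (P (Suc i)) (Q (Suc i)). \<forall>n. \<forall>v\<in>ob (P (Suc i)) n. c i n (g n v) = f n (d i n v)"
      using f by (intro projective_lift_image[OF res_proj(1)[OF P] res_proj(2)[OF Q] res_hom[OF Q] fd]) blast
    then obtain g where g: "g \<in> spf_hom (P (Suc i)) (Q (Suc i))"
      "\<And>n v. v \<in> ob (P (Suc i)) n \<Longrightarrow> c i n (g n v) = f n (d i n v)" by blast
    have "g n (d (Suc i) n v) \<in> c (Suc i) n ` ob (Q (Suc (Suc i))) n" if v: "v \<in> ob (P (Suc (Suc i))) n" for n v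
    proof -
      have v': "d (Suc i) n v \<in> ob (P (Suc i)) n" using hom_in[OF res_hom[OF P] v] .
      have "f n 0 = 0" using f hom_zero by blast
      then show ?thesis
        unfolding res_exact[OF Q] using g(2)[OF v'] hom_in[OF g(1) v'] res_dd[OF P v] by simp
    qed
    with g show "\<exists>g. ?R (Suc i) g \<and> (\<forall>n. \<forall>v\<in>ob (P (Suc i)) n. c i n (g n v) = f n (d i n v))"
      by blast
  qed
  then obtain f where f: "\<forall>i. ?R i (f i) \<and> (\<forall>n. \<forall>v\<in>ob (P (Suc i)) n. c i n (f (Suc i) n v) = f i n (d i n v))" ..
  then have "chain_map P d a Q c b f" unfolding chain_map_def by blast
  then show ?thesis by blast
qed

lemma homotopy_exists:
  fixes A :: "('k::field, 'b) spfun"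
  assumes P: "projective_resolution e A P d a"
    and chain: "chain_map P d a P d a f"
  shows "\<exists>s. contraction P d f s"
proof -
  note f = chain_map_hom[OF chain] chain_map_aug[OF chain] chain_map_comm[OF chain]
  note sub = spf_subspace[OF res_proj(2)[OF P]]
  let ?id = "\<lambda>i n v. if v \<in> ob (P i) n then v else 0"
  \<comment> \<open>The second clause, the homotopy equation restricted to boundaries, makes the
    error term of the next degree a cycle.\<close>
  let ?R = "\<lambda>i s. s \<in> spf_hom (P i) (P (Suc i)) \<and>
    (\<forall>n. \<forall>v\<in>ob (P (Suc i)) n. f i n (d i n v) - d i n v = d i n (s n (d i n v))) \<and>
    (i = 0 \<longrightarrow> (\<forall>n. \<forall>v\<in>ob (P 0) n. f 0 n v - v = d 0 n (s n v)))"
  have "\<exists>s. \<forall>i. ?R i (s i) \<and>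
    (\<forall>n. \<forall>v\<in>ob (P (Suc i)) n. f (Suc i) n v - v = d (Suc i) n (s (Suc i) n v) + s i n (d i n v))"
  proof (rule dependent_nat_choice)
    have u: "f 0 - ?id 0 \<in> spf_hom (P 0) (P 0)"
      by (rule hom_combine(2)[OF res_proj(2)[OF P] f(1) id_hom[OF res_proj(2)[OF P]]])
    have "\<exists>h\<in>spf_hom (P 0) (P (Suc 0)). \<forall>n. \<forall>v\<in>ob (P 0) n. d 0 n (h n v) = (f 0 - ?id 0) n v"
    proof (rule projective_lift_image[OF res_proj(1)[OF P] res_proj(2)[OF P] res_hom[OF P] u])
      show "(f 0 - ?id 0) n v \<in> d 0 n ` ob (P (Suc 0)) n" if "v \<in> ob (P 0) n" for n v
        using that hom_in[OF u that] f(2)[OF that] hom_diff[OF res_aug[OF P] sub hom_in[OF f(1) that] that]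
        unfolding res_exact0[OF P] by simp
    qed
    then obtain s where s: "s \<in> spf_hom (P 0) (P (Suc 0))"
      "\<And>n v. v \<in> ob (P 0) n \<Longrightarrow> f 0 n v - v = d 0 n (s n v)" by force
    moreover have "f 0 n (d 0 n v) - d 0 n v = d 0 n (s n (d 0 n v))" if "v \<in> ob (P (Suc 0)) n" for n v
      using s(2)[OF hom_in[OF res_hom[OF P] that]] .
    ultimately show "\<exists>s. ?R 0 s" by blast
  next
    fix s i assume s: "?R i s"
    \<comment> \<open>The part of \<open>f\<close> minus the identity that is not yet accounted for
      by \<open>s\<close>; it is a cycle, so it lifts along \<open>d (Suc i)\<close>.\<close>
    let ?u = "f (Suc i) - ?id (Suc i) - (\<lambda>n v. s n (d i n v))"
    have u: "?u \<in> spf_hom (P (Suc i)) (P (Suc i))"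
      using s by (intro hom_combine(2)[OF res_proj(2)[OF P]] f(1) id_hom[OF res_proj(2)[OF P]] hom_comp[OF res_hom[OF P]]) blast
    have "\<exists>h\<in>spf_hom (P (Suc i)) (P (Suc (Suc i))). \<forall>n. \<forall>v\<in>ob (P (Suc i)) n. d (Suc i) n (h n v) = ?u n v"
    proof (rule projective_lift_image[OF res_proj(1)[OF P] res_proj(2)[OF P] res_hom[OF P] u])
      show "?u n v \<in> d (Suc i) n ` ob (P (Suc (Suc i))) n" if v: "v \<in> ob (P (Suc i)) n" for n v
      proof -
        have dv: "d i n v \<in> ob (P i) n" using hom_in[OF res_hom[OF P] v] .
        have sdv: "s n (d i n v) \<in> ob (P (Suc i)) n" using s hom_in dv by blast
        have fv: "f (Suc i) n v \<in> ob (P (Suc i)) n" using hom_in[OF f(1) v] .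
        have "?u n v = f (Suc i) n v - v - s n (d i n v)" using v by simp
        then have "d i n (?u n v) = d i n (f (Suc i) n v - v - s n (d i n v))" by (rule arg_cong)
        also have "\<dots> = d i n (f (Suc i) n v) - d i n v - d i n (s n (d i n v))"
          by (simp only: hom_diff[OF res_hom[OF P] sub fvs.subspace_diff[OF sub fv v] sdv]
              hom_diff[OF res_hom[OF P] sub fv v])
        also have "\<dots> = 0" using s v f(3)[OF v] by simp
        finally show ?thesis unfolding res_exact[OF P] using hom_in[OF u v] by simp
      qed
    qed
    then obtain t where t: "t \<in> spf_hom (P (Suc i)) (P (Suc (Suc i)))"
      "\<And>n v. v \<in> ob (P (Suc i)) n \<Longrightarrow> d (Suc i) n (t n v) = ?u n v" by blast
    have t': "f (Suc i) n v - v = d (Suc i) n (t n v) + s n (d i n v)" if "v \<in> ob (P (Suc i)) n" for n v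
      using t(2)[OF that] that by simp
    have "f (Suc i) n (d (Suc i) n v) - d (Suc i) n v = d (Suc i) n (t n (d (Suc i) n v))"
      if "v \<in> ob (P (Suc (Suc i))) n" for n v
    proof -
      have "s n 0 = 0" using s hom_zero by blast
      then show ?thesis
        using t'[OF hom_in[OF res_hom[OF P] that]] res_dd[OF P that] by simp
    qed
    with t t' show "\<exists>t. ?R (Suc i) t \<and>
        (\<forall>n. \<forall>v\<in>ob (P (Suc i)) n. f (Suc i) n v - v = d (Suc i) n (t n v) + s n (d i n v))"
      by blast
  qed
  then obtain s where s: "\<forall>i. ?R i (s i) \<and>
    (\<forall>n. \<forall>v\<in>ob (P (Suc i)) n. f (Suc i) n v - v = d (Suc i) n (s (Suc i) n v) + s i n (d i n v))" ..
  then have "contraction P d f s" unfolding contraction_def by blast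
  then show ?thesis by blast
qed

text \<open>On \<open>f\<close> minus the identity, \<open>x\<close> kills the summand that ends
  with \<open>d\<close>; what is left is \<open>x\<close> after \<open>s\<close> after
  \<open>d\<close>, the coboundary of \<open>x\<close> after \<open>s\<close>. In degree 0 nothing
  is left.\<close>

lemma homotopy_cocycle:
  assumes P: "projective_resolution e A P d a" and B: "spf e B"
    and chain: "chain_map P d a P d a f"
    and x: "x \<in> cocycles P d B q"
  shows "(\<lambda>n v. x n (f q n v)) - x \<in> coboundaries P d B q"
proof -
  have xh: "x \<in> spf_hom (P q) B" and x0: "\<And>n v. v \<in> ob (P (Suc q)) n \<Longrightarrow> x n (d q n v) = 0"
    using x unfolding cocycles_def by auto
  note sub = spf_subspace[OF res_proj(2)[OF P]]
  note f = chain_map_hom[OF chain]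
  obtain s where con: "contraction P d f s" using homotopy_exists[OF P chain] by blast
  have s: "s i \<in> spf_hom (P i) (P (Suc i))"
    "v \<in> ob (P 0) n \<Longrightarrow> f 0 n v - v = d 0 n (s 0 n v)"
    "v \<in> ob (P (Suc i)) n \<Longrightarrow> f (Suc i) n v - v = d (Suc i) n (s (Suc i) n v) + s i n (d i n v)" for i n v
    using con by (simp_all add: contraction_def)
  have fx: "(\<lambda>n v. x n (f q n v)) \<in> spf_hom (P q) B" by (rule hom_comp[OF f xh])
  have diff: "x n (f q n v) - x n v = x n (f q n v - v)" if "v \<in> ob (P q) n" for n v
    using hom_diff[OF xh sub hom_in[OF f that] that] by simp
  show ?thesis
  proof (cases q)
    case 0
    have "(\<lambda>n v. x n (f q n v)) - x = 0"
    proof (rule hom_eqI[OF hom_combine(2)[OF B fx xh] zero_hom[OF B]])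
      fix n v assume v: "v \<in> ob (P q) n"
      have "x n (f q n v) - x n v = x n (d q n (s q n v))"
        using diff[OF v] s(2) v 0 by simp
      then show "((\<lambda>n v. x n (f q n v)) - x) n v = 0 n v"
        using x0[OF hom_in[OF s(1) v]] by simp
    qed
    then show ?thesis by (simp add: coboundaries_def 0)
  next
    case (Suc r)
    have xs: "(\<lambda>n v. x n (s r n v)) \<in> spf_hom (P r) B"
      using hom_comp[OF s(1) xh[unfolded Suc]] .
    have xsd: "(\<lambda>n v. x n (s r n (d r n v))) \<in> spf_hom (P q) B"
      unfolding Suc using hom_comp[OF res_hom[OF P] xs] .
    have "(\<lambda>n v. x n (f q n v)) - x = (\<lambda>n v. x n (s r n (d r n v)))"
    proof (rule hom_eqI[OF hom_combine(2)[OF B fx xh] xsd])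
      fix n v assume v: "v \<in> ob (P q) n"
      have v': "v \<in> ob (P (Suc r)) n" using v Suc by simp
      have 1: "d q n (s q n v) \<in> ob (P q) n" by (rule hom_in[OF res_hom[OF P] hom_in[OF s(1) v]])
      have 2: "s r n (d r n v) \<in> ob (P q) n"
        unfolding Suc by (rule hom_in[OF s(1) hom_in[OF res_hom[OF P] v']])
      have "x n (f q n v) - x n v = x n (d q n (s q n v) + s r n (d r n v))"
        unfolding diff[OF v] using s(3)[OF v'] Suc by simp
      also have "\<dots> = x n (d q n (s q n v)) + x n (s r n (d r n v))"
        by (rule linear_between_add[OF hom_linear_between[OF xh] 1 2])
      finally show "((\<lambda>n v. x n (f q n v)) - x) n v = x n (s r n (d r n v))"
        using x0[OF hom_in[OF s(1) v]] by simp
    qed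
    then show ?thesis using xs by (auto simp: coboundaries_def Suc)
  qed
qed

section \<open>Cocycles modulo coboundaries\<close>

lemma coboundaries_subset:
  assumes P: "projective_resolution e A P d a" and B: "spf e B"
  shows "coboundaries P d B q \<subseteq> cocycles P d B q"
proof (cases q)
  case 0
  then show ?thesis using zero_hom[OF B] by (auto simp: coboundaries_def cocycles_def)
next
  case (Suc r)
  have "(\<lambda>n v. g n (d r n v)) \<in> cocycles P d B q" if g: "g \<in> spf_hom (P r) B" for g
    unfolding cocycles_def Suc using hom_comp[OF res_hom[OF P] g] res_dd[OF P] hom_zero[OF g] by auto
  then show ?thesis by (auto simp: coboundaries_def Suc)
qed

global_interpretation homs: vector_space "hom_scale :: 'k::field \<Rightarrow> ('k, 'b, 'c) spmor \<Rightarrow> ('k, 'b, 'c) spmor"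
  by unfold_locales (auto simp: hom_scale_def fun_eq_iff algebra_simps)

lemma coboundaries_subspace:
  assumes P: "projective_resolution e A P d a" and B: "spf e B"
  shows "homs.subspace (coboundaries P d B q)"
proof (cases q)
  case 0
  then show ?thesis by (simp add: coboundaries_def)
next
  case (Suc r)
  let ?c = "\<lambda>g n v. g n (d r n v)"
  have "coboundaries P d B q = ?c ` spf_hom (P r) B" by (auto simp: coboundaries_def Suc)
  moreover have "homs.subspace (?c ` spf_hom (P r) B)"
  proof (rule homs.subspaceI)
    show "0 \<in> ?c ` spf_hom (P r) B" by (rule image_eqI[OF _ zero_hom[OF B]]) (auto simp: fun_eq_iff)
    show "x + y \<in> ?c ` spf_hom (P r) B" if "x \<in> ?c ` spf_hom (P r) B" "y \<in> ?c ` spf_hom (P r) B" for x y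
    proof -
      from that obtain g h where "g \<in> spf_hom (P r) B" "h \<in> spf_hom (P r) B" "x = ?c g" "y = ?c h" by blast
      then show ?thesis
        by (intro image_eqI[of _ _ "g + h"]) (auto simp: fun_eq_iff intro: hom_combine(1)[OF B])
    qed
    show "hom_scale t x \<in> ?c ` spf_hom (P r) B" if "x \<in> ?c ` spf_hom (P r) B" for t x
    proof -
      from that obtain g where "g \<in> spf_hom (P r) B" "x = ?c g" by blast
      then show ?thesis
        by (intro image_eqI[of _ _ "hom_scale t g"]) (auto simp: hom_scale_def intro: hom_combine(3)[OF B, unfolded hom_scale_def])
    qed
  qed
  ultimately show ?thesis by simp
qed

lemma zero_space_quotient: "zero_space (quotient_space sc U U)" if "module.subspace sc U" "vector_space sc"
  for sc :: "'k::field \<Rightarrow> 'h::ab_group_add \<Rightarrow> 'h"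
proof -
  interpret vector_space sc by fact
  have "coset_of U x = U" if "x \<in> U" for x
  proof -
    have "y \<in> (+) x ` U" if "y \<in> U" for y
      using subspace_diff[OF \<open>subspace U\<close> that \<open>x \<in> U\<close>] by (intro image_eqI[of _ _ "y - x"]) auto
    then show ?thesis unfolding coset_of_def using subspace_add[OF \<open>subspace U\<close> \<open>x \<in> U\<close>] by auto
  qed
  then have "coset_of U ` U = {U}" using subspace_0[OF \<open>subspace U\<close>] by auto
  then show ?thesis unfolding zero_space_def quotient_space_def by simp
qed

text \<open>The cosets of the multiples of \<open>z\<close> exhaust the quotient, and they are
  pairwise distinct because \<open>z\<close> lies outside \<open>U\<close>; the isomorphism reads
  off the multiple.\<close>

lemma iso_to_field_quotient:
  fixes sc :: "'k::field \<Rightarrow> 'h::ab_group_add \<Rightarrow> 'h"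
  assumes vs: "vector_space sc" and U: "module.subspace sc U"
    and Z: "Z = {sc t z + u | t u. u \<in> U}" and z: "z \<notin> U"
  shows "iso_to_field (quotient_space sc Z U)"
proof -
  interpret vector_space sc by fact
  note U' = subspace_add[OF U] subspace_diff[OF U] subspace_scale[OF U] subspace_0[OF U]
  define X where "X t = coset_of U (sc t z)" for t
  have X: "y \<in> X t \<longleftrightarrow> y - sc t z \<in> U" for y t
  proof
    show "y \<in> X t" if "y - sc t z \<in> U"
      unfolding X_def coset_of_def using that by (intro image_eqI[of _ _ "y - sc t z"]) auto
  qed (auto simp: X_def coset_of_def)
  have inj: "s = t" if "X s = X t" for s t
  proof (rule ccontr)
    assume "s \<noteq> t"
    have "sc s z \<in> X t" unfolding that[symmetric] X using U'(4) by simp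
    then have "sc (s - t) z \<in> U" unfolding X by (simp add: scale_left_diff_distrib)
    then have "sc (1 / (s - t)) (sc (s - t) z) \<in> U" by (rule U'(3))
    then show False using z \<open>s \<noteq> t\<close> by simp
  qed
  have coset: "coset_of U (sc t z + u) = X t" if u: "u \<in> U" for t u
  proof -
    have "coset_of U (sc t z + u) = {y. y - (sc t z + u) \<in> U}"
    proof (intro subset_antisym subsetI)
      fix y assume "y \<in> {y. y - (sc t z + u) \<in> U}"
      then show "y \<in> coset_of U (sc t z + u)"
        unfolding coset_of_def by (intro image_eqI[of _ _ "y - (sc t z + u)"]) auto
    next
      fix y assume "y \<in> coset_of U (sc t z + u)"
      then show "y \<in> {y. y - (sc t z + u) \<in> U}" by (auto simp: coset_of_def)
    qed
    also have "\<dots> = X t"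
    proof (intro Set.set_eqI)
      fix y
      have "y - (sc t z + u) = (y - sc t z) - u" "y - sc t z = (y - (sc t z + u)) + u"
        by (auto simp: algebra_simps)
      then show "y \<in> {y. y - (sc t z + u) \<in> U} \<longleftrightarrow> y \<in> X t"
        unfolding X mem_Collect_eq using U'(1)[OF _ u] U'(2)[OF _ u] by metis
    qed
    finally show ?thesis .
  qed
  have "range X \<subseteq> coset_of U ` Z"
  proof clarify
    fix t
    have "sc t z + 0 \<in> Z" unfolding Z using U'(4) by blast
    then show "X t \<in> coset_of U ` Z" using coset[OF U'(4), of t] by (metis imageI)
  qed
  moreover have "coset_of U ` Z \<subseteq> range X" unfolding Z using coset by auto
  ultimately have car: "coset_of U ` Z = range X" by blast
  define \<phi> where "\<phi> = inv_into UNIV X"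
  have injX: "inj X" using inj by (rule injI)
  then have \<phi>: "\<phi> (X t) = t" for t unfolding \<phi>_def by (rule inv_f_f)
  have add: "{x + y |x y. x \<in> X s \<and> y \<in> X t} = X (s + t)" for s t
  proof (intro Set.set_eqI iffI)
    fix w assume "w \<in> {x + y |x y. x \<in> X s \<and> y \<in> X t}"
    then obtain x y where w: "w = x + y" "x - sc s z \<in> U" "y - sc t z \<in> U" unfolding X by blast
    have "w - sc (s + t) z = (x - sc s z) + (y - sc t z)" unfolding w by (simp add: algebra_simps)
    then show "w \<in> X (s + t)" unfolding X using U'(1) w by metis
  next
    fix w assume w: "w \<in> X (s + t)"
    have "w = sc s z + (w - sc s z)" "w - sc s z - sc t z = w - sc (s + t) z"
      by (auto simp: algebra_simps)
    moreover have "sc s z - sc s z \<in> U" using U'(4) by simp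
    ultimately show "w \<in> {x + y |x y. x \<in> X s \<and> y \<in> X t}" using w unfolding X mem_Collect_eq by metis
  qed
  have scale: "{sc c x + u |x u. x \<in> X t \<and> u \<in> U} = X (c * t)" for c t
  proof (intro Set.set_eqI iffI)
    fix w assume "w \<in> {sc c x + u |x u. x \<in> X t \<and> u \<in> U}"
    then obtain x u where w: "w = sc c x + u" "x - sc t z \<in> U" "u \<in> U" unfolding X by blast
    have "w - sc (c * t) z = sc c (x - sc t z) + u" unfolding w by (simp add: algebra_simps)
    then show "w \<in> X (c * t)" unfolding X using U'(1,3) w by metis
  next
    fix w assume w: "w \<in> X (c * t)"
    have "w = sc c (sc t z) + (w - sc (c * t) z)" by simp
    moreover have "sc t z - sc t z \<in> U" using U'(4) by simp
    ultimately show "w \<in> {sc c x + u |x u. x \<in> X t \<and> u \<in> U}" using w unfolding X mem_Collect_eq by metis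
  qed
  show ?thesis
    unfolding iso_to_field_def
  proof (intro exI[of _ \<phi>] conjI ballI allI)
    show "bij_betw \<phi> (carrier (quotient_space sc Z U)) UNIV"
      unfolding quotient_space_def using car injX
      by (simp add: \<phi>_def bij_betw_inv_into inj_imp_bij_betw_inv)
    fix x c assume "x \<in> carrier (quotient_space sc Z U)"
    then obtain s where s: "x = X s" unfolding quotient_space_def using car by auto
    show "\<phi> (c \<odot>\<^bsub>quotient_space sc Z U\<^esub> x) = c * \<phi> x"
      unfolding s quotient_space_def by (simp add: scale \<phi>)
    fix y assume "y \<in> carrier (quotient_space sc Z U)"
    then obtain t where t: "y = X t" unfolding quotient_space_def using car by auto
    show "\<phi> (x \<oplus>\<^bsub>quotient_space sc Z U\<^esub> y) = \<phi> x + \<phi> y"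
      unfolding s t quotient_space_def by (simp add: add \<phi>)
  qed
qed

text \<open>
  If all but one of the groups \<open>Hom(Q\<^sub>i, B)\<close> vanish, then the complex \<open>Hom(Q, B)\<close> is its
  own cohomology, and a comparison with the chosen resolution computes \<open>Ext\<close>.
\<close>

context
  fixes e :: nat and A :: "('k::field, 'b) spfun" and B :: "('k, 'c) spfun" and Q c b
  assumes Q: "projective_resolution e A Q c b" and B: "spf e B"
begin

text \<open>Of the resolution behind \<open>Ext\<close> nothing is known except that it is one, and
  even this needs a witness for the choice, here \<open>Q\<close>.\<close>

lemma Ext_chosen:
  obtains P d a where "projective_resolution e A P d a"
    "Ext e q A B = quotient_space hom_scale (cocycles P d B q) (coboundaries P d B q)"
proof -
  obtain P d a where *: "(SOME (P, d, a). projective_resolution e A P d a) = (P, d, a)"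
    using prod_cases3 by blast
  have "case (SOME (P, d, a). projective_resolution e A P d a) of (P, d, a) \<Rightarrow> projective_resolution e A P d a"
    by (rule someI[of _ "(Q, c, b)"]) (use Q in simp)
  then show ?thesis using * by (intro that[of P d a]) (simp_all add: Ext_def)
qed

lemma comparison:
  assumes P: "projective_resolution e A P d a"
  shows "\<exists>f g. chain_map P d a Q c b f \<and> chain_map Q c b P d a g \<and>
    (\<forall>q. \<forall>x\<in>cocycles P d B q. (\<lambda>n v. x n (g q n (f q n v))) - x \<in> coboundaries P d B q) \<and>
    (\<forall>q. \<forall>x\<in>cocycles Q c B q. (\<lambda>n v. x n (f q n (g q n v))) - x \<in> coboundaries Q c B q)"
proof -
  obtain f where f: "chain_map P d a Q c b f" using chain_map_exists[OF P Q] by blast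
  obtain g where g: "chain_map Q c b P d a g" using chain_map_exists[OF Q P] by blast
  show ?thesis
    using f g homotopy_cocycle[OF P B chain_map_comp[OF f g]] homotopy_cocycle[OF Q B chain_map_comp[OF g f]]
    by blast
qed

text \<open>Pulled back to \<open>Q\<close> along \<open>g\<close>, a cocycle lands in the zero
  space; pulled back further along \<open>f\<close> it differs from the original by a
  coboundary.\<close>

lemma Ext_zero:
  assumes "spf_hom (Q q) B = {0}"
  shows "zero_space (Ext e q A B)"
proof -
  obtain P d a where P: "projective_resolution e A P d a"
    and E: "Ext e q A B = quotient_space hom_scale (cocycles P d B q) (coboundaries P d B q)"
    by (rule Ext_chosen)
  obtain f g where g: "chain_map Q c b P d a g" and
    gf: "\<forall>q. \<forall>x\<in>cocycles P d B q. (\<lambda>n v. x n (g q n (f q n v))) - x \<in> coboundaries P d B q"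
    using comparison[OF P] by blast
  note sub = coboundaries_subspace[OF P B]
  have "x \<in> coboundaries P d B q" if x: "x \<in> cocycles P d B q" for x
  proof -
    have "(\<lambda>n v. x n (g q n v)) \<in> spf_hom (Q q) B"
      using hom_comp[OF chain_map_hom[OF g]] x unfolding cocycles_def by blast
    then have "(\<lambda>n v. x n (g q n v)) = 0" using assms by simp
    then have "(\<lambda>n v. x n (g q n (f q n v))) = 0" by (simp add: fun_eq_iff)
    then have "- x \<in> coboundaries P d B q" using gf[rule_format, OF x] by simp
    then show ?thesis using homs.subspace_neg[OF sub, of "- x"] by simp
  qed
  then have "cocycles P d B q = coboundaries P d B q" using coboundaries_subset[OF P B] by blast
  then show ?thesis unfolding E using zero_space_quotient[OF sub homs.vector_space_axioms] by simp
qed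

text \<open>As both neighbouring Hom-spaces vanish, every element of Hom(Q q, B) is a cocycle and
  only 0 is a coboundary, so the line spanned by \<open>y\<close> survives; \<open>z\<close> is its
  transport to the chosen resolution.\<close>

lemma Ext_field:
  assumes "spf_hom (Q (Suc q)) B = {0}" "\<And>r. q = Suc r \<Longrightarrow> spf_hom (Q r) B = {0}"
    and y: "y \<in> spf_hom (Q q) B" "y \<noteq> 0" "\<And>x. x \<in> spf_hom (Q q) B \<Longrightarrow> \<exists>t. x = hom_scale t y"
  shows "iso_to_field (Ext e q A B)"
proof -
  obtain P d a where P: "projective_resolution e A P d a"
    and E: "Ext e q A B = quotient_space hom_scale (cocycles P d B q) (coboundaries P d B q)"
    by (rule Ext_chosen)
  obtain f g where f: "chain_map P d a Q c b f" and g: "chain_map Q c b P d a g" and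
    gf: "\<forall>q. \<forall>x\<in>cocycles P d B q. (\<lambda>n v. x n (g q n (f q n v))) - x \<in> coboundaries P d B q" and
    fg: "\<forall>q. \<forall>x\<in>cocycles Q c B q. (\<lambda>n v. x n (f q n (g q n v))) - x \<in> coboundaries Q c B q"
    using comparison[OF P] by blast
  note f1 = chain_map_hom[OF f] and f2 = chain_map_comm[OF f] and g1 = chain_map_hom[OF g] and g2 = chain_map_comm[OF g]
  let ?U = "coboundaries P d B q"
  note sub = coboundaries_subspace[OF P B]
  have cobQ: "coboundaries Q c B q \<subseteq> {0}"
    using assms(2) by (cases q) (auto simp: coboundaries_def fun_eq_iff)
  have "(\<lambda>n v. y n (c q n v)) \<in> spf_hom (Q (Suc q)) B" by (rule hom_comp[OF res_hom[OF Q] y(1)])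
  then have yc: "y n (c q n v) = 0" for n v using assms(1) by (auto simp: fun_eq_iff)
  have yZ: "y \<in> cocycles Q c B q" using y(1) yc by (simp add: cocycles_def)
  define z where "z = (\<lambda>n v. y n (f q n v))"
  have zh: "z \<in> spf_hom (P q) B" unfolding z_def by (rule hom_comp[OF f1 y(1)])
  have zZ: "z \<in> cocycles P d B q"
    unfolding cocycles_def using zh f2 yc by (auto simp: z_def) metis
  \<comment> \<open>If \<open>z\<close> were a coboundary, its pullback along \<open>g\<close> would
    factor through a morphism out of \<open>Q r\<close> and hence be 0; but this pullback is
    \<open>y\<close> up to a coboundary of \<open>Q\<close>, that is, up to 0.\<close>
  have zU: "z \<notin> ?U"
  proof
    assume "z \<in> ?U"
    have "(\<lambda>n v. z n (g q n v)) = 0"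
    proof (cases q)
      case 0
      then show ?thesis using \<open>z \<in> ?U\<close> by (simp add: coboundaries_def fun_eq_iff)
    next
      case (Suc r)
      then obtain x where x: "x \<in> spf_hom (P r) B" "z = (\<lambda>n v. x n (d r n v))"
        using \<open>z \<in> ?U\<close> by (auto simp: coboundaries_def)
      have "(\<lambda>n v. x n (g r n v)) \<in> spf_hom (Q r) B" by (rule hom_comp[OF g1 x(1)])
      then have "x n (g r n v) = 0" for n v using assms(2)[OF Suc] by (auto simp: fun_eq_iff)
      then have "z n (g q n v) = 0" if "v \<in> ob (Q q) n" for n v
        using g2 that unfolding x(2) Suc by metis
      moreover have "z n (g q n v) = 0" if "v \<notin> ob (Q q) n" for n v
        using hom_outside[OF g1 that] hom_zero[OF zh] by simp
      ultimately show ?thesis by (intro ext) (metis zero_fun_apply)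
    qed
    then have "(\<lambda>n v. y n (f q n (g q n v))) = 0" unfolding z_def .
    then have "- y \<in> coboundaries Q c B q" using fg[rule_format, OF yZ] by simp
    then show False using cobQ y(2) by (metis neg_equal_0_iff_equal singletonD subsetD)
  qed
  have "cocycles P d B q = {hom_scale t z + u | t u. u \<in> ?U}"
  proof (intro subset_antisym subsetI)
    fix x assume x: "x \<in> cocycles P d B q"
    then have "(\<lambda>n v. x n (g q n v)) \<in> spf_hom (Q q) B"
      using hom_comp[OF g1] unfolding cocycles_def by blast
    then obtain t where t: "(\<lambda>n v. x n (g q n v)) = hom_scale t y" using y(3) by blast
    have "(\<lambda>n v. x n (g q n (f q n v))) = hom_scale t z"
      using t unfolding z_def hom_scale_def by (simp add: fun_eq_iff)
    then have "hom_scale t z - x \<in> ?U" using gf[rule_format, OF x] by simp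
    then have "- (hom_scale t z - x) \<in> ?U" using homs.subspace_neg[OF sub] by blast
    moreover have "x = hom_scale t z + - (hom_scale t z - x)" by simp
    ultimately show "x \<in> {hom_scale t z + u | t u. u \<in> ?U}" by blast
  next
    fix x assume "x \<in> {hom_scale t z + u | t u. u \<in> ?U}"
    then obtain t u where x: "x = hom_scale t z + u" "u \<in> ?U" by blast
    have "u \<in> cocycles P d B q" using x(2) coboundaries_subset[OF P B] by blast
    then show "x \<in> cocycles P d B q"
      using zZ hom_combine(1)[OF B hom_combine(3)[OF B zh zh]]
      unfolding x(1) cocycles_def by (simp add: hom_scale_def fun_eq_iff)
  qed
  then show ?thesis unfolding E using iso_to_field_quotient[OF homs.vector_space_axioms sub _ zU] by blast
qed

end

section \<open>Tensor powers and the Koszul complex\<close>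

text \<open>A sign-reversing involution. Vanishing at fixed points is a hypothesis of its own, since
  in characteristic 2 it does not follow from the change of sign.\<close>

lemma sum_involution:
  fixes f :: "'x \<Rightarrow> 'y::ab_group_add"
  assumes "finite X" "\<And>x. x \<in> X \<Longrightarrow> \<tau> x \<in> X" "\<And>x. x \<in> X \<Longrightarrow> \<tau> (\<tau> x) = x"
    "\<And>x. x \<in> X \<Longrightarrow> f (\<tau> x) = - f x" "\<And>x. x \<in> X \<Longrightarrow> \<tau> x = x \<Longrightarrow> f x = 0"
  shows "(\<Sum>x\<in>X. f x) = 0"
  using assms
proof (induction X rule: finite_psubset_induct)
  case (psubset X)
  show ?case
  proof (cases "X = {}")
    case False
    then obtain x where x: "x \<in> X" by blast
    let ?Y = "X - {x, \<tau> x}"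
    have Y: "\<tau> y \<in> ?Y" if "y \<in> ?Y" for y
    proof -
      have "y \<in> X" "y \<noteq> x" "y \<noteq> \<tau> x" using that by auto
      then have "\<tau> y \<in> X" "\<tau> (\<tau> y) = y" "\<tau> (\<tau> x) = x" using psubset.prems x by blast+
      then show ?thesis using \<open>y \<noteq> x\<close> \<open>y \<noteq> \<tau> x\<close> by auto
    qed
    have "(\<Sum>y\<in>?Y. f y) = 0"
      by (rule psubset.IH) (use x Y psubset.prems in auto)
    moreover have "(\<Sum>y\<in>X. f y) = (\<Sum>y\<in>{x, \<tau> x}. f y) + (\<Sum>y\<in>?Y. f y)"
      using sum.subset_diff[of "{x, \<tau> x}" X f] x psubset.prems(1) psubset.hyps(1) by (simp add: add.commute)
    moreover have "(\<Sum>y\<in>{x, \<tau> x}. f y) = 0"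
      using psubset.prems(3,4) x by (cases "\<tau> x = x") auto
    ultimately show ?thesis by simp
  qed simp
qed

section \<open>Words and the tensor power\<close>

definition words :: "nat \<Rightarrow> nat \<Rightarrow> nat list set" where
  "words p n = {w. length w = p \<and> set w \<subseteq> {..<n}}"

lemma finite_words [simp]: "finite (words p n)"
  using finite_lists_length_eq[of "{..<n}" p] by (simp add: words_def conj_commute)

lemma words_0: "words 0 n = {[]}"
  by (auto simp: words_def)

lemma sum_words_Suc: "(\<Sum>x\<in>words (Suc p) n. f x) = (\<Sum>h<n. \<Sum>x\<in>words p n. f (h # x))"
proof -
  have "(\<Sum>h<n. \<Sum>x\<in>words p n. f (h # x)) = (\<Sum>(h, x)\<in>{..<n} \<times> words p n. f (h # x))"
    by (simp add: sum.cartesian_product)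
  also have "\<dots> = (\<Sum>x\<in>words (Suc p) n. f x)"
    by (rule sum.reindex_bij_witness[of _ "\<lambda>x. (hd x, tl x)" "\<lambda>(h, x). h # x"])
      (auto simp: words_def length_Suc_conv)
  finally show ?thesis by simp
qed

lemma words_mset:
  assumes "mset w = mset w'"
  shows "w \<in> words p n \<longleftrightarrow> w' \<in> words p n"
  by (simp add: words_def mset_eq_length[OF assms] mset_eq_setD[OF assms])

text \<open>The p-th tensor power of the generic matrix has in row \<open>w\<close> and column
  \<open>x\<close> the single monomial \<open>mset (zip w x)\<close>; \<open>coef\<close> collects
  the columns in which a given monomial occurs.\<close>

definition tensor_pow :: "nat \<Rightarrow> ('k::field, nat list) spfun" where
  "tensor_pow p = \<lparr>
     ob = (\<lambda>n. {v. \<forall>w. w \<notin> words p n \<longrightarrow> v w = 0}),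
     coef = (\<lambda>m n M v w.
       if w \<in> words p n then \<Sum>x | x \<in> words p m \<and> mset (zip w x) = M. v x else 0)\<rparr>"

lemma tensor_pow_ob: "v \<in> ob (tensor_pow p) n \<longleftrightarrow> (\<forall>w. w \<notin> words p n \<longrightarrow> v w = 0)"
  by (simp add: tensor_pow_def)

lemma tensor_pow_coef: "coef (tensor_pow p) m n M v w =
    (if w \<in> words p n then \<Sum>x | x \<in> words p m \<and> mset (zip w x) = M. v x else 0)"
  by (simp add: tensor_pow_def)

lemma tensor_pow_coef_sum: "coef (tensor_pow p) m n M v w =
    (if w \<in> words p n then \<Sum>x\<in>words p m. if mset (zip w x) = M then v x else 0 else 0)"
  by (simp add: tensor_pow_coef sum.inter_filter[symmetric] conj_commute)

text \<open>Multiplying out: choosing one inner index in every factor amounts to choosing a word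
  \<open>x\<close> between \<open>w\<close> and \<open>c\<close>.\<close>

lemma generic_product_expand:
  "length w = length c \<Longrightarrow>
   (\<Prod>(i, j)\<in>#mset (zip w c). \<Sum>h<m. pvar (Inl (i, h)) * pvar (Inr (h, j)) ::
      ((nat \<times> nat) + (nat \<times> nat), 'k::field) mpol) =
   (\<Sum>x\<in>words (length w) m.
      Poly_Mapping.single (image_mset Inl (mset (zip w x)) + image_mset Inr (mset (zip x c))) 1)"
proof (induction w c rule: list_induct2)
  case Nil
  then show ?case by (simp add: words_0)
next
  case (Cons i w j c)
  then show ?case
    by (simp add: sum_words_Suc sum_distrib_right sum_distrib_left pvar_def mult_single ac_simps)
      (rule sum.swap)
qed

lemma image_Inl_Inr_eq:
  "image_mset Inl A + image_mset Inr B = image_mset Inl A' + image_mset Inr B' \<longleftrightarrow> A = A' \<and> B = B'"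
  for A A' :: "'a multiset" and B B' :: "'b multiset"
proof
  assume eq: "image_mset Inl A + image_mset Inr B = image_mset Inl A' + image_mset Inr B'"
  have "{#x \<in># image_mset Inl X + image_mset Inr Y. isl x#} = image_mset Inl X"
    "{#x \<in># image_mset Inl X + image_mset Inr Y. \<not> isl x#} = image_mset Inr Y"
    for X :: "'x multiset" and Y :: "'y multiset"
    by (simp_all add: filter_mset_image_mset)
  then have "image_mset Inl A = (image_mset Inl A' :: ('a + 'b) multiset)"
    "image_mset Inr B = (image_mset Inr B' :: ('a + 'b) multiset)"
    using eq by metis+
  from arg_cong[OF this(1), of "image_mset projl"] arg_cong[OF this(2), of "image_mset projr"]
  show "A = A' \<and> B = B'" by (simp add: multiset.map_comp o_def)
qed simp

lemma comp_coeff_words: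
  assumes "length w = length c"
  shows "(comp_coeff m N M (mset (zip w c)) :: 'k::field) =
    (\<Sum>x\<in>words (length w) m. if mset (zip w x) = N \<and> mset (zip x c) = M then 1 else 0)"
  unfolding comp_coeff_def generic_product_expand[OF assms]
  by (auto simp: lookup_sum lookup_single when_def image_Inl_Inr_eq intro!: sum.cong)

lemma monomialsE:
  assumes "K \<in> monomials p n l"
  obtains w c where "K = mset (zip w c)" "w \<in> words p n" "c \<in> words p l"
proof -
  obtain xs where xs: "mset xs = K" using ex_mset by blast
  then have "length xs = p" "set xs \<subseteq> {..<n} \<times> {..<l}" using assms by (auto simp: monomials_def)
  then show thesis
    by (intro that[of "map fst xs" "map snd xs"]) (auto simp: xs words_def zip_map_fst_snd)
qed

lemma zip_monomial: "w \<in> words p n \<Longrightarrow> x \<in> words p m \<Longrightarrow> mset (zip w x) \<in> monomials p n m"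
  unfolding monomials_def words_def
  by (auto dest: set_zip_leftD set_zip_rightD)

lemma finite_monomials [simp]: "finite (monomials p n m)"
proof (rule finite_subset)
  show "monomials p n m \<subseteq> (\<lambda>(w, c). mset (zip w c)) ` (words p n \<times> words p m)"
    by (auto elim!: monomialsE)
qed simp

lemma spf_tensor_pow: "spf p (tensor_pow p :: ('k::field, nat list) spfun)"
  unfolding spf_def
proof (intro conjI allI ballI impI)
  show "fd_space (ob (tensor_pow p :: ('k, nat list) spfun) n)" for n
    by (rule fd_space_supported[of _ "words p n"]) (auto simp: tensor_pow_ob fvs.subspace_def)
  show "linear_between (ob (tensor_pow p :: ('k, nat list) spfun) m) (ob (tensor_pow p) n)
      (coef (tensor_pow p) m n M)" for m n M
    unfolding linear_between_def
    by (auto simp: tensor_pow_ob tensor_pow_coef fun_eq_iff sum.distrib sum_distrib_left)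
  show "coef (tensor_pow p) m n M v = 0" if "M \<notin> monomials p n m" for m n M and v :: "nat list \<Rightarrow> 'k"
    using that zip_monomial by (auto simp: tensor_pow_coef fun_eq_iff intro!: sum.neutral)
  show "spf_eval p (tensor_pow p) n n (\<lambda>i j. if i = j then 1 else 0) v = v"
    if v: "v \<in> ob (tensor_pow p) n" for n and v :: "nat list \<Rightarrow> 'k"
  proof
    fix w
    show "spf_eval p (tensor_pow p) n n (\<lambda>i j. if i = j then 1 else 0) v w = v w"
    proof (cases "w \<in> words p n")
      case True
      have diag: "(\<Prod>(i, j)\<in>#mset (zip w x). if i = j then 1 else 0 :: 'k) = (if w = x then 1 else 0)"
        if "length w = length x" for w x :: "nat list"
        using that by (induction w x rule: list_induct2) auto
      have "spf_eval p (tensor_pow p) n n (\<lambda>i j. if i = j then 1 else 0) v w =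
        (\<Sum>M\<in>monomials p n n. \<Sum>x\<in>words p n.
          if mset (zip w x) = M then (\<Prod>(i, j)\<in>#M. if i = j then 1 else 0) * v x else 0)"
        using True by (simp add: spf_eval_def sum_fun_apply tensor_pow_coef_sum sum_distrib_left if_distrib
            cong: if_cong)
      also have "\<dots> = (\<Sum>x\<in>words p n. \<Sum>M\<in>monomials p n n.
          if mset (zip w x) = M then (\<Prod>(i, j)\<in>#M. if i = j then 1 else 0) * v x else 0)"
        by (rule sum.swap)
      also have "\<dots> = (\<Sum>x\<in>words p n. (\<Prod>(i, j)\<in>#mset (zip w x). if i = j then 1 else 0) * v x)"
        using zip_monomial[OF True] by (intro sum.cong) simp_all
      also have "\<dots> = (\<Sum>x\<in>words p n. if w = x then v x else 0)"
        using True by (intro sum.cong) (auto simp: diag words_def)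
      also have "\<dots> = v w" using True by simp
      finally show ?thesis .
    qed (use v in \<open>auto simp: spf_eval_def sum_fun_apply tensor_pow_ob tensor_pow_coef\<close>)
  qed
  show "coef (tensor_pow p) m n N (coef (tensor_pow p) l m M v) =
      (\<Sum>K\<in>monomials p n l. fscale (comp_coeff m N M K) (coef (tensor_pow p) l n K v))"
    for l m n N M and v :: "nat list \<Rightarrow> 'k"
  proof
    fix w
    show "coef (tensor_pow p) m n N (coef (tensor_pow p) l m M v) w =
      (\<Sum>K\<in>monomials p n l. fscale (comp_coeff m N M K) (coef (tensor_pow p) l n K v)) w"
    proof (cases "w \<in> words p n")
      case True
      \<comment> \<open>Both sides sum \<open>v y\<close> over the pairs of words \<open>x\<close>,
        \<open>y\<close> with \<open>mset (zip w x) = N\<close> and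
        \<open>mset (zip x y) = M\<close>; \<open>comp_coeff\<close> counts the intermediate words
        \<open>x\<close>.\<close>
      have "(\<Sum>K\<in>monomials p n l. fscale (comp_coeff m N M K) (coef (tensor_pow p) l n K v)) w =
        (\<Sum>K\<in>monomials p n l. \<Sum>y\<in>words p l. if mset (zip w y) = K then comp_coeff m N M K * v y else 0)"
        using True by (simp add: sum_fun_apply tensor_pow_coef_sum sum_distrib_left if_distrib cong: if_cong)
      also have "\<dots> = (\<Sum>y\<in>words p l. \<Sum>K\<in>monomials p n l. if mset (zip w y) = K then comp_coeff m N M K * v y else 0)"
        by (rule sum.swap)
      also have "\<dots> = (\<Sum>y\<in>words p l. comp_coeff m N M (mset (zip w y)) * v y)"
        using zip_monomial[OF True] by (intro sum.cong) simp_all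
      also have "\<dots> = (\<Sum>y\<in>words p l. \<Sum>x\<in>words p m. if mset (zip w x) = N then if mset (zip x y) = M then v y else 0 else 0)"
        using True by (intro sum.cong) (auto simp: words_def comp_coeff_words sum_distrib_right if_distrib intro!: sum.cong)
      also have "\<dots> = (\<Sum>x\<in>words p m. \<Sum>y\<in>words p l. if mset (zip w x) = N then if mset (zip x y) = M then v y else 0 else 0)"
        by (rule sum.swap)
      also have "\<dots> = coef (tensor_pow p) m n N (coef (tensor_pow p) l m M v) w"
        using True by (auto simp: tensor_pow_coef_sum intro!: sum.cong)
      finally show ?thesis by simp
    qed (auto simp: sum_fun_apply tensor_pow_coef)
  qed
qed

section \<open>Place permutations, alternating and symmetric tensors\<close>

lemma permute_list_inverse:
  assumes "\<sigma> permutes {..<length x}"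
  shows "permute_list (inv_into UNIV \<sigma>) (permute_list \<sigma> x) = x" "permute_list \<sigma> (permute_list (inv_into UNIV \<sigma>) x) = x"
  using permute_list_compose[OF permutes_inv[OF assms], of \<sigma>] permute_list_compose[OF assms, of "inv_into UNIV \<sigma>"]
    permutes_inv_o[OF assms] by simp_all

lemma permute_words: "\<sigma> permutes {..<p} \<Longrightarrow> permute_list \<sigma> x \<in> words p n \<longleftrightarrow> x \<in> words p n"
  by (cases "length x = p") (auto simp: words_def)

text \<open>Place permutations are natural: permuting \<open>w\<close> and \<open>x\<close>
  simultaneously leaves the multiset of pairs unchanged.\<close>

lemma coef_permute:
  assumes \<sigma>: "\<sigma> permutes {..<p}"
  shows "coef (tensor_pow p) m n M v (permute_list \<sigma> w) = coef (tensor_pow p) m n M (\<lambda>x. v (permute_list \<sigma> x)) w"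
proof (cases "w \<in> words p n")
  case True
  have *: "mset (zip (permute_list \<sigma> w) (permute_list \<sigma> x)) = mset (zip w x)" if "x \<in> words p m" for x
    using permute_list_zip[OF \<sigma>, of w x] True that \<sigma> by (metis (mono_tags, lifting) length_zip
        mem_Collect_eq min.idem mset_permute_list words_def)
  have \<sigma>': "inv_into UNIV \<sigma> permutes {..<p}" by (rule permutes_inv[OF \<sigma>])
  have inv: "permute_list (inv_into UNIV \<sigma>) (permute_list \<sigma> x) = x" "permute_list \<sigma> (permute_list (inv_into UNIV \<sigma>) x) = x"
    if "x \<in> words p m" for x
    using that permute_list_inverse[of \<sigma> x] \<sigma> by (auto simp: words_def)
  have "(\<Sum>x | x \<in> words p m \<and> mset (zip (permute_list \<sigma> w) x) = M. v x) =
     (\<Sum>x | x \<in> words p m \<and> mset (zip w x) = M. v (permute_list \<sigma> x))"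
    by (rule sum.reindex_bij_witness[of _ "permute_list \<sigma>" "permute_list (inv_into UNIV \<sigma>)"])
      (use inv * permute_words[OF \<sigma>] permute_words[OF \<sigma>'] in \<open>auto simp flip: *\<close>)
  then show ?thesis using True by (simp add: tensor_pow_coef permute_words[OF \<sigma>])
qed (simp add: tensor_pow_coef permute_words[OF \<sigma>])

lemma coef_cong:
  "(\<And>x. x \<in> words p m \<Longrightarrow> v x = u x) \<Longrightarrow> coef (tensor_pow p) m n M v = coef (tensor_pow p) m n M u"
  by (auto simp: tensor_pow_coef fun_eq_iff intro!: sum.cong)

lemma coef_linear:
  "coef (tensor_pow p) m n M (\<lambda>x. \<Sum>i\<in>I. c i * v i x) w = (\<Sum>i\<in>I. c i * coef (tensor_pow p) m n M (v i) w)"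
  "coef (tensor_pow p) m n M (\<lambda>x. - u x) w = - coef (tensor_pow p) m n M u w"
  by (auto simp: tensor_pow_coef sum_distrib_left sum_negf intro: sum.swap)

abbreviation swap_adj :: "nat \<Rightarrow> 'x list \<Rightarrow> 'x list" where
  "swap_adj k \<equiv> permute_list (transpose k (Suc k))"

lemma transpose_permutes: "s < p \<Longrightarrow> t < p \<Longrightarrow> transpose s t permutes {..<p::nat}"
  by (rule permutes_swap_id) auto

lemma swap_adj_append:
  assumes "k = length P"
  shows "swap_adj k (P @ x # y # R) = P @ y # x # R"
proof (rule nth_equalityI)
  fix i assume "i < length (swap_adj k (P @ x # y # R))"
  then have i: "i < length (P @ x # y # R)" by simp
  have \<tau>: "transpose k (Suc k) permutes {..<length (P @ x # y # R)}"
    using assms by (intro transpose_permutes) auto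
  show "swap_adj k (P @ x # y # R) ! i = (P @ y # x # R) ! i"
    unfolding permute_list_nth[OF \<tau> i]
    using assms by (auto simp: nth_append transpose_def nth_Cons' not_less_eq less_Suc_eq)
qed simp

lemma split_adj:
  assumes "Suc k < length w"
  shows "w = take k w @ w ! k # w ! Suc k # drop (Suc (Suc k)) w"
  using assms by (metis Cons_nth_drop_Suc Suc_lessD append_take_drop_id)

text \<open>Vanishing on equal neighbours is demanded in addition to the sign rule, because p = 2 is
  allowed; only then do these tensors form an exterior power in every characteristic.\<close>

definition alternating :: "nat \<Rightarrow> nat \<Rightarrow> (nat list \<Rightarrow> 'k::field) \<Rightarrow> bool" where
  "alternating p j v \<longleftrightarrow> (\<forall>P x y R. length P + length R + 2 = p \<and> length P + 2 \<le> j \<longrightarrow>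
     v (P @ y # x # R) = - v (P @ x # y # R) \<and> v (P @ x # x # R) = 0)"

definition symmetric :: "nat \<Rightarrow> nat \<Rightarrow> (nat list \<Rightarrow> 'k::field) \<Rightarrow> bool" where
  "symmetric p j v \<longleftrightarrow> (\<forall>P x y R. length P + length R + 2 = p \<and> j \<le> length P \<longrightarrow>
     v (P @ y # x # R) = v (P @ x # y # R))"

lemma alternatingD:
  assumes "alternating p j v" "length P + length R + 2 = p" "length P + 2 \<le> j"
  shows "v (P @ y # x # R) = - v (P @ x # y # R)" "v (P @ x # x # R) = 0"
  using assms unfolding alternating_def by blast+

lemma symmetricD:
  assumes "symmetric p j v" "length P + length R + 2 = p" "j \<le> length P"
  shows "v (P @ y # x # R) = v (P @ x # y # R)"
  using assms unfolding symmetric_def by blast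

lemma alternating_linear:
  "alternating p j 0"
  "alternating p j u \<Longrightarrow> alternating p j v \<Longrightarrow> alternating p j (u + v)"
  "alternating p j u \<Longrightarrow> alternating p j (fscale c u)"
proof -
  show "alternating p j 0" by (simp add: alternating_def)
  show "alternating p j (u + v)" if u: "alternating p j u" and v: "alternating p j v"
    unfolding alternating_def
  proof (intro allI impI)
    fix P R :: "nat list" and x y assume l: "length P + length R + 2 = p \<and> length P + 2 \<le> j"
    note D = alternatingD(1)[OF u conjunct1[OF l] conjunct2[OF l], of y x] alternatingD(2)[OF u conjunct1[OF l] conjunct2[OF l], of x]
       alternatingD(1)[OF v conjunct1[OF l] conjunct2[OF l], of y x] alternatingD(2)[OF v conjunct1[OF l] conjunct2[OF l], of x]
    show "(u + v) (P @ y # x # R) = - (u + v) (P @ x # y # R) \<and> (u + v) (P @ x # x # R) = 0"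
      using D by simp
  qed
  show "alternating p j (fscale c u)" if u: "alternating p j u"
    unfolding alternating_def
  proof (intro allI impI)
    fix P R :: "nat list" and x y assume l: "length P + length R + 2 = p \<and> length P + 2 \<le> j"
    note D = alternatingD(1)[OF u conjunct1[OF l] conjunct2[OF l], of y x] alternatingD(2)[OF u conjunct1[OF l] conjunct2[OF l], of x]
    show "fscale c u (P @ y # x # R) = - fscale c u (P @ x # y # R) \<and> fscale c u (P @ x # x # R) = 0"
      using D by simp
  qed
qed

lemma symmetric_linear:
  "symmetric p j 0"
  "symmetric p j u \<Longrightarrow> symmetric p j v \<Longrightarrow> symmetric p j (u + v)"
  "symmetric p j u \<Longrightarrow> symmetric p j (fscale c u)"
proof -
  show "symmetric p j 0" by (simp add: symmetric_def)
  show "symmetric p j (u + v)" if u: "symmetric p j u" and v: "symmetric p j v"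
    unfolding symmetric_def
  proof (intro allI impI)
    fix P R :: "nat list" and x y assume l: "length P + length R + 2 = p \<and> j \<le> length P"
    note D = symmetricD[OF u conjunct1[OF l] conjunct2[OF l], of y x]
       symmetricD[OF v conjunct1[OF l] conjunct2[OF l], of y x]
    show "(u + v) (P @ y # x # R) = (u + v) (P @ x # y # R)"
      using D by simp
  qed
  show "symmetric p j (fscale c u)" if u: "symmetric p j u"
    unfolding symmetric_def
  proof (intro allI impI)
    fix P R :: "nat list" and x y assume l: "length P + length R + 2 = p \<and> j \<le> length P"
    note D = symmetricD[OF u conjunct1[OF l] conjunct2[OF l], of y x]
    show "fscale c u (P @ y # x # R) = fscale c u (P @ x # y # R)"
      using D by simp
  qed
qed

lemma alternating_iff:
  assumes "j \<le> p"
  shows "alternating p j v \<longleftrightarrow> (\<forall>k w. length w = p \<and> Suc k < j \<longrightarrow>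
    v (swap_adj k w) = - v w \<and> (w ! k = w ! Suc k \<longrightarrow> v w = 0))"
    (is "_ \<longleftrightarrow> ?R")
proof
  assume a: "alternating p j v"
  show ?R
  proof (intro allI impI)
    fix k and w :: "nat list" assume "length w = p \<and> Suc k < j"
    then have kw: "length w = p" "Suc k < j" "Suc k < length w" using assms by auto
    have l: "length (take k w) + length (drop (Suc (Suc k)) w) + 2 = p \<and> length (take k w) + 2 \<le> j"
      "k = length (take k w)"
      using kw by auto
    show "v (swap_adj k w) = - v w \<and> (w ! k = w ! Suc k \<longrightarrow> v w = 0)"
      using a[unfolded alternating_def, rule_format, OF l(1)] swap_adj_append[OF l(2)] split_adj[OF kw(3)]
      by metis
  qed
next
  assume r: ?R
  show "alternating p j v"
    unfolding alternating_def
  proof (intro allI impI)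
    fix P R :: "nat list" and x y
    assume l: "length P + length R + 2 = p \<and> length P + 2 \<le> j"
    have "v (swap_adj (length P) (P @ x # y # R)) = - v (P @ x # y # R)"
      by (rule r[rule_format, THEN conjunct1]) (use l in auto)
    moreover have "v (P @ x # x # R) = 0"
      by (rule r[rule_format, THEN conjunct2, rule_format, of _ "length P"])
        (use l in \<open>auto simp: nth_append\<close>)
    ultimately show "v (P @ y # x # R) = - v (P @ x # y # R) \<and> v (P @ x # x # R) = 0"
      by (simp add: swap_adj_append)
  qed
qed

lemma symmetric_iff:
  "symmetric p j v \<longleftrightarrow> (\<forall>k w. length w = p \<and> j \<le> k \<and> Suc k < p \<longrightarrow> v (swap_adj k w) = v w)"
    (is "_ \<longleftrightarrow> ?R")
proof
  assume a: "symmetric p j v"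
  show ?R
  proof (intro allI impI)
    fix k and w :: "nat list" assume "length w = p \<and> j \<le> k \<and> Suc k < p"
    then have kw: "length w = p" "j \<le> k" "Suc k < length w" by auto
    have l: "length (take k w) + length (drop (Suc (Suc k)) w) + 2 = p \<and> j \<le> length (take k w)"
      "k = length (take k w)"
      using kw by auto
    show "v (swap_adj k w) = v w"
      using a[unfolded symmetric_def, rule_format, OF l(1)] swap_adj_append[OF l(2)] split_adj[OF kw(3)]
      by metis
  qed
next
  assume r: ?R
  show "symmetric p j v"
    unfolding symmetric_def
  proof (intro allI impI)
    fix P R :: "nat list" and x y
    assume l: "length P + length R + 2 = p \<and> j \<le> length P"
    have "v (swap_adj (length P) (P @ x # y # R)) = v (P @ x # y # R)"
      by (rule r[rule_format]) (use l in auto)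
    then show "v (P @ y # x # R) = v (P @ x # y # R)"
      by (simp add: swap_adj_append)
  qed
qed

lemma alternating_swapD:
  assumes "alternating p j v" "j \<le> p" "length w = p" "Suc k < j"
  shows "v (swap_adj k w) = - v w" "w ! k = w ! Suc k \<Longrightarrow> v w = 0"
  using assms alternating_iff by blast+

lemma symmetric_swapD:
  assumes "symmetric p j v" "length w = p" "j \<le> k" "Suc k < p"
  shows "v (swap_adj k w) = v w"
  using assms symmetric_iff by blast

lemma alternating_transpose:
  assumes a: "alternating p j v" "j \<le> p" and "length w = p" "s < t" "t < j"
  shows "v (permute_list (transpose s t) w) = - v w"
  using assms(4,5,3)
proof (induction t arbitrary: w rule: less_induct)
  case (less t)
  show ?case
  proof (cases "t = Suc s")
    case True
    then show ?thesis using alternating_swapD(1)[OF a] less.prems by simp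
  next
    case False
    obtain u where u: "t = Suc u" "s < u" using less.prems(1) False by (cases t) auto
    have perm: "transpose u (Suc u) permutes {..<p}" "transpose s u permutes {..<p}"
      using u less.prems a(2) by (intro transpose_permutes; simp)+
    \<comment> \<open>Conjugation of a shorter transposition by an adjacent one: three changes of
      sign in total.\<close>
    have "transpose s t = transpose u (Suc u) \<circ> (transpose s u \<circ> transpose u (Suc u))"
      using u by (auto simp: fun_eq_iff transpose_def)
    then have "permute_list (transpose s t) w = swap_adj u (permute_list (transpose s u) (swap_adj u w))"
      using perm less.prems permutes_compose[OF perm] by (simp add: permute_list_compose)
    then show ?thesis
      using alternating_swapD(1)[OF a] less.IH[of u] u less.prems by simp
  qed
qed

lemma alternating_permute:
  assumes a: "alternating p j v" "j \<le> p" and \<sigma>: "\<sigma> permutes {..<j}" and w: "length w = p"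
  shows "v (permute_list \<sigma> w) = of_int (sign \<sigma>) * v w"
  using \<sigma> finite_lessThan w
proof (induction \<sigma> arbitrary: w rule: permutes_induct)
  case (swap s t \<sigma>)
  have \<sigma>p: "\<sigma> permutes {..<length w}"
    using permutes_subset[OF swap.hyps(4), of "{..<p}"] swap.prems a(2) by auto
  have tr: "v (permute_list (transpose s t) w) = - v w"
  proof (cases "s < t")
    case True
    then show ?thesis using alternating_transpose[OF a swap.prems, of s t] swap.hyps by simp
  next
    case False
    then have "t < s" using swap.hyps by simp
    then show ?thesis
      using alternating_transpose[OF a swap.prems, of t s] swap.hyps by (simp add: transpose_commute[of s t])
  qed
  have "permutation \<sigma>" "permutation (transpose s t)"
    by (rule permutes_imp_permutation[OF finite_lessThan swap.hyps(4)], rule permutation_swap_id)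
  then have sg: "sign (transpose s t \<circ> \<sigma>) = - sign \<sigma>"
    using swap.hyps by (simp add: sign_compose sign_swap_id)
  show ?case
    unfolding sg permute_list_compose[OF \<sigma>p]
    using swap.IH[of "permute_list (transpose s t) w"] tr swap.prems by simp
qed simp

text \<open>One transposition brings the second of two equal letters next to the first, which
  reduces to the adjacent case in the definition.\<close>

lemma alternating_repeat:
  assumes a: "alternating p j v" "j \<le> p" and w: "length w = p" and d: "\<not> distinct (take j w)"
  shows "v w = 0"
proof -
  obtain s t where st: "s < t" "t < j" "w ! s = w ! t"
  proof -
    from d obtain s t where st: "s < j" "t < j" "s \<noteq> t" "w ! s = w ! t"
      using w a(2) by (auto simp: distinct_conv_nth)
    then show thesis using that[of s t] that[of t s] by (cases "s < t") auto
  qed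
  show ?thesis
  proof (cases "t = Suc s")
    case True
    then show ?thesis using alternating_swapD(2)[OF a w, of s] st by simp
  next
    case False
    let ?u = "permute_list (transpose (Suc s) t) w"
    have perm: "transpose (Suc s) t permutes {..<length w}"
      using st a(2) w by (intro transpose_permutes) auto
    have "?u ! s = w ! s" "?u ! Suc s = w ! t"
      using st a(2) w perm False by (auto simp: permute_list_nth transpose_def)
    then have "v ?u = 0" using alternating_swapD(2)[OF a, of ?u s] st w by simp
    moreover have "v ?u = - v w" using alternating_transpose[OF a w, of "Suc s" t] st False by simp
    ultimately show ?thesis by simp
  qed
qed

lemma alternating_move:
  assumes a: "alternating p j v" and l: "length P + length A + 1 \<le> j" "length P + length A + length B + 1 = p"
  shows "v (P @ x # A @ B) = (-1) ^ length A * v (P @ A @ x # B)"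
  using l
proof (induction A arbitrary: P)
  case (Cons y A)
  have "v (P @ x # y # A @ B) = - v (P @ y # x # A @ B)"
    by (rule alternatingD[OF a]) (use Cons.prems in auto)
  also have "v (P @ y # x # A @ B) = (-1) ^ length A * v ((P @ [y]) @ A @ x # B)"
    using Cons.IH[of "P @ [y]"] Cons.prems by simp
  finally show ?case by simp
qed simp

lemma symmetric_move:
  assumes a: "symmetric p j v" and l: "j \<le> length P" "length P + length A + length B + 1 = p"
  shows "v (P @ x # A @ B) = v (P @ A @ x # B)"
  using l
proof (induction A arbitrary: P)
  case (Cons y A)
  have "v (P @ x # y # A @ B) = v (P @ y # x # A @ B)"
    by (rule symmetricD[OF a]) (use Cons.prems in auto)
  also have "\<dots> = v ((P @ [y]) @ A @ x # B)"
    using Cons.IH[of "P @ [y]"] Cons.prems by simp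
  finally show ?case by simp
qed simp

lemma symmetric_mset:
  assumes a: "symmetric p j v" and l: "j \<le> length P" "length P + length A = p" and m: "mset A = mset B"
  shows "v (P @ A) = v (P @ B)"
  using l m
proof (induction A arbitrary: P B)
  case (Cons x A)
  have "x \<in> set B" using mset_eq_setD[OF Cons.prems(3)] by auto
  then obtain C D where B: "B = C @ x # D" by (auto dest: split_list)
  then have m: "mset A = mset (C @ D)" using Cons.prems(3) by simp
  have "v (P @ x # A) = v ((P @ [x]) @ C @ D)"
    using Cons.IH[of "P @ [x]" "C @ D"] Cons.prems m by simp
  also have "\<dots> = v (P @ C @ x # D)"
    using symmetric_move[OF a, of P C D x] Cons.prems mset_eq_length[OF m] by simp
  finally show ?case by (simp add: B)
qed simp

text \<open>
  \<open>\<Lambda>\<^sup>j \<otimes> \<Gamma>\<^bsup>p-j\<^esup>\<close> as a subfunctor of \<open>I\<^bsup>\<otimes>p\<^esup>\<close>.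
\<close>

definition koszul_term :: "nat \<Rightarrow> nat \<Rightarrow> ('k::field, nat list) spfun" where
  "koszul_term p j = \<lparr>
     ob = (\<lambda>n. {v \<in> ob (tensor_pow p) n. alternating p j v \<and> symmetric p j v}),
     coef = coef (tensor_pow p)\<rparr>"

lemma koszul_term_simps:
  "v \<in> ob (koszul_term p j) n \<longleftrightarrow> v \<in> ob (tensor_pow p) n \<and> alternating p j v \<and> symmetric p j v"
  "coef (koszul_term p j) = coef (tensor_pow p)"
  by (simp_all add: koszul_term_def)

text \<open>The sign rule follows from \<open>coef_permute\<close>. If \<open>w\<close> has equal
  letters at places \<open>k\<close> and \<open>Suc k\<close>, swapping these places permutes the
  words \<open>x\<close> belonging to the monomial and negates \<open>v x\<close>; a fixed word has
  equal letters there itself, so \<open>v\<close> vanishes on it.\<close>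

lemma coef_alternating:
  assumes a: "alternating p j v" "j \<le> p"
  shows "alternating p j (coef (tensor_pow p) m n M v)"
  unfolding alternating_iff[OF a(2)]
proof (intro allI impI conjI)
  fix k and w :: "nat list" assume kw: "length w = p \<and> Suc k < j"
  then have \<tau>: "transpose k (Suc k) permutes {..<p}" using a(2) by (intro transpose_permutes) auto
  have sw: "v (swap_adj k x) = - v x" if "x \<in> words p m" for x
    using alternating_swapD(1)[OF a] kw that by (simp add: words_def)
  show "coef (tensor_pow p) m n M v (swap_adj k w) = - coef (tensor_pow p) m n M v w"
    unfolding coef_permute[OF \<tau>] using fun_cong[OF coef_cong[of p m "\<lambda>x. v (swap_adj k x)", OF sw], of n M w]
    by (simp add: coef_linear(2))
  assume eq: "w ! k = w ! Suc k"
  have ww: "swap_adj k w = w"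
  proof -
    have sp: "w = take k w @ w ! Suc k # w ! Suc k # drop (Suc (Suc k)) w"
      using split_adj[of k w] kw a(2) eq by simp
    have "k = length (take k w)" using kw a(2) by simp
    from swap_adj_append[OF this] show ?thesis using sp by metis
  qed
  have "(\<Sum>x | x \<in> words p m \<and> mset (zip w x) = M. v x) = 0"
  proof (rule sum_involution[where \<tau> = "swap_adj k"])
    show "finite {x. x \<in> words p m \<and> mset (zip w x) = M}" by simp
    fix x assume "x \<in> {x. x \<in> words p m \<and> mset (zip w x) = M}"
    then have x: "x \<in> words p m" "mset (zip w x) = M" "length x = p" by (auto simp: words_def)
    have "zip w (swap_adj k x) = zip (swap_adj k w) (swap_adj k x)" by (simp only: ww)
    also have "\<dots> = swap_adj k (zip w x)"
      using permute_list_zip[OF \<tau>, of w x] kw x by simp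
    finally have "mset (zip w (swap_adj k x)) = M" using x kw \<tau> by simp
    then show "swap_adj k x \<in> {x. x \<in> words p m \<and> mset (zip w x) = M}"
      using x permute_words[OF \<tau>] by simp
    show "swap_adj k (swap_adj k x) = x"
      using permute_list_compose[of "transpose k (Suc k)" x "transpose k (Suc k)"] \<tau> x by simp
    show "v (swap_adj k x) = - v x" by (rule sw[OF x(1)])
    assume fixed: "swap_adj k x = x"
    have "x ! k = x ! Suc k"
      using fixed permute_list_nth[of "transpose k (Suc k)" x k] \<tau> x kw a(2) by simp
    then show "v x = 0" using alternating_swapD(2)[OF a x(3)] kw by blast
  qed
  then show "coef (tensor_pow p) m n M v w = 0" by (simp add: tensor_pow_coef)
qed

lemma coef_symmetric:
  assumes a: "symmetric p j v"
  shows "symmetric p j (coef (tensor_pow p) m n M v)"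
  unfolding symmetric_iff
proof (intro allI impI)
  fix k and w :: "nat list" assume kw: "length w = p \<and> j \<le> k \<and> Suc k < p"
  then have \<tau>: "transpose k (Suc k) permutes {..<p}" by (intro transpose_permutes) auto
  have sw: "v (swap_adj k x) = v x" if "x \<in> words p m" for x
    using symmetric_swapD[OF a] kw that by (simp add: words_def)
  show "coef (tensor_pow p) m n M v (swap_adj k w) = coef (tensor_pow p) m n M v w"
    unfolding coef_permute[OF \<tau>] by (rule fun_cong[OF coef_cong[OF sw]])
qed

lemma spf_koszul_term:
  assumes "j \<le> p"
  shows "spf p (koszul_term p j :: ('k::field, nat list) spfun)"
proof (rule spf_sub[OF spf_tensor_pow])
  show "fvs.subspace (ob (koszul_term p j :: ('k, nat list) spfun) n)" for n
  proof (rule fvs.subspaceI)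
    note sub = spf_subspace[OF spf_tensor_pow[of p]]
    show "0 \<in> ob (koszul_term p j :: ('k, nat list) spfun) n"
      by (simp add: koszul_term_simps alternating_linear symmetric_linear fvs.subspace_0[OF sub])
    show "u + v \<in> ob (koszul_term p j) n"
      if "u \<in> ob (koszul_term p j) n" "v \<in> ob (koszul_term p j) n" for u v :: "nat list \<Rightarrow> 'k"
      using that fvs.subspace_add[OF sub, of u n v] alternating_linear(2) symmetric_linear(2)
      unfolding koszul_term_simps by blast
    show "fscale c u \<in> ob (koszul_term p j) n" if "u \<in> ob (koszul_term p j) n" for c and u :: "nat list \<Rightarrow> 'k"
      using that fvs.subspace_scale[OF sub, of u n c] alternating_linear(3) symmetric_linear(3)
      unfolding koszul_term_simps by blast
  qed
  show "coef (tensor_pow p) m n M v \<in> ob (koszul_term p j) n" if "v \<in> ob (koszul_term p j) m"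
    for m n M and v :: "nat list \<Rightarrow> 'k"
    using that coef_alternating[OF _ assms] coef_symmetric linear_between_in[OF spf_linear_between[OF spf_tensor_pow]]
    unfolding koszul_term_simps by blast
qed (auto simp: koszul_term_simps)

section \<open>The dual Koszul complex and its exactness\<close>

lemma Suc_length_remove1: "x \<in> set a \<Longrightarrow> Suc (length (remove1 x a)) = length a"
  by (induction a) auto

text \<open>
  \<open>permute_list (cyc j t)\<close> moves the letter at position \<open>t\<close> to position \<open>j\<close>, so that \<open>kdiff\<close> is
  the composite \<open>\<Lambda>\<^sup>j \<otimes> \<Gamma>\<^bsup>p-j\<^esup> \<rightarrow> \<Lambda>\<^sup>j \<otimes> I \<otimes> \<Gamma>\<^bsup>p-j-1\<^esup> \<rightarrow> \<Lambda>\<^bsup>j+1\<^esup> \<otimes> \<Gamma>\<^bsup>p-j-1\<^esup>\<close> up to the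
  sign \<open>(-1)\<^sup>j\<close>.
\<close>

definition cyc :: "nat \<Rightarrow> nat \<Rightarrow> nat \<Rightarrow> nat" where
  "cyc j t s = (if s < t then s else if s < j then Suc s else if s = j then t else s)"

lemma cyc_permutes:
  assumes "t \<le> j" "j < p"
  shows "cyc j t permutes {..<p}"
proof (rule bij_imp_permutes)
  show "bij_betw (cyc j t) {..<p} {..<p}"
    by (rule bij_betw_byWitness[where f' = "\<lambda>s. if s < t then s else if s = t then j else if s \<le> j then s - 1 else s"])
      (use assms in \<open>auto simp: cyc_def\<close>)
  show "cyc j t s = s" if "s \<notin> {..<p}" for s
    using that assms by (auto simp: cyc_def)
qed

lemma permute_cyc:
  assumes L: "length L = Suc j" and t: "t \<le> j"
  shows "permute_list (cyc j t) (L @ a) = take t L @ drop (Suc t) L @ L ! t # a"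
proof (rule nth_equalityI)
  show "length (permute_list (cyc j t) (L @ a)) = length (take t L @ drop (Suc t) L @ L ! t # a)"
    using assms by simp
  fix i assume "i < length (permute_list (cyc j t) (L @ a))"
  then have i: "i < length (L @ a)" by simp
  have c: "cyc j t permutes {..<length (L @ a)}" using L t by (intro cyc_permutes) auto
  consider "i < t" | "t \<le> i" "i < j" | "i = j" | "i > j" by linarith
  then show "permute_list (cyc j t) (L @ a) ! i = (take t L @ drop (Suc t) L @ L ! t # a) ! i"
    unfolding permute_list_nth[OF c i]
    by cases (use L t i in \<open>auto simp: cyc_def nth_append nth_Cons' min_def\<close>)
qed

definition kdiff :: "nat \<Rightarrow> nat \<Rightarrow> (nat list \<Rightarrow> 'k::field) \<Rightarrow> nat list \<Rightarrow> 'k" where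
  "kdiff p j v w = (if length w = p then \<Sum>t\<le>j. (-1) ^ t * v (permute_list (cyc j t) w) else 0)"

lemma kdiff_append:
  assumes "length L = Suc j" "length L + length a = p"
  shows "kdiff p j v (L @ a) = (\<Sum>t\<le>j. (-1) ^ t * v (take t L @ drop (Suc t) L @ L ! t # a))"
  using assms by (simp add: kdiff_def permute_cyc)

lemma kdiff_linear:
  "kdiff p j 0 = 0" "kdiff p j (u + v) = kdiff p j u + kdiff p j v"
  "kdiff p j (fscale c v) = fscale c (kdiff p j v)"
  by (auto simp: kdiff_def fun_eq_iff algebra_simps sum.distrib sum_distrib_left)

lemma coef_kdiff:
  assumes "j < p"
  shows "coef (tensor_pow p) m n M (kdiff p j v) = kdiff p j (coef (tensor_pow p) m n M v)"
proof
  fix w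
  show "coef (tensor_pow p) m n M (kdiff p j v) w = kdiff p j (coef (tensor_pow p) m n M v) w"
  proof (cases "length w = p")
    case True
    have "coef (tensor_pow p) m n M (kdiff p j v) =
      coef (tensor_pow p) m n M (\<lambda>x. \<Sum>t\<in>{..j}. (-1) ^ t * (\<lambda>t x. v (permute_list (cyc j t) x)) t x)"
      by (rule coef_cong) (simp add: kdiff_def words_def)
    then show ?thesis
      using True assms by (simp add: coef_linear(1) kdiff_def coef_permute[OF cyc_permutes])
  qed (simp add: kdiff_def tensor_pow_coef words_def)
qed

lemma swap_adj_same:
  assumes "Suc k < length w" "w ! k = w ! Suc k"
  shows "swap_adj k w = w"
proof -
  have sp: "w = take k w @ w ! Suc k # w ! Suc k # drop (Suc (Suc k)) w"
    using split_adj[OF assms(1)] assms(2) by simp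
  have "k = length (take k w)" using assms(1) by simp
  from swap_adj_append[OF this] show ?thesis using sp by metis
qed

text \<open>Swapping the places \<open>k\<close> and \<open>Suc k\<close> exchanges the summands
  \<open>t = k\<close> and \<open>t = Suc k\<close>, which carry opposite signs. In every other
  summand both letters stay in the first \<open>j\<close> places, shifted by one if the extracted
  letter stood before them, and the alternation of \<open>v\<close> applies. The same pairing of
  summands gives the vanishing for equal letters.\<close>

lemma kdiff_alternating:
  assumes a: "alternating p j v" and j: "j < p"
  shows "alternating p (Suc j) (kdiff p j v)"
proof -
  have jp: "j \<le> p" "Suc j \<le> p" using j by auto
  show ?thesis
    unfolding alternating_iff[OF jp(2)]
  proof (intro allI impI conjI)
    fix k and w :: "nat list"
    assume "length w = p \<and> Suc k < Suc j"
    then have w: "length w = p" and k: "k < j" by auto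
    define f where "f t = (-1) ^ t * v (permute_list (cyc j t) w)" for t
    define g where "g t = (-1) ^ t * v (permute_list (cyc j t) (swap_adj k w))" for t
    let ?\<tau> = "transpose k (Suc k)"
    have cp: "cyc j t permutes {..<length w}" if "t \<le> j" for t
      using cyc_permutes that j w by simp
    have \<tau>p: "transpose l (Suc l) permutes {..<length w}" if "l < j" for l
      using that j w by (intro transpose_permutes) auto
    have comp: "permute_list (cyc j t) (swap_adj k w) = permute_list (?\<tau> \<circ> cyc j t) w" if "t \<le> j" for t
      by (rule permute_list_compose[OF cp[OF that], symmetric])
    have g: "g t = - f (?\<tau> t)" if t: "t \<le> j" for t
    proof -
      consider "t < k" | "t = k" | "t = Suc k" | "Suc k < t" by linarith
      then show ?thesis
      proof cases
        case 1
        then obtain l where l: "k = Suc l" by (cases k) auto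
        have "?\<tau> \<circ> cyc j t = cyc j t \<circ> transpose l (Suc l)"
          using 1 k t l by (auto simp: fun_eq_iff cyc_def transpose_def)
        then have "permute_list (cyc j t) (swap_adj k w) = swap_adj l (permute_list (cyc j t) w)"
          using comp[OF t] permute_list_compose[OF \<tau>p[of l], of "cyc j t"] l k by simp
        then show ?thesis
          using alternating_swapD(1)[OF a jp(1), of "permute_list (cyc j t) w" l] w l k 1
          by (simp add: g_def f_def transpose_def)
      next
        case 2
        have "?\<tau> \<circ> cyc j t = cyc j (Suc k)"
          using 2 k t by (auto simp: fun_eq_iff cyc_def transpose_def)
        then show ?thesis using comp[OF t] 2 by (simp add: g_def f_def)
      next
        case 3
        have "?\<tau> \<circ> cyc j t = cyc j k"
          using 3 k t by (auto simp: fun_eq_iff cyc_def transpose_def)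
        then show ?thesis using comp[OF t] 3 by (simp add: g_def f_def)
      next
        case 4
        have "?\<tau> \<circ> cyc j t = cyc j t \<circ> ?\<tau>"
          using 4 k t by (auto simp: fun_eq_iff cyc_def transpose_def)
        then have "permute_list (cyc j t) (swap_adj k w) = swap_adj k (permute_list (cyc j t) w)"
          using comp[OF t] permute_list_compose[OF \<tau>p[of k], of "cyc j t"] k by simp
        then show ?thesis
          using alternating_swapD(1)[OF a jp(1), of "permute_list (cyc j t) w" k] w k 4 t
          by (simp add: g_def f_def transpose_def)
      qed
    qed
    have \<tau>j: "?\<tau> permutes {..j}" using k by (intro permutes_swap_id) auto
    have "(\<Sum>t\<le>j. g t) = - (\<Sum>t\<le>j. (f \<circ> ?\<tau>) t)"
      by (simp add: g sum_negf)
    also have "(\<Sum>t\<le>j. (f \<circ> ?\<tau>) t) = (\<Sum>t\<le>j. f t)"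
      by (rule sum.permute[OF \<tau>j, symmetric])
    finally show "kdiff p j v (swap_adj k w) = - kdiff p j v w"
      using w by (simp add: kdiff_def f_def g_def)
    assume eq: "w ! k = w ! Suc k"
    have gf: "g t = f t" for t
      unfolding g_def f_def using swap_adj_same[of k w] eq w k j by simp
    have "(\<Sum>t\<le>j. f t) = 0"
    proof (rule sum_involution[where \<tau> = ?\<tau>])
      show "?\<tau> t \<in> {..j}" if "t \<in> {..j}" for t using permutes_in_image[OF \<tau>j, of t] that by simp
      show "f (?\<tau> t) = - f t" if "t \<in> {..j}" for t using g[of t] gf[of t] that by simp
      show "f t = 0" if tj: "t \<in> {..j}" and fixed: "?\<tau> t = t" for t
      proof -
        have t: "t \<le> j" using tj by simp
        have "t \<noteq> k" proof assume "t = k" then show False using fixed by simp qed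
        moreover have "t \<noteq> Suc k" proof assume "t = Suc k" then show False using fixed by simp qed
        ultimately have ne: "t \<noteq> k" "t \<noteq> Suc k" by auto
        let ?u = "permute_list (cyc j t) w"
        show ?thesis
        proof (cases "t < k")
          case True
          then obtain l where l: "k = Suc l" by (cases k) auto
          have "?u ! l = w ! k" "?u ! Suc l = w ! Suc k"
            using True l k j w by (simp_all add: permute_list_nth[OF cp[OF t]] cyc_def)
          then have "v ?u = 0"
            using alternating_swapD(2)[OF a jp(1), of ?u l] eq l k w by simp
          then show ?thesis by (simp add: f_def)
        next
          case False
          then have "Suc k < t" using ne by simp
          then have "?u ! k = w ! k" "?u ! Suc k = w ! Suc k"
            using t j w by (simp_all add: permute_list_nth[OF cp[OF t]] cyc_def)
          then have "v ?u = 0"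
            using alternating_swapD(2)[OF a jp(1), of ?u k] eq \<open>Suc k < t\<close> t w by simp
          then show ?thesis by (simp add: f_def)
        qed
      qed
    qed auto
    then show "kdiff p j v w = 0" using w by (simp add: kdiff_def f_def)
  qed
qed

lemma kdiff_symmetric:
  assumes a: "symmetric p j v" and j: "j < p"
  shows "symmetric p (Suc j) (kdiff p j v)"
  unfolding symmetric_iff
proof (intro allI impI)
  fix k and w :: "nat list"
  assume "length w = p \<and> Suc j \<le> k \<and> Suc k < p"
  then have w: "length w = p" and k: "j < k" "Suc k < p" by auto
  have "v (permute_list (cyc j t) (swap_adj k w)) = v (permute_list (cyc j t) w)" if t: "t \<le> j" for t
  proof -
    have "transpose k (Suc k) \<circ> cyc j t = cyc j t \<circ> transpose k (Suc k)"
      using k t by (auto simp: fun_eq_iff cyc_def transpose_def)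
    moreover have "cyc j t permutes {..<length w}" "transpose k (Suc k) permutes {..<length w}"
      using cyc_permutes[OF t j] w k by (auto intro!: transpose_permutes)
    ultimately have "permute_list (cyc j t) (swap_adj k w) = swap_adj k (permute_list (cyc j t) w)"
      using permute_list_compose by metis
    then show ?thesis using symmetric_swapD[OF a, of "permute_list (cyc j t) w" k] w k by simp
  qed
  then show "kdiff p j v (swap_adj k w) = kdiff p j v w" by (simp add: kdiff_def)
qed

lemma kdiff_in:
  assumes "v \<in> ob (koszul_term p j) n" "j < p"
  shows "kdiff p j v \<in> ob (koszul_term p (Suc j)) n"
  using assms kdiff_alternating kdiff_symmetric permute_words[OF cyc_permutes[OF _ assms(2)]]
  by (auto simp: koszul_term_simps tensor_pow_ob kdiff_def)

text \<open>Extracting two letters in either order gives words that differ by a swap of the places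
  \<open>j\<close> and \<open>Suc j\<close>, where \<open>v\<close> is symmetric, while the parity
  of \<open>t + s\<close> changes.\<close>

lemma kdiff_kdiff:
  assumes a: "symmetric p j v" and j: "Suc j < p"
  shows "kdiff p (Suc j) (kdiff p j v) w = 0"
proof (cases "length w = p")
  case True
  define F where "F t s = (-1) ^ (t + s) * v (permute_list (cyc (Suc j) t \<circ> cyc j s) w)" for t s
  have cp: "cyc (Suc j) t permutes {..<length w}" "cyc j s permutes {..<length w}" if "t \<le> Suc j" "s \<le> j" for t s
    using cyc_permutes that j True by simp_all
  have \<tau>: "transpose j (Suc j) permutes {..<length w}" using True j by (intro transpose_permutes) auto
  have cancel: "F s (t - 1) = - F t s" if st: "s < t" "t \<le> Suc j" for s t
  proof -
    obtain t' where t': "t = Suc t'" using st by (cases t) auto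
    have "cyc (Suc j) s \<circ> cyc j t' = (cyc (Suc j) t \<circ> cyc j s) \<circ> transpose j (Suc j)"
      using st by (auto simp: fun_eq_iff cyc_def transpose_def t')
    then have "permute_list (cyc (Suc j) s \<circ> cyc j t') w = swap_adj j (permute_list (cyc (Suc j) t \<circ> cyc j s) w)"
      using permute_list_compose[OF \<tau>] by metis
    then have "v (permute_list (cyc (Suc j) s \<circ> cyc j t') w) = v (permute_list (cyc (Suc j) t \<circ> cyc j s) w)"
      using symmetric_swapD[OF a, of "permute_list (cyc (Suc j) t \<circ> cyc j s) w" j] True j by simp
    then show ?thesis by (simp add: F_def t' add.commute)
  qed
  \<comment> \<open>The same two letters extracted in the opposite order; the one further to the
    right changes its index by one.\<close>
  let ?\<psi> = "\<lambda>(t, s). if s < t then (s, t - 1) else (Suc s, t)"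
  have "kdiff p (Suc j) (kdiff p j v) w = (\<Sum>t\<le>Suc j. \<Sum>s\<le>j. F t s)"
    unfolding kdiff_def
    using True cp by (auto simp: sum_distrib_left F_def power_add mult.assoc permute_list_compose
        simp del: sum.atMost_Suc intro!: sum.cong)
  also have "\<dots> = (\<Sum>(t, s)\<in>{..Suc j} \<times> {..j}. F t s)" by (simp add: sum.cartesian_product del: sum.atMost_Suc)
  also have "\<dots> = 0"
  proof (rule sum_involution[where \<tau> = ?\<psi>])
    show "(case ?\<psi> x of (t, s) \<Rightarrow> F t s) = - (case x of (t, s) \<Rightarrow> F t s)" if "x \<in> {..Suc j} \<times> {..j}" for x
    proof -
      obtain t s where ts: "x = (t, s)" by (cases x)
      then have x: "x = (t, s)" "t \<le> Suc j" "s \<le> j" using that by simp_all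
      show ?thesis
        using cancel[of s t] cancel[of t "Suc s"] x by (cases "s < t") auto
    qed
  qed (auto split: if_splits)
  finally show ?thesis .
qed (simp add: kdiff_def)

text \<open>
  A contracting homotopy of the dual Koszul complex, compatible with the basis but not natural: it
  moves the least letter from the exterior to the symmetric factor, and gives \<open>0\<close> where it cannot.
\<close>

definition cone :: "nat \<Rightarrow> (nat list \<Rightarrow> 'k::field) \<Rightarrow> nat list \<Rightarrow> 'k" where
  "cone i v w = (let x = Min (set w) in
     if x \<in> set (drop i w) \<and> x \<notin> set (take i w) then v (x # take i w @ remove1 x (drop i w)) else 0)"

lemma cone_append:
  "length L = i \<Longrightarrow> cone i v (L @ a) =
    (if Min (set L \<union> set a) \<in> set a \<and> Min (set L \<union> set a) \<notin> set L
     then v (Min (set L \<union> set a) # L @ remove1 (Min (set L \<union> set a)) a) else 0)"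
  by (simp add: cone_def Let_def)

text \<open>The least letter depends only on the set of letters, so moving it is compatible with
  rearrangements inside either part.\<close>

lemma cone_in:
  assumes v: "v \<in> ob (koszul_term p (Suc i)) n" and i: "Suc i \<le> p"
  shows "cone i v \<in> ob (koszul_term p i) n"
  unfolding koszul_term_simps
proof (intro conjI)
  have alt: "alternating p (Suc i) v" and sym: "symmetric p (Suc i) v" and t: "v \<in> ob (tensor_pow p) n"
    using v by (simp_all add: koszul_term_simps)
  show "cone i v \<in> ob (tensor_pow p) n"
    unfolding tensor_pow_ob
  proof (intro allI impI)
    fix w assume w: "w \<notin> words p n"
    let ?x = "Min (set w)"
    show "cone i v w = 0"
    proof (cases "?x \<in> set (drop i w)")
      case True
      have "mset (?x # take i w @ remove1 ?x (drop i w)) = mset (take i w) + mset (drop i w)"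
        using True by simp
      also have "\<dots> = mset w" by (metis append_take_drop_id mset_append)
      finally have "?x # take i w @ remove1 ?x (drop i w) \<notin> words p n" using w words_mset by blast
      then show ?thesis using t unfolding tensor_pow_ob cone_def Let_def by simp
    qed (simp add: cone_def Let_def)
  qed
  show "alternating p i (cone i v)"
    unfolding alternating_def
  proof (intro allI impI)
    fix P R :: "nat list" and x y
    assume l: "length P + length R + 2 = p \<and> length P + 2 \<le> i"
    define A where "A = take (i - length P - 2) R"
    define a where "a = drop (i - length P - 2) R"
    have R: "R = A @ a" "length A = i - length P - 2" using l i by (auto simp: A_def a_def)
    have len: "length (P @ c # d # A) = i" for c d
    proof -
      have "length P + 2 \<le> i" using l by blast
      then show ?thesis using R(2) by simp
    qed
    have key: "cone i v (P @ c # d # R) =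
        (let S = set (P @ c # d # A @ a) in if Min S \<in> set a \<and> Min S \<notin> set (P @ c # d # A)
         then v ((Min S # P) @ c # d # A @ remove1 (Min S) a) else 0)" for c d
      using cone_append[OF len, of v c d a] unfolding R by (simp add: Let_def Un_assoc)
    have la: "length (z # P) + length (A @ remove1 z a) + 2 = p" if "z \<in> set a" for z
    proof -
      have "length P + 2 \<le> i" "length P + (length A + length a) + 2 = p" using l R(1) by auto
      then show ?thesis using Suc_length_remove1[OF that] by simp
    qed
    have lb: "length (z # P) + 2 \<le> Suc i" for z using l by simp
    have s: "set (P @ y # x # A @ a) = set (P @ x # y # A @ a)" "set (P @ y # x # A) = set (P @ x # y # A)" by auto
    show "cone i v (P @ y # x # R) = - cone i v (P @ x # y # R) \<and> cone i v (P @ x # x # R) = 0"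
    proof
      have e: "v ((z # P) @ y # x # A @ remove1 z a) = - v ((z # P) @ x # y # A @ remove1 z a)"
        if "z \<in> set a" for z
        by (rule alternatingD(1)[OF alt la[OF that] lb])
      show "cone i v (P @ y # x # R) = - cone i v (P @ x # y # R)"
        unfolding key s Let_def using e[of "Min (set (P @ x # y # A @ a))"] by auto
      have e0: "v ((z # P) @ x # x # A @ remove1 z a) = 0" if "z \<in> set a" for z
        by (rule alternatingD(2)[OF alt la[OF that] lb])
      show "cone i v (P @ x # x # R) = 0"
        unfolding key Let_def using e0[of "Min (set (P @ x # x # A @ a))"] by auto
    qed
  qed
  show "symmetric p i (cone i v)"
    unfolding symmetric_def
  proof (intro allI impI)
    fix P R :: "nat list" and x y
    assume l: "length P + length R + 2 = p \<and> i \<le> length P"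
    define L where "L = take i P"
    define A where "A = drop i P"
    have P: "P = L @ A" "length L = i" using l by (auto simp: L_def A_def)
    let ?a = "A @ x # y # R" and ?b = "A @ y # x # R"
    have set_ab: "set ?b = set ?a" by auto
    have m: "mset ?b = mset ?a" by simp
    have "v ((z # L) @ remove1 z ?b) = v ((z # L) @ remove1 z ?a)" if "z \<in> set ?a" for z
    proof (rule symmetric_mset[OF sym])
      show "Suc i \<le> length (z # L)" using P by simp
      show "mset (remove1 z ?b) = mset (remove1 z ?a)" by (simp only: mset_remove1 m)
      have "z \<in> set ?b" using that set_ab by blast
      then show "length (z # L) + length (remove1 z ?b) = p" using l P Suc_length_remove1[of z ?b] by simp
    qed
    then show "cone i v (P @ y # x # R) = cone i v (P @ x # y # R)"
      using cone_append[OF P(2), of v ?a] cone_append[OF P(2), of v ?b]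
      unfolding P append_assoc set_ab by simp
  qed
qed

text \<open>Let \<open>x\<close> be the least letter. If \<open>x\<close> is not in the exterior
  part \<open>L\<close>, then \<open>cone\<close> puts it in front of \<open>L\<close>; the summand
  of \<open>kdiff\<close> that extracts it again returns \<open>v w\<close>, and the other summands
  cancel against \<open>kdiff p i (cone i v)\<close>. If \<open>x\<close> is in \<open>L\<close>,
  the second term is 0, and in the first only the summand extracting \<open>x\<close> survives; its
  sign is that of moving \<open>x\<close> to the front of \<open>L\<close>. If \<open>x\<close>
  occurs twice in \<open>L\<close>, both sides vanish.\<close>

lemma kdiff_cone:
  assumes alt: "alternating p (Suc i) v" and sym: "symmetric p (Suc i) v" and i: "Suc i < p" and w: "length w = p"
  shows "kdiff p i (cone i v) w + cone (Suc i) (kdiff p (Suc i) v) w = v w"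
proof -
  define L a where "L = take (Suc i) w" and "a = drop (Suc i) w"
  have wLa: "w = L @ a" and lL: "length L = Suc i" and la: "Suc i + length a = p"
    using w i by (simp_all add: L_def a_def)
  define x where "x = Min (set L \<union> set a)"
  let ?del = "\<lambda>t. take t L @ drop (Suc t) L"
  have sL: "set L = insert (L ! t) (set (?del t))" if "t \<le> i" for t
  proof -
    have "set L = set (take t L @ L ! t # drop (Suc t) L)" using id_take_nth_drop[of t L] that lL by simp
    then show ?thesis by simp
  qed
  have k1: "kdiff p i (cone i v) w = (\<Sum>t\<le>i. (-1) ^ t *
     (if x \<in> insert (L ! t) (set a) \<and> x \<notin> set (?del t) then v (x # ?del t @ remove1 x (L ! t # a)) else 0))"
    unfolding wLa
  proof (subst kdiff_append)
    show "length L = Suc i" "length L + length a = p" using lL la by auto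
    have "cone i v (?del t @ L ! t # a) =
      (if x \<in> insert (L ! t) (set a) \<and> x \<notin> set (?del t) then v (x # ?del t @ remove1 x (L ! t # a)) else 0)"
      if t: "t \<le> i" for t
    proof -
      have len: "length (?del t) = i" using lL t by simp
      have "set (?del t) \<union> set (L ! t # a) = set L \<union> set a" using sL[OF t] by auto
      then show ?thesis unfolding cone_append[OF len] x_def by simp
    qed
    then show "(\<Sum>t\<le>i. (-1) ^ t * cone i v (take t L @ drop (Suc t) L @ L ! t # a)) = (\<Sum>t\<le>i. (-1) ^ t *
     (if x \<in> insert (L ! t) (set a) \<and> x \<notin> set (?del t) then v (x # ?del t @ remove1 x (L ! t # a)) else 0))"
      by (intro sum.cong) (simp_all)
  qed
  have k2: "cone (Suc i) (kdiff p (Suc i) v) w =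
    (if x \<in> set a \<and> x \<notin> set L then kdiff p (Suc i) v (x # L @ remove1 x a) else 0)"
    unfolding wLa cone_append[OF lL] x_def by simp
  show ?thesis
  proof (cases "x \<in> set L")
    case False
    have "x \<in> set L \<union> set a" unfolding x_def using lL by (intro Min_in) auto
    then have xa: "x \<in> set a" using False by simp
    let ?r = "remove1 x a"
    have lr: "length (x # L) + length ?r = p" using la lL Suc_length_remove1[OF xa] by simp
    have "kdiff p (Suc i) v (x # L @ ?r) = kdiff p (Suc i) v ((x # L) @ ?r)" by simp
    also have "\<dots> = (\<Sum>t\<le>Suc i. (-1) ^ t * v (take t (x # L) @ drop (Suc t) (x # L) @ (x # L) ! t # ?r))"
      by (rule kdiff_append) (use lL lr in auto)
    also have "\<dots> = v (L @ x # ?r) + (\<Sum>t\<le>i. (-1) ^ Suc t * v (x # ?del t @ L ! t # ?r))"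
      by (subst sum.atMost_Suc_shift) simp
    also have "v (L @ x # ?r) = v (L @ a)"
      by (rule symmetric_mset[OF sym]) (use lL lr xa in auto)
    finally have "kdiff p (Suc i) v (x # L @ ?r) = v w - (\<Sum>t\<le>i. (-1) ^ t * v (x # ?del t @ L ! t # ?r))"
      by (simp add: wLa sum_negf)
    moreover have "kdiff p i (cone i v) w = (\<Sum>t\<le>i. (-1) ^ t * v (x # ?del t @ L ! t # ?r))"
      unfolding k1
    proof (rule sum.cong[OF refl])
      fix t assume "t \<in> {..i}"
      then have "x \<noteq> L ! t" "x \<notin> set (?del t)" using sL[of t] False by auto
      then show "(-1) ^ t * (if x \<in> insert (L ! t) (set a) \<and> x \<notin> set (?del t)
          then v (x # ?del t @ remove1 x (L ! t # a)) else 0) = (-1) ^ t * v (x # ?del t @ L ! t # ?r)"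
        using xa by simp
    qed
    ultimately show ?thesis using k2 xa False by simp
  next
    case True
    then obtain t0 where t0: "t0 \<le> i" "L ! t0 = x" using lL by (auto simp: in_set_conv_nth less_Suc_eq_le)
    have other: "x \<in> set (?del t)" if t: "t \<le> i" "t \<noteq> t0" for t
    proof (cases "t0 < t")
      case True
      then have "x = take t L ! t0" "t0 < length (take t L)" using t0 t lL by auto
      then show ?thesis using nth_mem[of t0 "take t L"] by simp
    next
      case False
      then have "x = drop (Suc t) L ! (t0 - Suc t)" "t0 - Suc t < length (drop (Suc t) L)" using t0 t lL by auto
      then show ?thesis using nth_mem[of "t0 - Suc t" "drop (Suc t) L"] by simp
    qed
    have "kdiff p i (cone i v) w = (\<Sum>t\<le>i. if t = t0 then (-1) ^ t0 *
      (if x \<notin> set (?del t0) then v (x # ?del t0 @ a) else 0) else 0)"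
      unfolding k1
    proof (rule sum.cong[OF refl])
      fix t assume t: "t \<in> {..i}"
      show "(-1) ^ t * (if x \<in> insert (L ! t) (set a) \<and> x \<notin> set (?del t)
          then v (x # ?del t @ remove1 x (L ! t # a)) else 0) =
        (if t = t0 then (-1) ^ t0 * (if x \<notin> set (?del t0) then v (x # ?del t0 @ a) else 0) else 0)"
      proof (cases "t = t0")
        case True
        then show ?thesis using t0 by simp
      next
        case False
        then have "x \<in> set (?del t)" using other t by blast
        then show ?thesis using False by simp
      qed
    qed
    also have "\<dots> = (-1) ^ t0 * (if x \<notin> set (?del t0) then v (x # ?del t0 @ a) else 0)"
      using t0 by simp
    also have "\<dots> = v w"
    proof (cases "x \<in> set (?del t0)")
      case True
      have "\<not> distinct (take t0 L @ x # drop (Suc t0) L)" using True by auto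
      moreover have "L = take t0 L @ x # drop (Suc t0) L" using id_take_nth_drop[of t0 L] t0 lL by simp
      then have "distinct L = distinct (take t0 L @ x # drop (Suc t0) L)" by (rule arg_cong)
      ultimately have "\<not> distinct L" by blast
      then have "v w = 0" using alternating_repeat[OF alt _ w] i by (simp add: L_def)
      then show ?thesis using True by simp
    next
      case False
      have "v ([] @ x # take t0 L @ (drop (Suc t0) L @ a)) = (-1) ^ length (take t0 L) * v ([] @ take t0 L @ x # (drop (Suc t0) L @ a))"
        by (rule alternating_move[OF alt]) (use lL la t0 in auto)
      moreover have "take t0 L @ x # (drop (Suc t0) L @ a) = w"
      proof -
        have "(take t0 L @ x # drop (Suc t0) L) @ a = w"
          using id_take_nth_drop[of t0 L] t0 lL wLa by simp
        then show ?thesis by simp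
      qed
      ultimately show ?thesis using False t0 lL by (simp flip: power_add mult.assoc)
    qed
    finally show ?thesis using k2 True by simp
  qed
qed

text \<open>The left end of the complex: without exterior letters the least letter always lies in
  the symmetric part, so \<open>cone\<close> alone undoes \<open>kdiff\<close>.\<close>

lemma cone_kdiff_0:
  assumes sym: "symmetric p 0 v" and w: "length w = p" and p: "0 < p"
  shows "cone 0 (kdiff p 0 v) w = v w"
proof -
  let ?x = "Min (set w)"
  have x: "?x \<in> set w" using w p by (intro Min_in) auto
  have lw: "length [?x] + length (remove1 ?x w) = p" using w Suc_length_remove1[OF x] by simp
  have "cone 0 (kdiff p 0 v) w = kdiff p 0 v ([?x] @ remove1 ?x w)"
    using x by (simp add: cone_def Let_def)
  also have "\<dots> = v ([] @ ?x # remove1 ?x w)"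
    using kdiff_append[of "[?x]" 0 "remove1 ?x w" p v] lw by simp
  also have "\<dots> = v ([] @ w)" by (rule symmetric_mset[OF sym]) (use x lw in auto)
  finally show ?thesis by simp
qed

lemma kdiff_exact_0:
  assumes v: "v \<in> ob (koszul_term p 0) n" and p: "0 < p" and z: "kdiff p 0 v = 0"
  shows "v = 0"
proof
  fix w
  show "v w = 0 w"
  proof (cases "length w = p")
    case True
    have "v w = cone 0 (kdiff p 0 v) w"
      using cone_kdiff_0[of p v w] True p v by (simp add: koszul_term_simps)
    then show ?thesis by (simp add: z cone_def Let_def)
  next
    case False
    then have "w \<notin> words p n" by (simp add: words_def)
    then show ?thesis using v by (simp add: koszul_term_simps tensor_pow_ob)
  qed
qed

lemma kdiff_exact:
  assumes v: "v \<in> ob (koszul_term p (Suc i)) n" and i: "Suc i < p" and z: "kdiff p (Suc i) v = 0"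
  shows "kdiff p i (cone i v) = v" "cone i v \<in> ob (koszul_term p i) n"
proof -
  show "cone i v \<in> ob (koszul_term p i) n" using cone_in[OF v] i by simp
  show "kdiff p i (cone i v) = v"
  proof
    fix w
    show "kdiff p i (cone i v) w = v w"
    proof (cases "length w = p")
      case True
      have "cone (Suc i) (kdiff p (Suc i) v) w = 0" by (simp add: z cone_def Let_def)
      then show ?thesis
        using kdiff_cone[of p i v w] i True v by (simp add: koszul_term_simps)
    next
      case False
      then have "w \<notin> words p n" by (simp add: words_def)
      then show ?thesis using v False by (simp add: koszul_term_simps tensor_pow_ob kdiff_def)
    qed
  qed
qed

section \<open>Projectivity of the terms of the Koszul complex\<close>

text \<open>The word behind the generator: \<open>j\<close> light letters, once each, and then
  copies of the heavy letter \<open>j\<close>. It lives on \<open>j + 1\<close> letters, so the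
  Yoneda argument evaluates functors at \<open>Suc j\<close>.\<close>

definition std_word :: "nat \<Rightarrow> nat \<Rightarrow> nat list" where
  "std_word p j = [0..<j] @ replicate (p - j) j"

lemma std_word_nth: "i < p \<Longrightarrow> j \<le> p \<Longrightarrow> std_word p j ! i = (if i < j then i else j)"
  by (simp add: std_word_def nth_append)

lemma length_std_word [simp]: "j \<le> p \<Longrightarrow> length (std_word p j) = p"
  by (simp add: std_word_def)

lemma std_word_in: "j \<le> p \<Longrightarrow> std_word p j \<in> words p (Suc j)"
  by (auto simp: words_def std_word_def)

text \<open>A pair with a light letter locates one of the first \<open>j\<close> letters of
  \<open>w\<close>; the pairs with the heavy letter remember only the multiset of the rest.\<close>

lemma zip_std_word_cong:
  fixes w w' :: "nat list"
  assumes j: "j \<le> p" and w: "length w = p" "length w' = p"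
    and eq: "mset (zip w (std_word p j)) = mset (zip w' (std_word p j))"
  shows "take j w = take j w'" "mset (drop j w) = mset (drop j w')"
proof -
  have nth: "w ! i = w' ! i" if i: "i < j" for i
  proof -
    have "(w ! i, i) \<in> set (zip w (std_word p j))"
      using i j w by (auto simp: in_set_conv_nth std_word_nth intro!: exI[of _ i])
    then have "(w ! i, i) \<in> set (zip w' (std_word p j))" using mset_eq_setD[OF eq] by blast
    then obtain l where l: "l < p" "w ! i = w' ! l" "i = std_word p j ! l"
      using w j by (auto simp: in_set_conv_nth)
    then have "l = i" using i j by (auto simp: std_word_nth split: if_splits)
    then show ?thesis using l by simp
  qed
  then show tk: "take j w = take j w'"
    using w j by (intro nth_equalityI) auto
  have split: "zip x (std_word p j) = zip (take j x) [0..<j] @ zip (drop j x) (replicate (p - j) j)"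
    if "length x = p" for x :: "nat list"
    using zip_append[of "take j x" "[0..<j]" "drop j x" "replicate (p - j) j"] that j
    by (simp add: std_word_def)
  have "mset (zip (drop j w) (replicate (p - j) j)) = mset (zip (drop j w') (replicate (p - j) j))"
    using eq unfolding split[OF w(1)] split[OF w(2)] tk by simp
  then have "mset (map fst (zip (drop j w) (replicate (p - j) j))) = mset (map fst (zip (drop j w') (replicate (p - j) j)))"
    by (simp only: mset_map)
  then show "mset (drop j w) = mset (drop j w')" using w by simp
qed

lemma koszul_term_cong:
  assumes v: "v \<in> ob (koszul_term p j) n" and j: "j \<le> p" and w: "length w = p" "length w' = p"
    and eq: "mset (zip w (std_word p j)) = mset (zip w' (std_word p j))"
  shows "v w = v w'"
proof -
  have sym: "symmetric p j v" using v by (simp add: koszul_term_simps)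
  have "v w = v (take j w @ drop j w)" by simp
  also have "\<dots> = v (take j w @ drop j w')"
    by (rule symmetric_mset[OF sym]) (use zip_std_word_cong[OF j w eq] w j in auto)
  also have "take j w @ drop j w' = w'" by (simp add: zip_std_word_cong(1)[OF j w eq])
  finally show ?thesis .
qed

lemma mset_zip_reorder:
  assumes "mset c = mset s" "length w = length c"
  obtains \<sigma> where "\<sigma> permutes {..<length c}" "mset (zip w c) = mset (zip (permute_list \<sigma> w) s)"
proof -
  obtain \<sigma> where \<sigma>: "\<sigma> permutes {..<length c}" "permute_list \<sigma> c = s"
    using mset_eq_permutation[of s c] assms by metis
  have "zip (permute_list \<sigma> w) s = permute_list \<sigma> (zip w c)"
    using permute_list_zip[OF \<sigma>(1), of w c] assms(2) \<sigma>(2) by simp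
  then have "mset (zip (permute_list \<sigma> w) s) = mset (zip w c)" using \<sigma>(1) assms(2) by simp
  then show thesis by (intro that[of \<sigma>] \<sigma>(1)) simp
qed

text \<open>The monomials whose column indices have the weight of \<open>std_word\<close>; they
  correspond to words modulo rearrangement of the letters from place \<open>j\<close> on.\<close>

definition std_monomials :: "nat \<Rightarrow> nat \<Rightarrow> nat \<Rightarrow> (nat \<times> nat) multiset set" where
  "std_monomials p j n = (\<lambda>w. mset (zip w (std_word p j))) ` words p n"

definition std_rep :: "nat \<Rightarrow> nat \<Rightarrow> nat \<Rightarrow> (nat \<times> nat) multiset \<Rightarrow> nat list" where
  "std_rep p j n = inv_into (words p n) (\<lambda>w. mset (zip w (std_word p j)))"

text \<open>
  By the Yoneda lemma, an element \<open>x\<close> of \<open>T(k\<^bsup>j+1\<^esup>)\<close> gives a morphism from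
  \<open>I\<^bsup>\<otimes>j\<^esup> \<otimes> \<Gamma>\<^bsup>p-j\<^esup>\<close> to \<open>T\<close>; here it is restricted to \<open>\<Lambda>\<^sup>j \<otimes> \<Gamma>\<^bsup>p-j\<^esup>\<close>.
\<close>

definition yoneda_map :: "nat \<Rightarrow> nat \<Rightarrow> ('k::field, 'b) spfun \<Rightarrow> ('b \<Rightarrow> 'k) \<Rightarrow> ('k, nat list, 'b) spmor" where
  "yoneda_map p j T x n v = (if v \<in> ob (koszul_term p j) n
     then \<Sum>M\<in>std_monomials p j n. fscale (v (std_rep p j n M)) (coef T (Suc j) n M x) else 0)"

lemma finite_std_monomials [simp]: "finite (std_monomials p j n)"
  by (simp add: std_monomials_def)

lemma std_rep:
  assumes "M \<in> std_monomials p j n"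
  shows "std_rep p j n M \<in> words p n" "mset (zip (std_rep p j n M) (std_word p j)) = M"
  using inv_into_into[of M "\<lambda>w. mset (zip w (std_word p j))" "words p n"]
    f_inv_into_f[of M "\<lambda>w. mset (zip w (std_word p j))" "words p n"] assms
  by (simp_all add: std_rep_def std_monomials_def)

lemma eval_std_rep:
  assumes v: "v \<in> ob (koszul_term p j) n" and j: "j \<le> p" and w: "w \<in> words p n"
  shows "v (std_rep p j n (mset (zip w (std_word p j)))) = v w"
proof -
  have M: "mset (zip w (std_word p j)) \<in> std_monomials p j n" using w by (simp add: std_monomials_def)
  show ?thesis
    by (rule koszul_term_cong[OF v j]) (use std_rep[OF M] w in \<open>auto simp: words_def\<close>)
qed

lemma std_monomials_zip:
  assumes "j \<le> p" "w \<in> words p n" "length c = p"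
  shows "mset (zip w c) \<in> std_monomials p j n \<longleftrightarrow> mset c = mset (std_word p j)"
proof
  assume "mset (zip w c) \<in> std_monomials p j n"
  then obtain w' where w': "w' \<in> words p n" "mset (zip w c) = mset (zip w' (std_word p j))"
    by (auto simp: std_monomials_def)
  have "map snd (zip w c) = c" "map snd (zip w' (std_word p j)) = std_word p j"
    using assms w' by (simp_all add: words_def)
  then show "mset c = mset (std_word p j)"
    using arg_cong[OF w'(2), of "image_mset snd"] by (simp flip: mset_map)
next
  assume "mset c = mset (std_word p j)"
  moreover have "length w = length c" using assms by (simp add: words_def)
  ultimately obtain \<sigma> where \<sigma>: "\<sigma> permutes {..<length c}"
    "mset (zip w c) = mset (zip (permute_list \<sigma> w) (std_word p j))"
    by (rule mset_zip_reorder)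
  then show "mset (zip w c) \<in> std_monomials p j n"
    using assms permute_words[of \<sigma> p w n] by (auto simp: std_monomials_def)
qed

lemma std_monomials_subset: "j \<le> p \<Longrightarrow> std_monomials p j n \<subseteq> monomials p n (Suc j)"
  using zip_monomial std_word_in by (auto simp: std_monomials_def)

text \<open>Naturality of the Yoneda map, one coefficient at a time. Expanding
  \<open>comp_coeff\<close> over intermediate words \<open>y\<close> produces the action of
  \<open>N\<close> on \<open>v\<close>. The monomials \<open>mset (zip y c)\<close> have the column
  weight of \<open>K\<close>, so for another weight nothing remains.\<close>

lemma yoneda_coeff:
  assumes v: "v \<in> ob (koszul_term p j) m" and j: "j \<le> p"
    and K: "K \<in> monomials p n (Suc j)"
  shows "(\<Sum>M\<in>std_monomials p j m. comp_coeff m N M K * v (std_rep p j m M)) =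
    (if K \<in> std_monomials p j n then coef (tensor_pow p) m n N v (std_rep p j n K) else 0)"
proof -
  have expand: "(\<Sum>M\<in>std_monomials p j m. comp_coeff m N M K * v (std_rep p j m M)) =
    (\<Sum>y\<in>words p m. if mset (zip w y) = N \<and> mset (zip y c) \<in> std_monomials p j m
       then v (std_rep p j m (mset (zip y c))) else 0)"
    if K: "K = mset (zip w c)" and w: "w \<in> words p n" and c: "length c = p" for w c
  proof -
    have "(\<Sum>M\<in>std_monomials p j m. comp_coeff m N M K * v (std_rep p j m M)) =
      (\<Sum>M\<in>std_monomials p j m. \<Sum>y\<in>words p m.
         if mset (zip y c) = M then if mset (zip w y) = N then v (std_rep p j m M) else 0 else 0)"
      unfolding K using w c by (auto simp: words_def comp_coeff_words sum_distrib_right intro!: sum.cong)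
    also have "\<dots> = (\<Sum>y\<in>words p m. \<Sum>M\<in>std_monomials p j m.
         if mset (zip y c) = M then if mset (zip w y) = N then v (std_rep p j m M) else 0 else 0)"
      by (rule sum.swap)
    also have "\<dots> = (\<Sum>y\<in>words p m. if mset (zip w y) = N \<and> mset (zip y c) \<in> std_monomials p j m
       then v (std_rep p j m (mset (zip y c))) else 0)"
      by (intro sum.cong) auto
    finally show ?thesis .
  qed
  show ?thesis
  proof (cases "K \<in> std_monomials p j n")
    case True
    let ?w = "std_rep p j n K"
    have w: "?w \<in> words p n" "K = mset (zip ?w (std_word p j))" using std_rep[OF True] by auto
    have "(\<Sum>M\<in>std_monomials p j m. comp_coeff m N M K * v (std_rep p j m M)) =
      (\<Sum>y\<in>words p m. if mset (zip ?w y) = N then v y else 0)"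
      unfolding expand[OF w(2,1) length_std_word[OF j]]
    proof (rule sum.cong[OF refl])
      fix y assume y: "y \<in> words p m"
      have "mset (zip y (std_word p j)) \<in> std_monomials p j m" using y by (simp add: std_monomials_def)
      then show "(if mset (zip ?w y) = N \<and> mset (zip y (std_word p j)) \<in> std_monomials p j m
         then v (std_rep p j m (mset (zip y (std_word p j)))) else 0) = (if mset (zip ?w y) = N then v y else 0)"
        using eval_std_rep[OF v j y] by simp
    qed
    then show ?thesis using True w(1) by (simp add: tensor_pow_coef_sum)
  next
    case False
    obtain w c where wc: "K = mset (zip w c)" "w \<in> words p n" "c \<in> words p (Suc j)"
      using monomialsE[OF K] .
    have c: "length c = p" using wc by (simp add: words_def)
    then have "mset c \<noteq> mset (std_word p j)" using std_monomials_zip[OF j wc(2) c] False wc(1) by simp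
    then have "mset (zip y c) \<notin> std_monomials p j m" if "y \<in> words p m" for y
      using std_monomials_zip[OF j that c] by simp
    then show ?thesis unfolding expand[OF wc(1,2) c] using False by simp
  qed
qed

lemma yoneda_map_hom:
  fixes T :: "('k::field, 'b) spfun"
  assumes T: "spf p T" and x: "x \<in> ob T (Suc j)" and j: "j \<le> p"
  shows "yoneda_map p j T x \<in> spf_hom (koszul_term p j) T"
proof -
  note subT = spf_subspace[OF T]
  note subQ = spf_subspace[OF spf_koszul_term[OF j]]
  have cT: "coef T m n M y \<in> ob T n" if "y \<in> ob T m" for m n M y
    using linear_between_in[OF spf_linear_between[OF T]] that .
  have lin: "linear_between (ob (koszul_term p j) n) (ob T n) (yoneda_map p j T x n)" for n
    unfolding linear_between_def
  proof (intro conjI ballI allI)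
    fix v :: "nat list \<Rightarrow> 'k" assume v: "v \<in> ob (koszul_term p j) n"
    show "yoneda_map p j T x n v \<in> ob T n"
      using v by (simp add: yoneda_map_def)
        (intro fvs.subspace_sum[OF subT] fvs.subspace_scale[OF subT] cT x)
    show "yoneda_map p j T x n (fscale c v) = fscale c (yoneda_map p j T x n v)" for c
      using v fvs.subspace_scale[OF subQ v, of c]
      by (simp add: yoneda_map_def fvs.scale_sum_right)
    fix w :: "nat list \<Rightarrow> 'k" assume w: "w \<in> ob (koszul_term p j) n"
    show "yoneda_map p j T x n (v + w) = yoneda_map p j T x n v + yoneda_map p j T x n w"
      using v w fvs.subspace_add[OF subQ v w]
      by (simp add: yoneda_map_def fvs.scale_left_distrib sum.distrib)
  qed
  have nat: "yoneda_map p j T x n (coef (koszul_term p j) m n N v) = coef T m n N (yoneda_map p j T x m v)"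
    if v: "v \<in> ob (koszul_term p j) m" for m n N v
  proof -
    have "coef T m n N (yoneda_map p j T x m v) =
       coef T m n N (\<Sum>M\<in>std_monomials p j m. fscale (v (std_rep p j m M)) (coef T (Suc j) m M x))"
      using v by (simp add: yoneda_map_def)
    also have "\<dots> = (\<Sum>M\<in>std_monomials p j m. coef T m n N (fscale (v (std_rep p j m M)) (coef T (Suc j) m M x)))"
      by (rule linear_between_sum[OF spf_linear_between[OF T] subT]) (intro fvs.subspace_scale[OF subT] cT x)
    also have "\<dots> = (\<Sum>M\<in>std_monomials p j m. fscale (v (std_rep p j m M))
        (\<Sum>K\<in>monomials p n (Suc j). fscale (comp_coeff m N M K) (coef T (Suc j) n K x)))"
      by (simp only: linear_between_scale[OF spf_linear_between[OF T] cT[OF x]] spf_comp[OF T x])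
    also have "\<dots> = (\<Sum>M\<in>std_monomials p j m. \<Sum>K\<in>monomials p n (Suc j).
        fscale (comp_coeff m N M K * v (std_rep p j m M)) (coef T (Suc j) n K x))"
      by (simp add: fvs.scale_sum_right mult.commute)
    also have "\<dots> = (\<Sum>K\<in>monomials p n (Suc j).
        fscale (\<Sum>M\<in>std_monomials p j m. comp_coeff m N M K * v (std_rep p j m M)) (coef T (Suc j) n K x))"
      unfolding fvs.scale_sum_left by (rule sum.swap)
    also have "\<dots> = (\<Sum>K\<in>monomials p n (Suc j).
        if K \<in> std_monomials p j n then fscale (coef (tensor_pow p) m n N v (std_rep p j n K)) (coef T (Suc j) n K x) else 0)"
    proof (rule sum.cong[OF refl])
      fix K assume K: "K \<in> monomials p n (Suc j)"
      show "fscale (\<Sum>M\<in>std_monomials p j m. comp_coeff m N M K * v (std_rep p j m M)) (coef T (Suc j) n K x) =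
        (if K \<in> std_monomials p j n then fscale (coef (tensor_pow p) m n N v (std_rep p j n K)) (coef T (Suc j) n K x) else 0)"
        unfolding yoneda_coeff[OF v j K] by simp
    qed
    also have "\<dots> = (\<Sum>K\<in>std_monomials p j n. fscale (coef (tensor_pow p) m n N v (std_rep p j n K)) (coef T (Suc j) n K x))"
      using std_monomials_subset[OF j] by (simp add: sum.inter_restrict[symmetric] Int_absorb1)
    also have "\<dots> = yoneda_map p j T x n (coef (koszul_term p j) m n N v)"
      using linear_between_in[OF spf_linear_between[OF spf_koszul_term[OF j]] v, of n N] by (simp add: yoneda_map_def koszul_term_simps(2))
    finally show ?thesis by simp
  qed
  show ?thesis
    unfolding spf_hom_def using lin nat by (simp add: yoneda_map_def)
qed

lemma yoneda_map_natural:
  assumes S: "spf p S" and x: "x \<in> ob S (Suc j)" and f: "f \<in> spf_hom S T"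
  shows "f n (yoneda_map p j S x n v) = yoneda_map p j T (f (Suc j) x) n v"
proof (cases "v \<in> ob (koszul_term p j) n")
  case True
  have cS: "coef S m n M y \<in> ob S n" if "y \<in> ob S m" for m n M y
    using linear_between_in[OF spf_linear_between[OF S]] that .
  have "f n (yoneda_map p j S x n v) = (\<Sum>M\<in>std_monomials p j n. f n (fscale (v (std_rep p j n M)) (coef S (Suc j) n M x)))"
    using True unfolding yoneda_map_def if_P[OF True]
    by (intro linear_between_sum[OF hom_linear_between[OF f] spf_subspace[OF S]] fvs.subspace_scale[OF spf_subspace[OF S]] cS x)
  also have "\<dots> = (\<Sum>M\<in>std_monomials p j n. fscale (v (std_rep p j n M)) (coef T (Suc j) n M (f (Suc j) x)))"
    by (simp only: linear_between_scale[OF hom_linear_between[OF f] cS[OF x]] hom_coef[OF f x])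
  finally show ?thesis using True by (simp add: yoneda_map_def)
qed (simp add: yoneda_map_def hom_zero[OF f])

section \<open>Antisymmetrization and the generator\<close>

lemma permutes_le: "\<sigma> permutes {..<j} \<Longrightarrow> j \<le> p \<Longrightarrow> \<sigma> permutes {..<p::nat}"
  by (rule permutes_subset) auto

definition antisymmetrize :: "nat \<Rightarrow> (nat list \<Rightarrow> 'k::field) \<Rightarrow> nat list \<Rightarrow> 'k" where
  "antisymmetrize j g w = (\<Sum>\<sigma> | \<sigma> permutes {..<j}. of_int (sign \<sigma>) * g (permute_list \<sigma> w))"

text \<open>Composition with the adjacent transposition pairs off permutations of opposite sign;
  this yields the sign rule and, for equal letters, cancellation in every characteristic.\<close>

lemma alternating_antisymmetrize:
  assumes j: "j \<le> p"
  shows "alternating p j (antisymmetrize j g)"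
  unfolding alternating_iff[OF j]
proof (intro allI impI conjI)
  fix k and w :: "nat list" assume "length w = p \<and> Suc k < j"
  then have w: "length w = p" and k: "Suc k < j" by auto
  let ?\<tau> = "transpose k (Suc k)" and ?h = "\<lambda>\<sigma>. of_int (sign \<sigma>) * g (permute_list \<sigma> w)"
  have \<tau>: "?\<tau> permutes {..<j}" using k by (intro transpose_permutes) auto
  have sg: "sign (?\<tau> \<circ> \<sigma>) = - sign \<sigma>" if "\<sigma> permutes {..<j}" for \<sigma>
    using permutes_imp_permutation[OF finite_lessThan that] permutation_swap_id[of k "Suc k"]
    by (simp add: sign_compose sign_swap_id)
  have comp: "permute_list \<sigma> (swap_adj k w) = permute_list (?\<tau> \<circ> \<sigma>) w" if "\<sigma> permutes {..<j}" for \<sigma>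
    by (rule permute_list_compose[symmetric]) (use permutes_le[OF that j] w in simp)
  have "antisymmetrize j g (swap_adj k w) = (\<Sum>\<sigma> | \<sigma> permutes {..<j}. - ?h (?\<tau> \<circ> \<sigma>))"
    unfolding antisymmetrize_def
  proof (rule sum.cong[OF refl])
    fix \<sigma> assume "\<sigma> \<in> {\<sigma>. \<sigma> permutes {..<j}}"
    then have \<sigma>: "\<sigma> permutes {..<j}" by simp
    show "of_int (sign \<sigma>) * g (permute_list \<sigma> (swap_adj k w)) = - ?h (?\<tau> \<circ> \<sigma>)"
      unfolding comp[OF \<sigma>] sg[OF \<sigma>] by simp
  qed
  also have "\<dots> = - (\<Sum>\<sigma> | \<sigma> permutes {..<j}. ?h (?\<tau> \<circ> \<sigma>))" by (rule sum_negf)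
  also have "(\<Sum>\<sigma> | \<sigma> permutes {..<j}. ?h (?\<tau> \<circ> \<sigma>)) = (\<Sum>\<sigma> | \<sigma> permutes {..<j}. ?h \<sigma>)"
    by (rule sum.reindex_bij_witness[of _ "\<lambda>\<sigma>. ?\<tau> \<circ> \<sigma>" "\<lambda>\<sigma>. ?\<tau> \<circ> \<sigma>"])
      (use permutes_compose[OF _ \<tau>] in \<open>simp_all add: fun_eq_iff\<close>)
  finally show "antisymmetrize j g (swap_adj k w) = - antisymmetrize j g w"
    unfolding antisymmetrize_def .
  assume "w ! k = w ! Suc k"
  then have fixed: "swap_adj k w = w" using swap_adj_same[of k w] w k j by simp
  show "antisymmetrize j g w = 0"
    unfolding antisymmetrize_def
  proof (rule sum_involution[where \<tau> = "\<lambda>\<sigma>. ?\<tau> \<circ> \<sigma>"])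
    show "finite {\<sigma>. \<sigma> permutes {..<j}}" by (rule finite_permutations) simp
    fix \<sigma> assume "\<sigma> \<in> {\<sigma>. \<sigma> permutes {..<j}}"
    then have \<sigma>: "\<sigma> permutes {..<j}" by simp
    show "?\<tau> \<circ> \<sigma> \<in> {\<sigma>. \<sigma> permutes {..<j}}" using permutes_compose[OF \<sigma> \<tau>] by simp
    show "?\<tau> \<circ> (?\<tau> \<circ> \<sigma>) = \<sigma>" by (simp add: fun_eq_iff)
    show "?h (?\<tau> \<circ> \<sigma>) = - ?h \<sigma>" unfolding sg[OF \<sigma>] comp[OF \<sigma>, symmetric] fixed by simp
    assume "?\<tau> \<circ> \<sigma> = \<sigma>"
    then have "sign \<sigma> = - sign \<sigma>" using sg[OF \<sigma>] by simp
    then show "?h \<sigma> = 0" by (cases \<sigma> rule: sign_cases) auto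
  qed
qed

lemma symmetric_antisymmetrize:
  assumes g: "symmetric p j g"
  shows "symmetric p j (antisymmetrize j g)"
  unfolding symmetric_iff
proof (intro allI impI)
  fix k and w :: "nat list" assume "length w = p \<and> j \<le> k \<and> Suc k < p"
  then have w: "length w = p" and k: "j \<le> k" "Suc k < p" by auto
  have "g (permute_list \<sigma> (swap_adj k w)) = g (permute_list \<sigma> w)" if \<sigma>: "\<sigma> permutes {..<j}" for \<sigma>
  proof -
    have "transpose k (Suc k) \<circ> \<sigma> = \<sigma> \<circ> transpose k (Suc k)"
    proof
      fix i
      have "\<sigma> k = k" "\<sigma> (Suc k) = Suc k" using permutes_not_in[OF \<sigma>] k by auto
      moreover have "\<sigma> i = i" if "\<not> i < j" using permutes_not_in[OF \<sigma>] that by auto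
      moreover have "\<sigma> i < j" if "i < j" using permutes_in_image[OF \<sigma>, of i] that by simp
      ultimately show "(transpose k (Suc k) \<circ> \<sigma>) i = (\<sigma> \<circ> transpose k (Suc k)) i"
        using k by (cases "i < j") (auto simp: transpose_def)
    qed
    moreover have "permute_list (transpose k (Suc k) \<circ> \<sigma>) w = permute_list \<sigma> (swap_adj k w)"
      by (rule permute_list_compose) (use permutes_le[OF \<sigma>, of p] w k in simp)
    moreover have "permute_list (\<sigma> \<circ> transpose k (Suc k)) w = swap_adj k (permute_list \<sigma> w)"
      by (rule permute_list_compose) (use w k in \<open>auto intro: transpose_permutes\<close>)
    ultimately show ?thesis using symmetric_swapD[OF g, of "permute_list \<sigma> w" k] w k by simp
  qed
  then show "antisymmetrize j g (swap_adj k w) = antisymmetrize j g w"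
    unfolding antisymmetrize_def by (intro sum.cong) auto
qed

definition generator :: "nat \<Rightarrow> nat \<Rightarrow> nat list \<Rightarrow> 'k::field" where
  "generator p j = antisymmetrize j (\<lambda>w. if w = std_word p j then 1 else 0)"

lemma generator_in:
  assumes j: "j \<le> p"
  shows "(generator p j :: nat list \<Rightarrow> 'k::field) \<in> ob (koszul_term p j) (Suc j)"
  unfolding koszul_term_simps generator_def
proof (intro conjI alternating_antisymmetrize symmetric_antisymmetrize j)
  let ?d = "\<lambda>w. if w = std_word p j then 1 else 0 :: 'k"
  show "antisymmetrize j ?d \<in> ob (tensor_pow p) (Suc j)"
    unfolding tensor_pow_ob antisymmetrize_def
  proof (intro allI impI sum.neutral ballI)
    fix w \<sigma> assume w: "w \<notin> words p (Suc j)" "\<sigma> \<in> {\<sigma>. \<sigma> permutes {..<j}}"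
    then have "permute_list \<sigma> w \<noteq> std_word p j"
      using permute_words[OF permutes_le[OF _ j], of \<sigma> w "Suc j"] std_word_in[OF j] by auto
    then show "of_int (sign \<sigma>) * ?d (permute_list \<sigma> w) = 0" by simp
  qed
  show "symmetric p j ?d"
    unfolding symmetric_iff
  proof (intro allI impI)
    fix k and w :: "nat list" assume kw: "length w = p \<and> j \<le> k \<and> Suc k < p"
    then have \<tau>: "transpose k (Suc k) permutes {..<length w}" by (intro transpose_permutes) auto
    have "swap_adj k (std_word p j) = std_word p j"
      by (rule swap_adj_same) (use kw j in \<open>auto simp: std_word_nth\<close>)
    moreover have "swap_adj k (swap_adj k w) = w"
      using permute_list_compose[OF \<tau>, of "transpose k (Suc k)"] by simp
    ultimately have "swap_adj k w = std_word p j \<longleftrightarrow> w = std_word p j" by metis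
    then show "?d (swap_adj k w) = ?d w" by simp
  qed
qed

text \<open>Each permutation \<open>\<sigma>\<close> contributes \<open>v w\<close>: it rearranges
  the first \<open>j\<close> letters of \<open>w\<close>, and its sign cancels the one produced by
  \<open>v\<close>. So the generator generates as soon as \<open>fact j\<close> is invertible, which
  is how the splitting off from the tensor power enters.\<close>

lemma yoneda_map_generator:
  assumes j: "j \<le> p" and v: "v \<in> ob (koszul_term p j) n"
  shows "yoneda_map p j (koszul_term p j) (generator p j) n v = fscale (of_nat (fact j)) v"
proof
  fix w
  let ?Q = "koszul_term p j :: ('a, nat list) spfun"
  let ?g = "generator p j :: nat list \<Rightarrow> 'a"
  show "yoneda_map p j ?Q ?g n v w = fscale (of_nat (fact j)) v w"
  proof (cases "w \<in> words p n")
    case True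
    have alt: "alternating p j v" using v by (simp add: koszul_term_simps)
    have lw: "length w = p" using True by (simp add: words_def)
    have "yoneda_map p j ?Q ?g n v w =
      (\<Sum>M\<in>std_monomials p j n. \<Sum>y\<in>words p (Suc j). if mset (zip w y) = M then v (std_rep p j n M) * ?g y else 0)"
      using v True by (simp add: yoneda_map_def sum_fun_apply koszul_term_simps(2) tensor_pow_coef_sum
          sum_distrib_left if_distrib cong: if_cong)
    also have "\<dots> = (\<Sum>y\<in>words p (Suc j). \<Sum>M\<in>std_monomials p j n. if mset (zip w y) = M then v (std_rep p j n M) * ?g y else 0)"
      by (rule sum.swap)
    also have "\<dots> = (\<Sum>y\<in>words p (Suc j). (if mset (zip w y) \<in> std_monomials p j n then v (std_rep p j n (mset (zip w y))) else 0) * ?g y)"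
      by (intro sum.cong) auto
    also have "\<dots> = (\<Sum>y\<in>words p (Suc j). \<Sum>\<sigma> | \<sigma> permutes {..<j}. if permute_list \<sigma> y = std_word p j then
        of_int (sign \<sigma>) * (if mset (zip w y) \<in> std_monomials p j n then v (std_rep p j n (mset (zip w y))) else 0) else 0)"
      unfolding generator_def antisymmetrize_def sum_distrib_left by (intro sum.cong) auto
    also have "\<dots> = (\<Sum>\<sigma> | \<sigma> permutes {..<j}. \<Sum>y\<in>words p (Suc j). if permute_list \<sigma> y = std_word p j then
        of_int (sign \<sigma>) * (if mset (zip w y) \<in> std_monomials p j n then v (std_rep p j n (mset (zip w y))) else 0) else 0)"
      by (rule sum.swap)
    also have "\<dots> = (\<Sum>\<sigma> | \<sigma> permutes {..<j}. v w)"
    proof (rule sum.cong[OF refl])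
      fix \<sigma> assume "\<sigma> \<in> {\<sigma>. \<sigma> permutes {..<j}}"
      then have \<sigma>: "\<sigma> permutes {..<j}" by simp
      note \<sigma>p = permutes_le[OF \<sigma> j]
      let ?y = "permute_list (inv_into UNIV \<sigma>) (std_word p j)"
      have y: "?y \<in> words p (Suc j)"
        using permute_words[OF permutes_inv[OF \<sigma>p]] std_word_in[OF j] by simp
      have iff: "permute_list \<sigma> x = std_word p j \<longleftrightarrow> x = ?y" if "x \<in> words p (Suc j)" for x
      proof -
        have "\<sigma> permutes {..<length x}" "\<sigma> permutes {..<length (std_word p j)}"
          using \<sigma>p that j by (simp_all add: words_def)
        then show ?thesis using permute_list_inverse by metis
      qed
      have iw: "permute_list \<sigma> w \<in> words p n" using permute_words[OF \<sigma>p] True by simp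
      have ly: "length ?y = p" using j by simp
      have "permute_list \<sigma> (zip w ?y) = zip (permute_list \<sigma> w) (std_word p j)"
        using permute_list_zip[OF \<sigma>p, of w ?y] lw ly iff[OF y] by simp
      then have m: "mset (zip w ?y) = mset (zip (permute_list \<sigma> w) (std_word p j))"
        using mset_permute_list[of \<sigma> "zip w ?y"] \<sigma>p lw ly by simp
      have "mset (zip w ?y) \<in> std_monomials p j n" unfolding m using iw by (simp add: std_monomials_def)
      moreover have "v (std_rep p j n (mset (zip w ?y))) = v (permute_list \<sigma> w)"
        unfolding m by (rule eval_std_rep[OF v j iw])
      moreover have "v (permute_list \<sigma> w) = of_int (sign \<sigma>) * v w"
        by (rule alternating_permute[OF alt j \<sigma> lw])
      moreover have "of_int (sign \<sigma>) * (of_int (sign \<sigma>) * v w) = v w"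
        by (cases \<sigma> rule: sign_cases) simp_all
      moreover have "(\<Sum>y\<in>words p (Suc j). if permute_list \<sigma> y = std_word p j then
          of_int (sign \<sigma>) * (if mset (zip w y) \<in> std_monomials p j n then v (std_rep p j n (mset (zip w y))) else 0) else 0)
        = (\<Sum>y\<in>words p (Suc j). if y = ?y then
          of_int (sign \<sigma>) * (if mset (zip w y) \<in> std_monomials p j n then v (std_rep p j n (mset (zip w y))) else 0) else 0)"
        using iff by (intro sum.cong) simp_all
      ultimately show "(\<Sum>y\<in>words p (Suc j). if permute_list \<sigma> y = std_word p j then
          of_int (sign \<sigma>) * (if mset (zip w y) \<in> std_monomials p j n then v (std_rep p j n (mset (zip w y))) else 0) else 0) = v w"
        using y by simp
    qed
    also have "\<dots> = fscale (of_nat (fact j)) v w"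
      using card_permutations[of "{..<j}" j] by simp
    finally show ?thesis .
  next
    case False
    then show ?thesis
      using v by (simp add: yoneda_map_def sum_fun_apply koszul_term_simps tensor_pow_coef_sum tensor_pow_ob)
  qed
qed

lemma koszul_term_hom_apply:
  assumes j: "j \<le> p" and f: "f \<in> spf_hom (koszul_term p j) T" and v: "v \<in> ob (koszul_term p j) n"
  shows "fscale (of_nat (fact j)) (f n v) = yoneda_map p j T (f (Suc j) (generator p j)) n v"
  using yoneda_map_natural[OF spf_koszul_term[OF j] generator_in[OF j] f, of n v]
  by (simp only: yoneda_map_generator[OF j v] linear_between_scale[OF hom_linear_between[OF f] v])

lemma koszul_term_hom_eqI:
  assumes j: "j \<le> p" "of_nat (fact j) \<noteq> (0 :: 'k::field)"
    and f: "f \<in> spf_hom (koszul_term p j) T" and g: "g \<in> spf_hom (koszul_term p j) (T :: ('k, 'b) spfun)"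
    and eq: "f (Suc j) (generator p j) = g (Suc j) (generator p j)"
  shows "f = g"
proof (rule hom_eqI[OF f g])
  fix n v assume v: "v \<in> ob (koszul_term p j :: ('k, nat list) spfun) n"
  have "fscale (of_nat (fact j)) (f n v) = fscale (of_nat (fact j)) (g n v)"
    unfolding koszul_term_hom_apply[OF j(1) f v] koszul_term_hom_apply[OF j(1) g v] eq ..
  then show "f n v = g n v" using j(2) by simp
qed

text \<open>Lift the value of \<open>f\<close> at the generator to some \<open>x\<close>; the Yoneda
  map of \<open>x\<close> lifts \<open>fact j\<close> times \<open>f\<close>, and the scalar is
  divided out.\<close>

lemma koszul_term_lift:
  fixes S :: "('k::field, 'b) spfun" and T :: "('k, 'c) spfun"
  assumes j: "j \<le> p" "of_nat (fact j) \<noteq> (0 :: 'k)" and S: "spf p S" and T: "spf p T"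
    and g: "g \<in> spf_hom S T" "\<And>n. g n ` ob S n = ob T n" and f: "f \<in> spf_hom (koszul_term p j) T"
  shows "\<exists>h\<in>spf_hom (koszul_term p j) S. \<forall>n. \<forall>v\<in>ob (koszul_term p j) n. g n (h n v) = f n v"
proof -
  have "f (Suc j) (generator p j) \<in> ob T (Suc j)" using hom_in[OF f generator_in[OF j(1)]] .
  then obtain x where x: "x \<in> ob S (Suc j)" "g (Suc j) x = f (Suc j) (generator p j)"
    using g(2)[of "Suc j"] by (metis imageE)
  let ?c = "1 / of_nat (fact j) :: 'k"
  let ?y = "yoneda_map p j S x"
  have y: "?y \<in> spf_hom (koszul_term p j) S" by (rule yoneda_map_hom[OF S x(1) j(1)])
  have "g n (hom_scale ?c ?y n v) = f n v" if v: "v \<in> ob (koszul_term p j) n" for n v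
  proof -
    have "g n (hom_scale ?c ?y n v) = fscale ?c (g n (?y n v))"
      unfolding hom_scale_def by (rule linear_between_scale[OF hom_linear_between[OF g(1)] hom_in[OF y v]])
    also have "g n (?y n v) = fscale (of_nat (fact j)) (f n v)"
      unfolding yoneda_map_natural[OF S x(1) g(1)] x(2) koszul_term_hom_apply[OF j(1) f v] ..
    finally show ?thesis using j(2) by simp
  qed
  then show ?thesis using hom_combine(3)[OF S y y, of ?c] by blast
qed

section \<open>Schur, Weyl and simple functors of hooks\<close>

lemma antisym_coeff_permute:
  assumes l: "length K = r" "length J = r" and \<sigma>: "\<sigma> permutes {..<r}"
  shows "antisym_coeff (permute_list \<sigma> K) J = (of_int (sign \<sigma>) * antisym_coeff K J :: 'k::field)"
proof -
  let ?A = "mat r r (\<lambda>(i, j). if K ! i = J ! j then 1 else 0) :: 'k mat"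
  have \<sigma>i: "\<sigma> i < r" if "i < r" for i using permutes_in_image[OF \<sigma>, of i] that by simp
  have "mat r r (\<lambda>(i, j). if permute_list \<sigma> K ! i = J ! j then 1 else 0) = mat r r (\<lambda>(i, j). ?A $$ (\<sigma> i, j))"
    by (rule eq_matI) (use \<sigma>i l \<sigma> in \<open>auto simp: permute_list_nth\<close>)
  moreover have "det (mat r r (\<lambda>(i, j). ?A $$ (\<sigma> i, j))) = of_int (sign \<sigma>) * det ?A"
    by (rule det_permute_rows) (use \<sigma> in \<open>auto simp: atLeast0LessThan\<close>)
  ultimately show ?thesis by (simp add: antisym_coeff_def l)
qed

lemma antisym_coeff_equal_entries:
  assumes l: "length K = r" "length J = r" and ij: "i < r" "j < r" "i \<noteq> j" "K ! i = K ! j"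
  shows "antisym_coeff K J = (0 :: 'k::field)"
  unfolding antisym_coeff_def l
  by (rule det_identical_rows[OF _ ij(3,1,2)]) (use ij in \<open>auto intro!: eq_vecI\<close>)

lemma antisym_coeff_missing:
  assumes l: "length K = r" "length J = r" and i: "i < r" "K ! i \<notin> set J"
  shows "antisym_coeff K J = (0 :: 'k::field)"
proof -
  let ?A = "mat r r (\<lambda>(i, j). if K ! i = J ! j then 1 else 0) :: 'k mat"
  have "(\<Prod>l = 0..<r. ?A $$ (l, \<sigma> l)) = 0" if \<sigma>: "\<sigma> permutes {0..<r}" for \<sigma>
  proof (rule prod_zero)
    have "\<sigma> i < r" using permutes_in_image[OF \<sigma>, of i] i by simp
    then have "?A $$ (i, \<sigma> i) = 0" using i l by (auto simp: in_set_conv_nth)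
    then show "\<exists>l\<in>{0..<r}. ?A $$ (l, \<sigma> l) = 0" using i by auto
  qed simp
  then have "det ?A = 0" by (subst det_def'[of _ r]) (auto intro!: sum.neutral)
  then show ?thesis by (simp add: antisym_coeff_def l)
qed

lemma antisym_coeff_refl:
  assumes "distinct J"
  shows "antisym_coeff J J = (1 :: 'k::field)"
proof -
  have "mat (length J) (length J) (\<lambda>(i, j). if J ! i = J ! j then 1 else 0) = (1\<^sub>m (length J) :: 'k mat)"
    by (rule eq_matI) (use assms in \<open>auto simp: nth_eq_iff_index_eq\<close>)
  then show ?thesis by (simp add: antisym_coeff_def)
qed

lemma antisym_coeff_leibniz:
  assumes l: "length L = m" "length I = m"
  shows "antisym_coeff L I =
    (\<Sum>\<sigma> | \<sigma> permutes {..<m}. of_int (sign \<sigma>) * (if L = permute_list \<sigma> I then 1 else 0) :: 'k::field)"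
proof -
  have "(\<Prod>i = 0..<m. mat m m (\<lambda>(i, j). if L ! i = I ! j then 1 else 0) $$ (i, \<sigma> i)) =
    (if L = permute_list \<sigma> I then 1 else 0 :: 'k)" if \<sigma>: "\<sigma> permutes {..<m}" for \<sigma>
  proof -
    have \<sigma>i: "\<sigma> i < m" if "i < m" for i using permutes_in_image[OF \<sigma>, of i] that by simp
    have eq: "L = permute_list \<sigma> I \<longleftrightarrow> (\<forall>i<m. L ! i = I ! \<sigma> i)"
      using l \<sigma> by (auto simp: list_eq_iff_nth_eq permute_list_nth)
    have "(\<Prod>i = 0..<m. mat m m (\<lambda>(i, j). if L ! i = I ! j then 1 else 0) $$ (i, \<sigma> i)) =
      (\<Prod>i = 0..<m. if L ! i = I ! \<sigma> i then 1 else 0 :: 'k)"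
      using \<sigma>i by (intro prod.cong) auto
    also have "\<dots> = (if \<forall>i<m. L ! i = I ! \<sigma> i then 1 else 0)"
      by (auto intro!: prod.neutral prod_zero)
    finally show ?thesis using eq by simp
  qed
  then show ?thesis
    unfolding antisym_coeff_def l by (subst det_def'[of _ m]) (auto simp: atLeast0LessThan)
qed

text \<open>Expansion along the first row, that of the corner box of the hook; its alternating sum
  over \<open>t\<close> becomes the one in \<open>kdiff\<close>.\<close>

lemma antisym_coeff_laplace:
  assumes l: "length L = m" "length J = Suc m"
  shows "antisym_coeff (i # L) J =
    (\<Sum>t\<le>m. (-1) ^ t * (if i = J ! t then antisym_coeff L (take t J @ drop (Suc t) J) else 0) :: 'k::field)"
proof -
  let ?A = "mat (Suc m) (Suc m) (\<lambda>(a, b). if (i # L) ! a = J ! b then 1 else 0) :: 'k mat"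
  have del: "mat_delete ?A 0 t = mat m m (\<lambda>(a, b). if L ! a = (take t J @ drop (Suc t) J) ! b then 1 else 0)"
    if "t \<le> m" for t
    by (rule eq_matI) (use l that in \<open>auto simp: mat_delete_def nth_append min_def\<close>)
  have "det ?A = (\<Sum>t<Suc m. ?A $$ (0, t) * cofactor ?A 0 t)"
    by (rule laplace_expansion_row) auto
  also have "\<dots> = (\<Sum>t\<le>m. (-1) ^ t * (if i = J ! t then antisym_coeff L (take t J @ drop (Suc t) J) else 0))"
    unfolding lessThan_Suc_atMost
    by (intro sum.cong) (use l del in \<open>auto simp: cofactor_def antisym_coeff_def min_def\<close>)
  finally show ?thesis by (simp add: antisym_coeff_def l)
qed

lemma antisym_coeff_single: "antisym_coeff [x] [y] = (if x = y then 1 else 0 :: 'k::field)"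
  using antisym_coeff_laplace[of "[]" 0 "[y]" x, where 'k = 'k] antisym_coeff_refl[of "[]", where 'k = 'k] by simp

lemma antisym_coeff_alternating: "length J = r \<Longrightarrow> alternating r r (\<lambda>K. antisym_coeff K J :: 'k::field)"
  unfolding alternating_iff[OF order_refl]
proof (intro allI impI conjI)
  fix k and w :: "nat list" assume J: "length J = r" and kw: "length w = r \<and> Suc k < r"
  then have "transpose k (Suc k) permutes {..<r}" by (intro transpose_permutes) auto
  then show "antisym_coeff (swap_adj k w) J = - (antisym_coeff w J :: 'k)"
    using antisym_coeff_permute[of w r J, where 'k = 'k] kw J by (simp add: sign_swap_id)
  assume "w ! k = w ! Suc k"
  then show "antisym_coeff w J = (0 :: 'k)"
    by (intro antisym_coeff_equal_entries[of w r J k "Suc k"]) (use kw J in auto)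
qed

lemma alternating_take:
  assumes a: "alternating r r g" and r: "r \<le> p"
  shows "alternating p r (\<lambda>w. g (take r w) * c (drop r w))"
  unfolding alternating_def
proof (intro allI impI)
  fix P R :: "nat list" and x y
  assume l: "length P + length R + 2 = p \<and> length P + 2 \<le> r"
  define k where "k = r - length P - 2"
  have tk: "take r (P @ u # v # R) = P @ u # v # take k R" "drop r (P @ u # v # R) = drop k R" for u v
    using l by (auto simp: k_def Suc_diff_Suc numeral_2_eq_2 take_Cons' drop_Cons')
  have "length P + length (take k R) + 2 = r" "length P + 2 \<le> r" using l r by (auto simp: k_def)
  note D = alternatingD[OF a this]
  show "g (take r (P @ y # x # R)) * c (drop r (P @ y # x # R)) =
        - (g (take r (P @ x # y # R)) * c (drop r (P @ x # y # R))) \<and>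
        g (take r (P @ x # x # R)) * c (drop r (P @ x # x # R)) = 0"
    unfolding tk using D(1)[of y x] D(2)[of x] by simp
qed

lemma permute_list_append:
  assumes "\<sigma> permutes {..<length x}"
  shows "permute_list \<sigma> (x @ y) = permute_list \<sigma> x @ y"
proof (rule nth_equalityI)
  fix i assume "i < length (permute_list \<sigma> (x @ y))"
  then have i: "i < length (x @ y)" by simp
  have \<sigma>: "\<sigma> permutes {..<length (x @ y)}" by (rule permutes_le[OF assms]) simp
  have "\<sigma> i < length x" if "i < length x" using permutes_in_image[OF assms, of i] that by simp
  moreover have "\<sigma> i = i" if "\<not> i < length x" using permutes_not_in[OF assms, of i] that by simp
  ultimately show "permute_list \<sigma> (x @ y) ! i = (permute_list \<sigma> x @ y) ! i"
    using i by (cases "i < length x") (simp_all add: permute_list_nth[OF \<sigma> i] permute_list_nth[OF assms] nth_append)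
qed simp

lemma sum_words_append: "(\<Sum>w\<in>words (a + b) n. f w) = (\<Sum>L\<in>words a n. \<Sum>c\<in>words b n. f (L @ c))"
proof -
  have "(\<Sum>L\<in>words a n. \<Sum>c\<in>words b n. f (L @ c)) = (\<Sum>(L, c)\<in>words a n \<times> words b n. f (L @ c))"
    by (rule sum.cartesian_product)
  also have "\<dots> = (\<Sum>w\<in>words (a + b) n. f w)"
    by (rule sum.reindex_bij_witness[of _ "\<lambda>w. (take a w, drop a w)" "\<lambda>(L, c). L @ c"])
      (auto simp: words_def dest: in_set_takeD in_set_dropD)
  finally show ?thesis by simp
qed

text \<open>By the Leibniz formula \<open>L\<close> runs over the rearrangements of
  \<open>I\<close>, with a sign that cancels the one of \<open>v\<close>; all permutations
  contribute alike. The factor \<open>fact m\<close> in all later formulas originates here.\<close>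

lemma sum_antisym_alternating:
  fixes v :: "nat list \<Rightarrow> 'k::field"
  assumes a: "alternating p m v" and I: "I \<in> words m n" and r: "m + length r = p"
  shows "(\<Sum>L\<in>words m n. antisym_coeff L I * v (L @ r)) = of_nat (fact m) * v (I @ r)"
proof -
  have lI: "length I = m" using I by (simp add: words_def)
  have "(\<Sum>L\<in>words m n. antisym_coeff L I * v (L @ r)) = (\<Sum>L\<in>words m n. \<Sum>\<sigma> | \<sigma> permutes {..<m}.
      if L = permute_list \<sigma> I then of_int (sign \<sigma>) * v (L @ r) else 0)"
    using antisym_coeff_leibniz[OF _ lI, where 'k = 'k] by (auto simp: words_def sum_distrib_right intro!: sum.cong)
  also have "\<dots> = (\<Sum>\<sigma> | \<sigma> permutes {..<m}. \<Sum>L\<in>words m n.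
      if L = permute_list \<sigma> I then of_int (sign \<sigma>) * v (L @ r) else 0)"
    by (rule sum.swap)
  also have "\<dots> = (\<Sum>\<sigma> | \<sigma> permutes {..<m}. v (I @ r))"
  proof (rule sum.cong[OF refl])
    fix \<sigma> assume "\<sigma> \<in> {\<sigma>. \<sigma> permutes {..<m}}"
    then have \<sigma>: "\<sigma> permutes {..<m}" by simp
    have "v (permute_list \<sigma> I @ r) = of_int (sign \<sigma>) * v (I @ r)"
      using alternating_permute[OF a _ \<sigma>, of "I @ r"] permute_list_append[of \<sigma> I r] \<sigma> lI r by simp
    moreover have "permute_list \<sigma> I \<in> words m n" using I permute_words[OF \<sigma>] by simp
    moreover have "of_int (sign \<sigma>) * (of_int (sign \<sigma>) * v (I @ r)) = v (I @ r)"
      by (cases \<sigma> rule: sign_cases) simp_all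
    ultimately show "(\<Sum>L\<in>words m n. if L = permute_list \<sigma> I then of_int (sign \<sigma>) * v (L @ r) else 0) = v (I @ r)"
      by simp
  qed
  also have "\<dots> = of_nat (fact m) * v (I @ r)" using card_permutations[of "{..<m}" m] by simp
  finally show ?thesis .
qed

text \<open>For \<open>K = i # L\<close> the Laplace expansion matches \<open>i\<close> with
  \<open>J ! t\<close>, and \<open>sum_antisym_alternating\<close> sums \<open>L\<close> against
  \<open>J\<close> without that letter.\<close>

lemma sum_antisym_laplace:
  fixes v :: "nat list \<Rightarrow> 'k::field"
  assumes a: "alternating p m v" and J: "J \<in> words (Suc m) n" and b: "Suc m + length b = p"
  shows "(\<Sum>K\<in>words (Suc m) n. antisym_coeff K J * v (tl K @ hd K # b)) = of_nat (fact m) * kdiff p m v (J @ b)"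
proof -
  have lJ: "length J = Suc m" using J by (simp add: words_def)
  let ?del = "\<lambda>t. take t J @ drop (Suc t) J"
  have "(\<Sum>K\<in>words (Suc m) n. antisym_coeff K J * v (tl K @ hd K # b)) =
    (\<Sum>i<n. \<Sum>L\<in>words m n. \<Sum>t\<le>m. if i = J ! t then (-1) ^ t * (antisym_coeff L (?del t) * v (L @ i # b)) else 0)"
    unfolding sum_words_Suc
    using antisym_coeff_laplace[OF _ lJ, where 'k = 'k] by (auto simp: words_def sum_distrib_right intro!: sum.cong)
  also have "\<dots> = (\<Sum>i<n. \<Sum>t\<le>m. \<Sum>L\<in>words m n. if i = J ! t then (-1) ^ t * (antisym_coeff L (?del t) * v (L @ i # b)) else 0)"
    by (intro sum.cong refl sum.swap)
  also have "\<dots> = (\<Sum>t\<le>m. \<Sum>i<n. \<Sum>L\<in>words m n. if i = J ! t then (-1) ^ t * (antisym_coeff L (?del t) * v (L @ i # b)) else 0)"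
    by (rule sum.swap)
  also have "\<dots> = (\<Sum>t\<le>m. (-1) ^ t * (of_nat (fact m) * v (?del t @ J ! t # b)))"
  proof (rule sum.cong[OF refl])
    fix t assume "t \<in> {..m}"
    then have t: "t \<le> m" by simp
    have "J ! t \<in> set J" using t lJ by (intro nth_mem) simp
    then have Jt: "J ! t < n" using J by (auto simp: words_def)
    have dw: "?del t \<in> words m n" using J t by (auto simp: words_def dest: in_set_takeD in_set_dropD)
    have "(\<Sum>i<n. \<Sum>L\<in>words m n. if i = J ! t then (-1) ^ t * (antisym_coeff L (?del t) * v (L @ i # b)) else 0) =
      (\<Sum>i<n. if i = J ! t then (-1) ^ t * (\<Sum>L\<in>words m n. antisym_coeff L (?del t) * v (L @ i # b)) else 0)"
      by (intro sum.cong) (auto simp: sum_distrib_left)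
    also have "\<dots> = (-1) ^ t * (\<Sum>L\<in>words m n. antisym_coeff L (?del t) * v (L @ J ! t # b))"
      using Jt by simp
    also have "(\<Sum>L\<in>words m n. antisym_coeff L (?del t) * v (L @ J ! t # b)) = of_nat (fact m) * v (?del t @ J ! t # b)"
      using sum_antisym_alternating[OF a dw, of "J ! t # b"] b by simp
    finally show "(\<Sum>i<n. \<Sum>L\<in>words m n. if i = J ! t then (-1) ^ t * (antisym_coeff L (?del t) * v (L @ i # b)) else 0) =
      (-1) ^ t * (of_nat (fact m) * v (?del t @ J ! t # b))" .
  qed
  also have "\<dots> = of_nat (fact m) * kdiff p m v (J @ b)"
    using kdiff_append[of J m b p v] lJ b by (simp add: sum_distrib_left ac_simps)
  finally show ?thesis .
qed

definition sorted_words :: "nat \<Rightarrow> nat \<Rightarrow> nat list set" where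
  "sorted_words r n = {J \<in> words r n. sorted_wrt (<) J}"

lemma finite_sorted_words [simp]: "finite (sorted_words r n)"
  by (simp add: sorted_words_def)

text \<open>Only the increasing rearrangement of \<open>K\<close> contributes, and its coefficient
  is the sign of the sorting permutation.\<close>

lemma sum_antisym_sorted:
  fixes z :: "nat list \<Rightarrow> 'k::field"
  assumes a: "alternating p r z" and K: "K \<in> words r n" and b: "r + length b = p"
  shows "(\<Sum>J\<in>sorted_words r n. antisym_coeff K J * z (J @ b)) = z (K @ b)"
proof (cases "distinct K")
  case False
  have lK: "length K = r" using K by (simp add: words_def)
  have "antisym_coeff K J = (0 :: 'k)" if "J \<in> sorted_words r n" for J
    using alternating_repeat[OF antisym_coeff_alternating[of J r, where 'k = 'k], of K] that False lK
    by (simp add: sorted_words_def words_def)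
  moreover have "z (K @ b) = 0" using alternating_repeat[OF a, of "K @ b"] False lK b by simp
  ultimately show ?thesis by simp
next
  case True
  have lK: "length K = r" using K by (simp add: words_def)
  let ?J = "sort K"
  obtain \<sigma> where \<sigma>: "\<sigma> permutes {..<length ?J}" "permute_list \<sigma> ?J = K"
    using mset_eq_permutation[of K ?J] by auto
  have lJ: "length ?J = r" using lK by simp
  have Jin: "?J \<in> sorted_words r n"
    using K True by (simp add: sorted_words_def words_def strict_sorted_iff)
  have other: "antisym_coeff K J = (0 :: 'k)" if J: "J \<in> sorted_words r n" "J \<noteq> ?J" for J
  proof -
    have d: "distinct J" "sorted J" "length J = r" using J by (auto simp: sorted_words_def words_def strict_sorted_iff)
    have "\<not> set K \<subseteq> set J"
    proof
      assume "set K \<subseteq> set J"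
      then have "set K = set J" using d lK True by (intro card_subset_eq) (auto simp: distinct_card)
      then have "J = ?J" using d True by (intro sorted_distinct_set_unique) auto
      then show False using J by simp
    qed
    then obtain i where "i < r" "K ! i \<notin> set J" using lK by (auto simp: in_set_conv_nth subset_iff)
    then show ?thesis using antisym_coeff_missing[OF lK d(3)] by blast
  qed
  have "(\<Sum>J\<in>sorted_words r n. antisym_coeff K J * z (J @ b)) = (\<Sum>J\<in>sorted_words r n. if J = ?J then antisym_coeff K ?J * z (?J @ b) else 0)"
    using other by (intro sum.cong) auto
  also have "\<dots> = antisym_coeff K ?J * z (?J @ b)" using Jin by simp
  also have "antisym_coeff K ?J = (of_int (sign \<sigma>) :: 'k)"
    using antisym_coeff_permute[of ?J r ?J \<sigma>, where 'k = 'k] antisym_coeff_refl[of ?J, where 'k = 'k] \<sigma> lJ True by simp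
  also have "of_int (sign \<sigma>) * z (?J @ b) = z (permute_list \<sigma> (?J @ b))"
    using alternating_permute[OF a _ , of \<sigma> "?J @ b"] \<sigma>(1) lJ b by simp
  also have "\<dots> = z (K @ b)" using permute_list_append[OF \<sigma>(1)] \<sigma>(2) by simp
  finally show ?thesis .
qed

section \<open>Hook diagrams and the Schur map on words\<close>

abbreviation singles :: "'x list \<Rightarrow> 'x list list" where
  "singles b \<equiv> map (\<lambda>x. [x]) b"

abbreviation hook_cols :: "nat \<Rightarrow> nat \<Rightarrow> nat list" where
  "hook_cols p m \<equiv> (p - m) # replicate m 1"

lemma conj_part_hook:
  assumes "m < p"
  shows "conj_part (hook p m) = hook_cols p m"
proof -
  have fm: "fold max (replicate k 1) (Suc m) = Suc m" for k m :: nat by (induction k) auto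
  have "fold max (hook p m) 0 = Suc m" using fm[of "p - m - 1" m] by (simp add: hook_def)
  then show ?thesis
    unfolding conj_part_def
    by (intro nth_equalityI) (use assms in \<open>auto simp: hook_def nth_Cons' less_Suc_eq_0_disj simp del: upt_Suc\<close>)
qed

lemma words_Suc: "words (Suc k) n = {x # w |x w. x < n \<and> w \<in> words k n}"
  by (auto simp: words_def length_Suc_conv)

lemma fillings_Cons: "fillings (a # mu) n = {r # T |r T. r \<in> words a n \<and> T \<in> fillings mu n}"
  by (auto simp: fillings_def words_def map_eq_Cons_conv subset_iff)

lemma fillings_ones: "fillings (replicate k 1) n = singles ` words k n"
proof (induction k)
  case 0
  then show ?case by (auto simp: fillings_def words_def)
next
  case (Suc k)
  show ?case
    unfolding replicate_Suc fillings_Cons Suc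
  proof (intro subset_antisym subsetI)
    fix T assume "T \<in> {r # T |r T. r \<in> words 1 n \<and> T \<in> singles ` words k n}"
    then obtain x w where x: "T = [x] # singles w" "x < n" "w \<in> words k n"
      unfolding words_Suc[of 0, unfolded One_nat_def[symmetric]] words_0 by blast
    then have "x # w \<in> words (Suc k) n" by (auto simp: words_Suc)
    then show "T \<in> singles ` words (Suc k) n" using x by (intro image_eqI[of _ _ "x # w"]) auto
  next
    fix T assume "T \<in> singles ` words (Suc k) n"
    then obtain x w where "T = [x] # singles w" "x < n" "w \<in> words k n" by (auto simp: words_Suc)
    moreover from this have "[x] \<in> words 1 n" by (simp add: words_def)
    ultimately show "T \<in> {r # T |r T. r \<in> words 1 n \<and> T \<in> singles ` words k n}" by blast
  qed
qed

lemma fillings_hook_shape: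
  "fillings (a # replicate k 1) n = {r # singles b |r b. r \<in> words a n \<and> b \<in> words k n}"
  unfolding fillings_Cons fillings_ones by blast

lemma ext_basis_hook:
  "ext_basis (hook p m) n = {J # singles b |J b. J \<in> sorted_words (Suc m) n \<and> b \<in> words (p - m - 1) n}"
  unfolding ext_basis_def hook_def fillings_hook_shape by (auto simp: sorted_words_def)

lemma sum_ext_basis_hook:
  "(\<Sum>T\<in>ext_basis (hook p m) n. f T) =
     (\<Sum>J\<in>sorted_words (Suc m) n. \<Sum>b\<in>words (p - m - 1) n. f (J # singles b))"
proof -
  have "(\<Sum>J\<in>sorted_words (Suc m) n. \<Sum>b\<in>words (p - m - 1) n. f (J # singles b)) =
    (\<Sum>(J, b)\<in>sorted_words (Suc m) n \<times> words (p - m - 1) n. f (J # singles b))"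
    by (rule sum.cartesian_product)
  also have "\<dots> = (\<Sum>T\<in>ext_basis (hook p m) n. f T)"
    by (rule sum.reindex_bij_witness[of _ "\<lambda>T. (hd T, map hd (tl T))" "\<lambda>(J, b). J # singles b"])
      (auto simp: ext_basis_hook o_def)
  finally show ?thesis by simp
qed

lemma prod_antisym_singles:
  "length b = length c \<Longrightarrow>
    prod_list (map2 antisym_coeff (singles b) (singles c)) = (if b = c then 1 else 0 :: 'k::field)"
  by (induction b c rule: list_induct2) (auto simp: antisym_coeff_single)

lemma ext_to_tensor_hook:
  assumes K: "K \<in> words (Suc m) n" and b: "b \<in> words (p - m - 1) n"
  shows "ext_to_tensor (hook p m) n y (K # singles b) =
    (\<Sum>J\<in>sorted_words (Suc m) n. antisym_coeff K J * (y (J # singles b) :: 'k::field))"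
proof -
  have "K # singles b \<in> fillings (hook p m) n"
    unfolding hook_def fillings_hook_shape using K b by auto
  then have "ext_to_tensor (hook p m) n y (K # singles b) =
    (\<Sum>J\<in>sorted_words (Suc m) n. \<Sum>c\<in>words (p - m - 1) n.
       antisym_coeff K J * prod_list (map2 antisym_coeff (singles b) (singles c)) * y (J # singles c))"
    by (simp add: ext_to_tensor_def sum_ext_basis_hook)
  also have "\<dots> = (\<Sum>J\<in>sorted_words (Suc m) n. \<Sum>c\<in>words (p - m - 1) n.
       if b = c then antisym_coeff K J * y (J # singles b) else 0)"
    using b prod_antisym_singles[of b, where 'k = 'k] by (intro sum.cong refl) (auto simp: words_def)
  also have "\<dots> = (\<Sum>J\<in>sorted_words (Suc m) n. antisym_coeff K J * y (J # singles b))"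
    using b by simp
  finally show ?thesis .
qed

lemma transpose_hook: "c \<noteq> [] \<Longrightarrow> List.transpose (c # singles L) = (hd c # L) # singles (tl c)"
proof (cases c)
  case (Cons x xs)
  have ones: "List.transpose (ys # replicate k []) = singles ys" for ys :: "'a list" and k
  proof (induction ys arbitrary: k)
    case Nil
    have "List.transpose (replicate k []) = ([] :: 'a list list)" by (induction k) auto
    then show ?case by simp
  next
    case (Cons y ys)
    show ?case using Cons[of 0] by simp
  qed
  have a: "concat (map (case_list [] (\<lambda>h t. [h])) (singles L)) = L" by (induction L) auto
  have b: "concat (map (case_list [] (\<lambda>h t. [t])) (singles L)) = replicate (length L) []"
    by (induction L) auto
  show ?thesis unfolding Cons using a b ones[of xs "length L"] by simp
qed simp

text \<open>
  For a hook, \<open>rows_to_columns\<close> is the rotation of the first \<open>m + 1\<close> positions: the corner box is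
  the first letter of the column, which comes after the arm in the order used for \<open>koszul_term\<close>.
\<close>

definition rotp :: "nat \<Rightarrow> nat \<Rightarrow> nat" where
  "rotp m s = (if s = 0 then m else if s \<le> m then s - 1 else s)"

lemma rotp_permutes:
  assumes "m < p"
  shows "rotp m permutes {..<p}"
proof (rule bij_imp_permutes)
  show "bij_betw (rotp m) {..<p} {..<p}"
    by (rule bij_betw_byWitness[where f' = "cyc m 0"]) (use assms in \<open>auto simp: rotp_def cyc_def\<close>)
qed (use assms in \<open>auto simp: rotp_def\<close>)

lemma rotp_append:
  assumes "length L = m"
  shows "permute_list (rotp m) (L @ i # c) = i # L @ c"
proof (rule nth_equalityI)
  fix s assume "s < length (permute_list (rotp m) (L @ i # c))"
  then have s: "s < length (L @ i # c)" by simp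
  have "rotp m permutes {..<length (L @ i # c)}" using assms by (intro rotp_permutes) simp
  from permute_list_nth[OF this s]
  show "permute_list (rotp m) (L @ i # c) ! s = (i # L @ c) ! s"
    using assms s by (auto simp: rotp_def nth_append nth_Cons' not_less)
qed simp

text \<open>The index in \<open>sym_basis\<close> of the image of a word: the column of the hook,
  formed by the last letters, is the first part of the conjugate partition.\<close>

definition word_type :: "nat \<Rightarrow> nat list \<Rightarrow> nat multiset list" where
  "word_type m w = mset (drop m w) # map (\<lambda>x. {#x#}) (take m w)"

text \<open>
  The projection of \<open>I\<^bsup>\<otimes>p\<^esup>\<close> onto \<open>S\<^bsup>p-m\<^esup> \<otimes> I\<^bsup>\<otimes>m\<^esup>\<close>, the symmetric factor being formed by the last letters.
\<close>

definition sym_proj :: "nat \<Rightarrow> nat \<Rightarrow> nat \<Rightarrow> (nat list \<Rightarrow> 'k::field) \<Rightarrow> nat multiset list \<Rightarrow> 'k" where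
  "sym_proj p m n g \<alpha> = (\<Sum>w | w \<in> words p n \<and> word_type m w = \<alpha>. g w)"

lemma sym_proj_linear:
  "sym_proj p m n 0 = 0" "sym_proj p m n (\<lambda>w. g w + h w) = sym_proj p m n g + sym_proj p m n h"
  "sym_proj p m n (\<lambda>w. c * g w) = fscale c (sym_proj p m n g)"
  by (auto simp: sym_proj_def fun_eq_iff sum.distrib sum_distrib_left)

text \<open>
  \<open>ext_to_tensor\<close> for a hook, on words instead of fillings.
\<close>

definition ext_tensor :: "nat \<Rightarrow> nat \<Rightarrow> nat \<Rightarrow> (nat list list \<Rightarrow> 'k::field) \<Rightarrow> nat list \<Rightarrow> 'k" where
  "ext_tensor p m n y w = (if w \<in> words p n
     then \<Sum>J\<in>sorted_words (Suc m) n. antisym_coeff (take (Suc m) w) J * y (J # singles (drop (Suc m) w)) else 0)"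

lemma ext_tensor_append:
  assumes "K \<in> words (Suc m) n" "b \<in> words (p - m - 1) n" "m < p"
  shows "ext_tensor p m n y (K @ b) = (\<Sum>J\<in>sorted_words (Suc m) n. antisym_coeff K J * y (J # singles b))"
proof -
  have "length K = Suc m" "K @ b \<in> words p n" using assms by (auto simp: words_def)
  then show ?thesis by (simp add: ext_tensor_def)
qed

text \<open>A filling of the conjugate hook with first row \<open>c\<close> and further rows
  \<open>singles L\<close> is encoded as the word \<open>L @ c\<close>. Its transpose has the first
  row \<open>hd c # L\<close>, and passing from \<open>L @ c\<close> to that order is the rotation
  \<open>rotp\<close>.\<close>

lemma schur_map_hook:
  assumes m: "m < p"
  shows "schur_map (hook p m) n y =
    sym_proj p m n (\<lambda>w. ext_tensor p m n y (permute_list (rotp m) w) :: 'k::field)"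
proof
  fix \<alpha>
  have "schur_map (hook p m) n y \<alpha> =
    (\<Sum>U | U \<in> fillings (hook_cols p m) n \<and> map mset U = \<alpha>. ext_to_tensor (hook p m) n y (List.transpose U))"
    unfolding schur_map_def tensor_to_sym_def rows_to_columns_def conj_part_hook[OF m]
    by (intro sum.cong) auto
  also have "\<dots> = (\<Sum>w | w \<in> words p n \<and> word_type m w = \<alpha>. ext_tensor p m n y (permute_list (rotp m) w))"
  proof (rule sum.reindex_bij_witness[of _ "\<lambda>w. drop m w # singles (take m w)" "\<lambda>U. map hd (tl U) @ hd U"])
    fix U assume U: "U \<in> {U. U \<in> fillings (hook_cols p m) n \<and> map mset U = \<alpha>}"
    then obtain c L where cL: "U = c # singles L" "c \<in> words (p - m) n" "L \<in> words m n"
      unfolding fillings_hook_shape by auto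
    have lens: "length c = p - m" "length L = m" using cL by (auto simp: words_def)
    have w: "map hd (tl U) @ hd U = L @ c" using cL by (simp add: o_def)
    show "drop m (map hd (tl U) @ hd U) # singles (take m (map hd (tl U) @ hd U)) = U"
      unfolding w using cL lens by simp
    have Lc: "L @ c \<in> words p n" using cL m by (auto simp: words_def)
    show "map hd (tl U) @ hd U \<in> {w. w \<in> words p n \<and> word_type m w = \<alpha>}"
      unfolding w using Lc U cL lens by (auto simp: word_type_def o_def)
    obtain i c' where c: "c = i # c'" using lens m by (cases c) auto
    have K: "i # L \<in> words (Suc m) n" "c' \<in> words (p - m - 1) n" using cL c by (auto simp: words_def)
    have "permute_list (rotp m) (L @ c) = (i # L) @ c'" unfolding c using rotp_append[OF lens(2)] by simp
    then have "ext_tensor p m n y (permute_list (rotp m) (L @ c)) =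
      (\<Sum>J\<in>sorted_words (Suc m) n. antisym_coeff (i # L) J * y (J # singles c'))"
      using ext_tensor_append[OF K m] by metis
    moreover have "List.transpose U = (i # L) # singles c'"
      unfolding cL using transpose_hook[of c L] c by simp
    ultimately show "ext_tensor p m n y (permute_list (rotp m) (map hd (tl U) @ hd U)) =
        ext_to_tensor (hook p m) n y (List.transpose U)"
      unfolding w using ext_to_tensor_hook[OF K, where y = y] by simp
  next
    fix w assume w: "w \<in> {w. w \<in> words p n \<and> word_type m w = \<alpha>}"
    show "map hd (tl (drop m w # singles (take m w))) @ hd (drop m w # singles (take m w)) = w"
      by (simp add: o_def)
    show "drop m w # singles (take m w) \<in> {U. U \<in> fillings (hook_cols p m) n \<and> map mset U = \<alpha>}"
    proof -
      have "take m w \<in> words m n" "drop m w \<in> words (p - m) n"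
        using w m by (auto simp: words_def dest: in_set_takeD in_set_dropD)
      then have "drop m w # singles (take m w) \<in> fillings (hook_cols p m) n"
        unfolding fillings_hook_shape by blast
      then show ?thesis using w by (simp add: word_type_def o_def)
    qed
  qed
  finally show "schur_map (hook p m) n y \<alpha> = sym_proj p m n (\<lambda>w. ext_tensor p m n y (permute_list (rotp m) w)) \<alpha>"
    by (simp add: sym_proj_def)
qed

text \<open>For \<open>r = Suc m\<close> this is the image of the natural monomorphism from
  \<open>ext_pow (hook p m)\<close> into the tensor power, by \<open>ext_tensor_in\<close> and
  \<open>ext_tensor_surj\<close>.\<close>

definition alt_tensors :: "nat \<Rightarrow> nat \<Rightarrow> nat \<Rightarrow> (nat list \<Rightarrow> 'k::field) set" where
  "alt_tensors p r n = {z \<in> ob (tensor_pow p) n. alternating p r z}"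

lemma alternating_sum:
  fixes f :: "'i \<Rightarrow> nat list \<Rightarrow> 'k::field"
  assumes "\<And>i. i \<in> I \<Longrightarrow> alternating p r (f i)"
  shows "alternating p r (\<Sum>i\<in>I. f i)"
  using assms by (induction I rule: infinite_finite_induct) (auto simp: alternating_linear)

lemma ext_tensor_in:
  assumes m: "m < p"
  shows "(ext_tensor p m n y :: nat list \<Rightarrow> 'k::field) \<in> alt_tensors p (Suc m) n"
proof -
  let ?f = "\<lambda>J w. if w \<in> words p n then antisym_coeff (take (Suc m) w) J * y (J # singles (drop (Suc m) w)) else 0 :: 'k"
  have "alternating p (Suc m) (?f J)" if J: "J \<in> sorted_words (Suc m) n" for J
  proof -
    have lJ: "length J = Suc m" using J by (simp add: sorted_words_def words_def)
    have a: "alternating p (Suc m) (\<lambda>w. antisym_coeff (take (Suc m) w) J * y (J # singles (drop (Suc m) w)) :: 'k)"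
      by (rule alternating_take[OF antisym_coeff_alternating[OF lJ]]) (use m in simp)
    show ?thesis
      unfolding alternating_def
    proof (intro allI impI)
      fix P R :: "nat list" and x z
      assume "length P + length R + 2 = p \<and> length P + 2 \<le> Suc m"
      then have l: "length P + length R + 2 = p" "length P + 2 \<le> Suc m" by auto
      have "P @ z # x # R \<in> words p n \<longleftrightarrow> P @ x # z # R \<in> words p n" by (rule words_mset) simp
      then show "?f J (P @ z # x # R) = - ?f J (P @ x # z # R) \<and> ?f J (P @ x # x # R) = 0"
        using alternatingD(1)[OF a l, of z x] alternatingD(2)[OF a l, of x] by simp
    qed
  qed
  then have "alternating p (Suc m) (\<Sum>J\<in>sorted_words (Suc m) n. ?f J)" by (rule alternating_sum)
  moreover have "(\<Sum>J\<in>sorted_words (Suc m) n. ?f J) = ext_tensor p m n y"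
    by (simp add: fun_eq_iff sum_fun_apply ext_tensor_def)
  ultimately show ?thesis by (simp add: alt_tensors_def tensor_pow_ob ext_tensor_def)
qed

text \<open>An alternating tensor is rebuilt from its entries at increasing words by
  \<open>sum_antisym_sorted\<close>, so identities between such tensors need checking only
  there.\<close>

lemma ext_tensor_restrict:
  assumes m: "m < p" and z: "(z :: nat list \<Rightarrow> 'k::field) \<in> alt_tensors p (Suc m) n"
    and y: "\<And>J b. J \<in> sorted_words (Suc m) n \<Longrightarrow> b \<in> words (p - m - 1) n \<Longrightarrow> y (J # singles b) = z (J @ b)"
  shows "ext_tensor p m n y = z"
proof
  fix w
  show "ext_tensor p m n y w = z w"
  proof (cases "w \<in> words p n")
    case True
    define K b where "K = take (Suc m) w" and "b = drop (Suc m) w"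
    have w: "w = K @ b" by (simp add: K_def b_def)
    have K: "K \<in> words (Suc m) n" and b: "b \<in> words (p - m - 1) n"
      using True m by (auto simp: K_def b_def words_def dest: in_set_takeD in_set_dropD)
    have "ext_tensor p m n y w = (\<Sum>J\<in>sorted_words (Suc m) n. antisym_coeff K J * z (J @ b))"
      unfolding w ext_tensor_append[OF K b m] using y b by simp
    also have "\<dots> = z w"
      unfolding w by (rule sum_antisym_sorted) (use z K b m in \<open>auto simp: alt_tensors_def words_def\<close>)
    finally show ?thesis .
  next
    case False
    then show ?thesis using z by (simp add: ext_tensor_def alt_tensors_def tensor_pow_ob)
  qed
qed

lemma ext_tensor_surj:
  assumes m: "m < p" and z: "(z :: nat list \<Rightarrow> 'k::field) \<in> alt_tensors p (Suc m) n"
  shows "\<exists>y\<in>ob (ext_pow (hook p m)) n. ext_tensor p m n y = z"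
proof -
  define y where "y T = (if T \<in> ext_basis (hook p m) n then z (hd T @ map hd (tl T)) else 0)" for T
  have "y \<in> ob (ext_pow (hook p m)) n" by (simp add: y_def ext_pow_def matrix_spfun_def)
  moreover have "ext_tensor p m n y = z"
    by (rule ext_tensor_restrict[OF m z]) (auto simp: y_def ext_basis_hook o_def)
  ultimately show ?thesis by blast
qed

lemma schur_hook_ob:
  assumes m: "m < p"
  shows "ob (schur (hook p m)) n =
    (\<lambda>z. sym_proj p m n (\<lambda>w. z (permute_list (rotp m) w))) ` (alt_tensors p (Suc m) n :: (nat list \<Rightarrow> 'k::field) set)"
    (is "_ = ?f ` _")
proof -
  have "ob (schur (hook p m)) n = (\<lambda>y. ?f (ext_tensor p m n y)) ` ob (ext_pow (hook p m)) n"
    by (simp add: schur_def spf_image_def schur_map_hook[OF m])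
  also have "\<dots> = ?f ` ext_tensor p m n ` ob (ext_pow (hook p m)) n"
    by (rule image_image[symmetric])
  also have "ext_tensor p m n ` ob (ext_pow (hook p m)) n = (alt_tensors p (Suc m) n :: (nat list \<Rightarrow> 'k) set)"
  proof (intro subset_antisym subsetI)
    fix z :: "nat list \<Rightarrow> 'k" assume "z \<in> alt_tensors p (Suc m) n"
    from ext_tensor_surj[OF m this] show "z \<in> ext_tensor p m n ` ob (ext_pow (hook p m)) n" by blast
  next
    fix z :: "nat list \<Rightarrow> 'k" assume "z \<in> ext_tensor p m n ` ob (ext_pow (hook p m)) n"
    then show "z \<in> alt_tensors p (Suc m) n" using ext_tensor_in[OF m] by blast
  qed
  finally show ?thesis .
qed

section \<open>The symmetric powers of the conjugate hook\<close>

lemma sym_basis_Cons: "sym_basis (a # mu) n = {r # T |r T. size r = a \<and> set_mset r \<subseteq> {..<n} \<and> T \<in> sym_basis mu n}"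
  by (auto simp: sym_basis_def map_eq_Cons_conv subset_iff)

lemma sym_basis_ones: "sym_basis (replicate k 1) n = map (\<lambda>x. {#x#}) ` words k n"
proof (induction k)
  case 0
  then show ?case by (auto simp: sym_basis_def words_def)
next
  case (Suc k)
  show ?case
  proof (intro subset_antisym subsetI)
    fix \<alpha> assume "\<alpha> \<in> sym_basis (replicate (Suc k) 1) n"
    then obtain r w where r: "\<alpha> = r # map (\<lambda>x. {#x#}) w" "size r = 1" "set_mset r \<subseteq> {..<n}" "w \<in> words k n"
      unfolding replicate_Suc sym_basis_Cons Suc by blast
    then obtain x where x: "r = {#x#}" using size_1_singleton_mset by blast
    then have "x # w \<in> words (Suc k) n" using r by (auto simp: words_Suc)
    then show "\<alpha> \<in> map (\<lambda>x. {#x#}) ` words (Suc k) n" using r x by (intro image_eqI[of _ _ "x # w"]) auto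
  next
    fix \<alpha> assume "\<alpha> \<in> map (\<lambda>x. {#x#}) ` words (Suc k) n"
    then obtain x w where "\<alpha> = {#x#} # map (\<lambda>x. {#x#}) w" "x < n" "w \<in> words k n" by (auto simp: words_Suc)
    then show "\<alpha> \<in> sym_basis (replicate (Suc k) 1) n"
      unfolding replicate_Suc sym_basis_Cons Suc by auto
  qed
qed

lemma sym_basis_hook:
  assumes "m \<le> p"
  shows "sym_basis (hook_cols p m) n = word_type m ` words p n"
proof (intro subset_antisym subsetI)
  fix \<alpha> assume "\<alpha> \<in> sym_basis (hook_cols p m) n"
  then obtain r L where rL: "\<alpha> = r # map (\<lambda>x. {#x#}) L" "size r = p - m" "set_mset r \<subseteq> {..<n}" "L \<in> words m n"
    unfolding sym_basis_Cons sym_basis_ones by blast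
  then have "\<alpha> = word_type m (L @ sorted_list_of_multiset r)" by (simp add: word_type_def words_def)
  moreover have "L @ sorted_list_of_multiset r \<in> words p n"
    using rL assms by (auto simp: words_def simp flip: size_mset)
  ultimately show "\<alpha> \<in> word_type m ` words p n" by blast
next
  fix \<alpha> assume "\<alpha> \<in> word_type m ` words p n"
  then obtain w where w: "w \<in> words p n" "\<alpha> = word_type m w" by blast
  show "\<alpha> \<in> sym_basis (hook_cols p m) n"
    unfolding sym_basis_Cons sym_basis_ones w(2) word_type_def
    using w assms by (auto simp: words_def dest: in_set_takeD in_set_dropD intro!: imageI)
qed

lemma sum_word_type:
  assumes "m \<le> p"
  shows "(\<Sum>\<alpha>\<in>sym_basis (hook_cols p m) n. F \<alpha> * sym_proj p m n g \<alpha>) = (\<Sum>w\<in>words p n. F (word_type m w) * g w)"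
proof -
  have "(\<Sum>\<alpha>\<in>sym_basis (hook_cols p m) n. F \<alpha> * sym_proj p m n g \<alpha>) =
    (\<Sum>\<alpha>\<in>word_type m ` words p n. \<Sum>w | w \<in> words p n \<and> word_type m w = \<alpha>. F (word_type m w) * g w)"
    unfolding sym_basis_hook[OF assms] sym_proj_def sum_distrib_left by (intro sum.cong) auto
  also have "\<dots> = (\<Sum>w\<in>words p n. F (word_type m w) * g w)"
    by (rule sum.group) auto
  finally show ?thesis .
qed

lemma prod_pvar_zip:
  "length w = length c \<Longrightarrow>
    prod_list (map pvar (zip w c)) = (Poly_Mapping.single (mset (zip w c)) 1 :: (nat \<times> nat, 'k::field) mpol)"
proof (induction w c rule: list_induct2)
  case Nil
  then show ?case by (simp flip: single_one)
qed (simp add: pvar_def mult_single)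

lemma sym_entry_single: "sym_entry {#x#} {#y#} = (pvar (x, y) :: (nat \<times> nat, 'k::field) mpol)"
proof -
  have "{w. mset w = {#x#}} = {[x]}" by auto
  then show ?thesis by (simp add: sym_entry_def)
qed

lemma prod_sym_entry_word_type:
  assumes w: "length w = p" and x: "length x = p" and m: "m \<le> p"
  shows "prod_list (map2 sym_entry (word_type m w) (word_type m x)) =
    (\<Sum>c | mset c = mset (drop m w). Poly_Mapping.single (mset (zip (take m w @ c) x)) 1 :: (nat \<times> nat, 'k::field) mpol)"
proof -
  have ones: "prod_list (map2 sym_entry (map (\<lambda>x. {#x#}) K) (map (\<lambda>x. {#x#}) L)) =
      (Poly_Mapping.single (mset (zip K L)) 1 :: (nat \<times> nat, 'k) mpol)" if "length K = length L" for K L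
    using that
  proof (induction K L rule: list_induct2)
    case Nil
    then show ?case by (simp flip: single_one)
  qed (simp add: pvar_def mult_single sym_entry_single)
  let ?A = "{c. mset c = mset (drop m w)}"
  \<comment> \<open>\<open>sym_entry\<close> lists its second argument in sorted order; permuting
    \<open>c\<close> along with it restores the order in which the letters stand in
    \<open>x\<close>.\<close>
  let ?s = "sort (drop m x)"
  obtain \<sigma> where \<sigma>: "\<sigma> permutes {..<length (drop m x)}" "permute_list \<sigma> (drop m x) = ?s"
    using mset_eq_permutation[of ?s "drop m x"] by auto
  have len: "length c = p - m" if "c \<in> ?A" for c using that w mset_eq_length[of c "drop m w"] by simp
  have "sym_entry (mset (drop m w)) (mset (drop m x)) =
    (\<Sum>c\<in>?A. Poly_Mapping.single (mset (zip c ?s)) 1 :: (nat \<times> nat, 'k) mpol)"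
    unfolding sym_entry_def using len x by (intro sum.cong) (auto simp: prod_pvar_zip)
  also have "\<dots> = (\<Sum>c\<in>?A. Poly_Mapping.single (mset (zip c (drop m x))) 1)"
  proof (rule sum.reindex_bij_witness[of _ "permute_list \<sigma>" "permute_list (inv_into UNIV \<sigma>)"])
    have \<sigma>': "inv_into UNIV \<sigma> permutes {..<length (drop m x)}" by (rule permutes_inv[OF \<sigma>(1)])
    fix c assume c: "c \<in> ?A"
    have l: "length c = length (drop m x)" using len[OF c] x by simp
    show "permute_list \<sigma> (permute_list (inv_into UNIV \<sigma>) c) = c" "permute_list (inv_into UNIV \<sigma>) (permute_list \<sigma> c) = c"
      using permute_list_inverse[of \<sigma> c] \<sigma>(1) l by simp_all
    show "permute_list (inv_into UNIV \<sigma>) c \<in> ?A" "permute_list \<sigma> c \<in> ?A" using c \<sigma>(1) \<sigma>' l by simp_all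
    have "zip c ?s = permute_list \<sigma> (zip (permute_list (inv_into UNIV \<sigma>) c) (drop m x))"
      using permute_list_zip[OF \<sigma>(1), of "permute_list (inv_into UNIV \<sigma>) c" "drop m x"] \<sigma> l permute_list_inverse(2)[of \<sigma> c] by simp
    then have "mset (zip c ?s) = mset (zip (permute_list (inv_into UNIV \<sigma>) c) (drop m x))"
      using \<sigma>(1) l by simp
    then show "Poly_Mapping.single (mset (zip (permute_list (inv_into UNIV \<sigma>) c) (drop m x))) 1 =
        (Poly_Mapping.single (mset (zip c ?s)) 1 :: (nat \<times> nat, 'k) mpol)" by simp
  qed
  finally have "prod_list (map2 sym_entry (word_type m w) (word_type m x)) =
    (\<Sum>c\<in>?A. Poly_Mapping.single (mset (zip c (drop m x)) + mset (zip (take m w) (take m x))) 1 :: (nat \<times> nat, 'k) mpol)"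
    using ones[of "take m w" "take m x"] w x by (simp add: word_type_def sum_distrib_right mult_single)
  also have "\<dots> = (\<Sum>c\<in>?A. Poly_Mapping.single (mset (zip (take m w @ c) x)) 1)"
  proof (rule sum.cong[OF refl])
    fix c assume c: "c \<in> ?A"
    have "zip (take m w @ c) x = zip (take m w @ c) (take m x @ drop m x)" by simp
    also have "\<dots> = zip (take m w) (take m x) @ zip c (drop m x)"
      using w x by (intro zip_append) simp
    finally show "Poly_Mapping.single (mset (zip c (drop m x)) + mset (zip (take m w) (take m x))) 1 =
      (Poly_Mapping.single (mset (zip (take m w @ c) x)) 1 :: (nat \<times> nat, 'k) mpol)" by (simp add: add.commute)
  qed
  finally show ?thesis .
qed

lemma word_type_fibre:
  assumes w: "w \<in> words p n" and m: "m \<le> p"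
  shows "{y. y \<in> words p n \<and> word_type m y = word_type m w} = (\<lambda>c. take m w @ c) ` {c. mset c = mset (drop m w)}"
proof (intro subset_antisym subsetI)
  fix y assume "y \<in> {y. y \<in> words p n \<and> word_type m y = word_type m w}"
  then have y: "mset (drop m y) = mset (drop m w)" "map (\<lambda>x. {#x#}) (take m y) = map (\<lambda>x. {#x#}) (take m w)"
    by (auto simp: word_type_def)
  have "inj (\<lambda>x. {#x#})" by (auto intro: injI)
  then have "take m y = take m w" using y(2) inj_map_eq_map by blast
  then have "y = take m w @ drop m y" by (metis append_take_drop_id)
  then show "y \<in> (\<lambda>c. take m w @ c) ` {c. mset c = mset (drop m w)}" using y(1) by blast
next
  fix y assume "y \<in> (\<lambda>c. take m w @ c) ` {c. mset c = mset (drop m w)}"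
  then obtain c where c: "y = take m w @ c" "mset c = mset (drop m w)" by blast
  have "mset y = mset (take m w @ drop m w)" unfolding c(1) mset_append c(2) ..
  then have "y \<in> words p n" using words_mset w by (metis append_take_drop_id)
  then show "y \<in> {y. y \<in> words p n \<and> word_type m y = word_type m w}"
    using c w m by (auto simp: word_type_def words_def)
qed

text \<open>Naturality of the projection: a row of the matrix of the symmetric power sums the rows
  of the tensor power over one fibre of \<open>word_type\<close>.\<close>

lemma sym_pow_coef_sym_proj:
  assumes m: "m \<le> p"
  shows "coef (sym_pow (hook_cols p m)) n1 n2 N (sym_proj p m n1 g) =
    (sym_proj p m n2 (coef (tensor_pow p) n1 n2 N g) :: nat multiset list \<Rightarrow> 'k::field)"
proof
  fix \<beta>
  let ?L = "coef (sym_pow (hook_cols p m)) n1 n2 N (sym_proj p m n1 g) \<beta>"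
  show "?L = sym_proj p m n2 (coef (tensor_pow p) n1 n2 N g) \<beta>"
  proof (cases "\<beta> \<in> sym_basis (hook_cols p m) n2")
    case True
    then obtain w where w: "w \<in> words p n2" "\<beta> = word_type m w" unfolding sym_basis_hook[OF m] by blast
    let ?A = "{c. mset c = mset (drop m w)}"
    have "?L = (\<Sum>\<alpha>\<in>sym_basis (hook_cols p m) n1.
        Poly_Mapping.lookup (prod_list (map2 sym_entry \<beta> \<alpha>)) N * sym_proj p m n1 g \<alpha>)"
      using True by (simp add: sym_pow_def matrix_spfun_def)
    also have "\<dots> = (\<Sum>x\<in>words p n1. Poly_Mapping.lookup (prod_list (map2 sym_entry \<beta> (word_type m x))) N * g x)"
      by (rule sum_word_type[OF m])
    also have "\<dots> = (\<Sum>x\<in>words p n1. \<Sum>c\<in>?A. if mset (zip (take m w @ c) x) = N then g x else 0)"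
    proof (rule sum.cong[OF refl])
      fix x assume x: "x \<in> words p n1"
      have "Poly_Mapping.lookup (prod_list (map2 sym_entry \<beta> (word_type m x))) N =
        (\<Sum>c\<in>?A. if mset (zip (take m w @ c) x) = N then 1 else 0 :: 'k)"
        unfolding w(2)
        by (subst prod_sym_entry_word_type[of w p x m]) (use w x m in \<open>auto simp: words_def lookup_sum lookup_single when_def\<close>)
      then show "Poly_Mapping.lookup (prod_list (map2 sym_entry \<beta> (word_type m x))) N * g x =
        (\<Sum>c\<in>?A. if mset (zip (take m w @ c) x) = N then g x else 0)"
        by (auto simp: sum_distrib_right intro!: sum.cong)
    qed
    also have "\<dots> = (\<Sum>c\<in>?A. \<Sum>x\<in>words p n1. if mset (zip (take m w @ c) x) = N then g x else 0)"
      by (rule sum.swap)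
    also have "\<dots> = (\<Sum>c\<in>?A. coef (tensor_pow p) n1 n2 N g (take m w @ c))"
    proof (rule sum.cong[OF refl])
      fix c assume "c \<in> ?A"
      then have "take m w @ c \<in> words p n2" using word_type_fibre[OF w(1) m] by blast
      then show "(\<Sum>x\<in>words p n1. if mset (zip (take m w @ c) x) = N then g x else 0) = coef (tensor_pow p) n1 n2 N g (take m w @ c)"
        by (simp add: tensor_pow_coef_sum)
    qed
    also have "\<dots> = (\<Sum>y\<in>(\<lambda>c. take m w @ c) ` ?A. coef (tensor_pow p) n1 n2 N g y)"
      by (subst sum.reindex) (auto simp: inj_on_def)
    also have "\<dots> = sym_proj p m n2 (coef (tensor_pow p) n1 n2 N g) \<beta>"
      unfolding sym_proj_def w(2) word_type_fibre[OF w(1) m] ..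
    finally show ?thesis .
  next
    case False
    then have empty: "{w. w \<in> words p n2 \<and> word_type m w = \<beta>} = {}" unfolding sym_basis_hook[OF m] by auto
    have "sym_proj p m n2 (coef (tensor_pow p) n1 n2 N g) \<beta> = 0"
      unfolding sym_proj_def empty by (rule sum.empty)
    then show ?thesis using False by (simp add: sym_pow_def matrix_spfun_def)
  qed
qed

text \<open>Extend the functional linearly to all functions and evaluate it at the delta functions
  of \<open>X\<close>. It will show that the dual of the inclusion of the Schur functor is
  surjective.\<close>

lemma functional_extend:
  fixes V :: "('b \<Rightarrow> 'k::field) set"
  assumes V: "fvs.subspace V" and X: "finite X" and supp: "\<And>s x. s \<in> V \<Longrightarrow> x \<notin> X \<Longrightarrow> s x = 0"
    and add: "\<And>s t. s \<in> V \<Longrightarrow> t \<in> V \<Longrightarrow> \<phi> (s + t) = \<phi> s + \<phi> t"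
    and scale: "\<And>c s. s \<in> V \<Longrightarrow> \<phi> (fscale c s) = c * \<phi> s"
  shows "\<exists>\<kappa>. \<forall>s\<in>V. \<phi> s = (\<Sum>x\<in>X. \<kappa> x * s x)"
proof -
  interpret P: vector_space_pair "fscale :: 'k \<Rightarrow> ('b \<Rightarrow> 'k) \<Rightarrow> 'b \<Rightarrow> 'k" "(*) :: 'k \<Rightarrow> 'k \<Rightarrow> 'k"
    by unfold_locales (auto simp: algebra_simps)
  have fdV: "fd_space V" by (rule fd_space_supported[OF V X]) (rule supp)
  obtain S where S: "finite S" "V = fvs.span S" using fdV unfolding fd_space_def by blast
  obtain B where B: "B \<subseteq> V" "fvs.independent B" "V \<subseteq> fvs.span B"
    using fvs.maximal_independent_subset by blast
  have fB: "finite B" using fvs.independent_span_bound[OF S(1) B(2)] B(1) S(2) by blast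
  obtain g where g: "Vector_Spaces.linear fscale (*) g" "\<forall>b\<in>B. g b = \<phi> b"
    using P.linear_independent_extend[OF B(2)] by blast
  \<comment> \<open>The functional is regarded as a map into functions on \<open>unit\<close>, so
    that the lemmas on \<open>linear_between\<close> apply.\<close>
  have lin: "linear_between V UNIV (\<lambda>s (_::unit). \<phi> s)"
    unfolding linear_between_def by (auto simp: add scale)
  let ?\<delta> = "\<lambda>x y. if x = y then 1 else 0 :: 'k"
  have "\<phi> s = (\<Sum>x\<in>X. g (?\<delta> x) * s x)" if s: "s \<in> V" for s
  proof -
    have sd: "s = (\<Sum>x\<in>X. fscale (s x) (?\<delta> x))"
    proof
      fix y show "s y = (\<Sum>x\<in>X. fscale (s x) (?\<delta> x)) y"
        using X supp[OF s, of y] by (cases "y \<in> X") (auto simp: sum_fun_apply if_distrib cong: if_cong)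
    qed
    let ?r = "fvs.representation B s"
    have sr: "s = (\<Sum>b\<in>B. fscale (?r b) b)"
      using fvs.sum_representation_eq[OF B(2) subsetD[OF B(3) s] fB order_refl] by simp
    have "(\<lambda>_::unit. \<phi> (\<Sum>b\<in>B. fscale (?r b) b)) = (\<Sum>b\<in>B. (\<lambda>_. \<phi> (fscale (?r b) b)))"
      by (rule linear_between_sum[OF lin V]) (use B(1) fvs.subspace_scale[OF V] in blast)
    then have "\<phi> s = (\<Sum>b\<in>B. \<phi> (fscale (?r b) b))"
      unfolding sr[symmetric] by (simp add: fun_eq_iff sum_fun_apply)
    also have "\<dots> = (\<Sum>b\<in>B. ?r b * g b)"
    proof (rule sum.cong[OF refl])
      fix b assume b: "b \<in> B"
      then have "b \<in> V" using B(1) by blast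
      then show "\<phi> (fscale (?r b) b) = ?r b * g b" using scale g(2) b by simp
    qed
    also have "\<dots> = g (\<Sum>b\<in>B. fscale (?r b) b)"
      by (simp only: P.linear_sum[OF g(1)] P.linear_scale[OF g(1)])
    also have "\<dots> = g s" by (simp only: sr[symmetric])
    also have "g s = g (\<Sum>x\<in>X. fscale (s x) (?\<delta> x))" by (rule arg_cong[OF sd])
    also have "\<dots> = (\<Sum>x\<in>X. s x * g (?\<delta> x))"
      by (simp only: P.linear_sum[OF g(1)] P.linear_scale[OF g(1)])
    also have "\<dots> = (\<Sum>x\<in>X. g (?\<delta> x) * s x)" by (simp add: mult.commute)
    finally show ?thesis .
  qed
  then show ?thesis by (intro exI[of _ "\<lambda>x. g (?\<delta> x)"]) blast
qed

text \<open>The tensor power of the transposed matrix is the transposed tensor power; on monomials,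
  transposition is \<open>prod.swap\<close>, as in \<open>kuhn_dual\<close>.\<close>

lemma coef_adjoint:
  "(\<Sum>w\<in>words p n2. coef (tensor_pow p) n1 n2 M v w * g w) =
   (\<Sum>x\<in>words p n1. v x * (coef (tensor_pow p) n2 n1 (image_mset prod.swap M) g x :: 'k::field))"
proof -
  have sw: "mset (zip x w) = image_mset prod.swap M \<longleftrightarrow> mset (zip w x) = M" for x w :: "nat list"
  proof -
    have "zip x w = map prod.swap (zip w x)"
      by (subst zip_commute) (auto simp: prod.swap_def intro!: map_cong)
    then have "mset (zip x w) = image_mset prod.swap (mset (zip w x))" by simp
    moreover have "image_mset prod.swap (image_mset prod.swap A) = A" for A :: "(nat \<times> nat) multiset"
      by (simp add: multiset.map_comp o_def)
    ultimately show ?thesis by metis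
  qed
  have "(\<Sum>w\<in>words p n2. coef (tensor_pow p) n1 n2 M v w * g w) =
    (\<Sum>w\<in>words p n2. \<Sum>x\<in>words p n1. if mset (zip w x) = M then v x * g w else 0)"
    by (intro sum.cong) (auto simp: tensor_pow_coef_sum sum_distrib_right intro!: sum.cong)
  also have "\<dots> = (\<Sum>x\<in>words p n1. \<Sum>w\<in>words p n2. if mset (zip w x) = M then v x * g w else 0)"
    by (rule sum.swap)
  also have "\<dots> = (\<Sum>x\<in>words p n1. v x * coef (tensor_pow p) n2 n1 (image_mset prod.swap M) g x)"
    by (intro sum.cong) (auto simp: tensor_pow_coef_sum sw sum_distrib_left intro!: sum.cong)
  finally show ?thesis .
qed

text \<open>The pairing of invariants and coinvariants of the permutations of the last
  \<open>p - m\<close> places. A tensor symmetric there is constant on the words of one type, so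
  that the representative chosen by \<open>inv_into\<close> is immaterial.\<close>

definition pairing :: "nat \<Rightarrow> nat \<Rightarrow> nat \<Rightarrow> (nat list \<Rightarrow> 'k::field) \<Rightarrow> (nat multiset list \<Rightarrow> 'k) \<Rightarrow> 'k" where
  "pairing p m n v s = (\<Sum>\<alpha>\<in>sym_basis (hook_cols p m) n. v (inv_into (words p n) (word_type m) \<alpha>) * s \<alpha>)"

lemma koszul_term_word_type:
  assumes v: "v \<in> ob (koszul_term p m) n" and m: "m \<le> p" and w: "w \<in> words p n"
  shows "v (inv_into (words p n) (word_type m) (word_type m w)) = v w"
proof -
  let ?y = "inv_into (words p n) (word_type m) (word_type m w)"
  have "?y \<in> words p n" "word_type m ?y = word_type m w"
    using w by (auto intro: inv_into_into f_inv_into_f)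
  then have "?y \<in> (\<lambda>c. take m w @ c) ` {c. mset c = mset (drop m w)}"
    using word_type_fibre[OF w m] by blast
  then obtain c where c: "?y = take m w @ c" "mset c = mset (drop m w)" by blast
  have "v (take m w @ c) = v (take m w @ drop m w)"
    by (rule symmetric_mset[of p m]) (use v c w m mset_eq_length[OF c(2)] in \<open>auto simp: koszul_term_simps words_def\<close>)
  then show ?thesis unfolding c(1) by simp
qed

lemma pairing_sym_proj:
  assumes v: "v \<in> ob (koszul_term p m) n" and m: "m \<le> p"
  shows "pairing p m n v (sym_proj p m n g) = (\<Sum>w\<in>words p n. v w * g w)"
  unfolding pairing_def sum_word_type[OF m] using koszul_term_word_type[OF v m] by (intro sum.cong) auto

lemma sum_rotated_words:
  assumes "m < p"
  shows "(\<Sum>w\<in>words p n. F w) = (\<Sum>b\<in>words (p - m - 1) n. \<Sum>K\<in>words (Suc m) n. F (tl K @ hd K # b))"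
proof -
  have p: "p = m + Suc (p - m - 1)" using assms by simp
  have "(\<Sum>w\<in>words p n. F w) = (\<Sum>L\<in>words m n. \<Sum>i<n. \<Sum>b\<in>words (p - m - 1) n. F (L @ i # b))"
    by (subst p) (simp add: sum_words_append sum_words_Suc del: add_Suc_right)
  also have "\<dots> = (\<Sum>i<n. \<Sum>L\<in>words m n. \<Sum>b\<in>words (p - m - 1) n. F (L @ i # b))"
    by (rule sum.swap)
  also have "\<dots> = (\<Sum>K\<in>words (Suc m) n. \<Sum>b\<in>words (p - m - 1) n. F (tl K @ hd K # b))"
    by (simp add: sum_words_Suc)
  also have "\<dots> = (\<Sum>b\<in>words (p - m - 1) n. \<Sum>K\<in>words (Suc m) n. F (tl K @ hd K # b))"
    by (rule sum.swap)
  finally show ?thesis .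
qed

text \<open>Summing over words with the corner letter moved back to the front turns the left side
  into antisymmetrizer coefficients against \<open>v\<close>, which
  \<open>sum_antisym_laplace\<close> evaluates. Up to \<open>fact m\<close>, \<open>kdiff\<close> is
  thus the adjoint of the Schur map.\<close>

lemma pairing_schur_map:
  assumes v: "v \<in> ob (koszul_term p m) n" and m: "m < p"
  shows "pairing p m n v (schur_map (hook p m) n y) =
    (\<Sum>b\<in>words (p - m - 1) n. \<Sum>J\<in>sorted_words (Suc m) n.
       of_nat (fact m) * kdiff p m v (J @ b) * (y (J # singles b) :: 'k::field))"
proof -
  have alt: "alternating p m v" using v by (simp add: koszul_term_simps)
  have "pairing p m n v (schur_map (hook p m) n y) =
    (\<Sum>w\<in>words p n. v w * ext_tensor p m n y (permute_list (rotp m) w))"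
    unfolding schur_map_hook[OF m] by (rule pairing_sym_proj[OF v]) (use m in simp)
  also have "\<dots> = (\<Sum>b\<in>words (p - m - 1) n. \<Sum>K\<in>words (Suc m) n.
      v (tl K @ hd K # b) * ext_tensor p m n y (permute_list (rotp m) (tl K @ hd K # b)))"
    by (rule sum_rotated_words[OF m])
  also have "\<dots> = (\<Sum>b\<in>words (p - m - 1) n. \<Sum>J\<in>sorted_words (Suc m) n.
       of_nat (fact m) * kdiff p m v (J @ b) * y (J # singles b))"
  proof (rule sum.cong[OF refl])
    fix b assume b: "b \<in> words (p - m - 1) n"
    have "(\<Sum>K\<in>words (Suc m) n. v (tl K @ hd K # b) * ext_tensor p m n y (permute_list (rotp m) (tl K @ hd K # b))) =
      (\<Sum>K\<in>words (Suc m) n. \<Sum>J\<in>sorted_words (Suc m) n.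
         antisym_coeff K J * v (tl K @ hd K # b) * y (J # singles b))"
    proof (rule sum.cong[OF refl])
      fix K assume K: "K \<in> words (Suc m) n"
      then obtain i L where KL: "K = i # L" "length L = m" by (auto simp: words_def length_Suc_conv)
      have "permute_list (rotp m) (tl K @ hd K # b) = K @ b" using rotp_append[OF KL(2)] KL(1) by simp
      then show "v (tl K @ hd K # b) * ext_tensor p m n y (permute_list (rotp m) (tl K @ hd K # b)) =
        (\<Sum>J\<in>sorted_words (Suc m) n. antisym_coeff K J * v (tl K @ hd K # b) * y (J # singles b))"
        using ext_tensor_append[OF K b m, of y] by (simp add: sum_distrib_left ac_simps)
    qed
    also have "\<dots> = (\<Sum>J\<in>sorted_words (Suc m) n. \<Sum>K\<in>words (Suc m) n.
         antisym_coeff K J * v (tl K @ hd K # b) * y (J # singles b))"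
      by (rule sum.swap)
    also have "\<dots> = (\<Sum>J\<in>sorted_words (Suc m) n. of_nat (fact m) * kdiff p m v (J @ b) * y (J # singles b))"
    proof (rule sum.cong[OF refl])
      fix J assume J: "J \<in> sorted_words (Suc m) n"
      then have "(\<Sum>K\<in>words (Suc m) n. antisym_coeff K J * v (tl K @ hd K # b)) = of_nat (fact m) * kdiff p m v (J @ b)"
        by (intro sum_antisym_laplace[OF alt]) (use b m in \<open>auto simp: sorted_words_def words_def\<close>)
      then show "(\<Sum>K\<in>words (Suc m) n. antisym_coeff K J * v (tl K @ hd K # b) * y (J # singles b)) =
         of_nat (fact m) * kdiff p m v (J @ b) * y (J # singles b)"
        by (simp flip: sum_distrib_right)
    qed
    finally show "(\<Sum>K\<in>words (Suc m) n. v (tl K @ hd K # b) * ext_tensor p m n y (permute_list (rotp m) (tl K @ hd K # b))) =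
      (\<Sum>J\<in>sorted_words (Suc m) n. of_nat (fact m) * kdiff p m v (J @ b) * y (J # singles b))" .
  qed
  finally show ?thesis .
qed

lemma pairing_schur_map_unit:
  assumes v: "v \<in> ob (koszul_term p m) n" and m: "m < p"
    and J: "J \<in> sorted_words (Suc m) n" and b: "b \<in> words (p - m - 1) n"
  shows "pairing p m n v (schur_map (hook p m) n (\<lambda>T. if T = J # singles b then 1 else 0)) =
    of_nat (fact m) * (kdiff p m v (J @ b) :: 'k::field)"
proof -
  have inj: "J' # singles b' = J # singles b \<longleftrightarrow> J' = J \<and> b' = b" for J' b'
    by (auto simp: inj_map_eq_map inj_def)
  have "pairing p m n v (schur_map (hook p m) n (\<lambda>T. if T = J # singles b then 1 else 0)) =
    (\<Sum>b'\<in>words (p - m - 1) n. \<Sum>J'\<in>sorted_words (Suc m) n.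
       if b' = b then if J' = J then of_nat (fact m) * kdiff p m v (J' @ b') else 0 else 0)"
    unfolding pairing_schur_map[OF v m] inj by (intro sum.cong) auto
  also have "\<dots> = (\<Sum>b'\<in>words (p - m - 1) n. if b' = b then
      (\<Sum>J'\<in>sorted_words (Suc m) n. if J' = J then of_nat (fact m) * kdiff p m v (J' @ b') else 0) else 0)"
    by (intro sum.cong) auto
  also have "\<dots> = of_nat (fact m) * kdiff p m v (J @ b)" using J b by simp
  finally show ?thesis .
qed

section \<open>Weyl and simple functors of hooks as quotients of Koszul terms\<close>

lemma schur_hook_coef: "m < p \<Longrightarrow> coef (schur (hook p m)) = coef (sym_pow (hook_cols p m))"
  by (simp add: schur_def spf_image_def conj_part_hook)

lemma tensor_pow_coef_in: "coef (tensor_pow p) m n M v \<in> ob (tensor_pow p) n"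
  by (simp add: tensor_pow_ob tensor_pow_coef)

lemma schur_hook_coef_sym_proj:
  assumes m: "m < p"
  shows "coef (schur (hook p m)) n1 n2 N (sym_proj p m n1 (\<lambda>w. z (permute_list (rotp m) w))) =
    sym_proj p m n2 (\<lambda>w. coef (tensor_pow p) n1 n2 N z (permute_list (rotp m) w) :: 'k::field)"
proof -
  have mp: "m \<le> p" using m by simp
  show ?thesis
    unfolding schur_hook_coef[OF m] sym_pow_coef_sym_proj[OF mp] coef_permute[OF rotp_permutes[OF m]] ..
qed

lemma schur_hook_coef_in:
  assumes m: "m < p" and s: "s \<in> ob (schur (hook p m) :: ('k::field, _) spfun) n1"
  shows "coef (schur (hook p m)) n1 n2 N s \<in> ob (schur (hook p m)) n2"
proof -
  obtain z where z: "z \<in> alt_tensors p (Suc m) n1" "s = sym_proj p m n1 (\<lambda>w. z (permute_list (rotp m) w))"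
    using s unfolding schur_hook_ob[OF m] by blast
  have "coef (tensor_pow p) n1 n2 N z \<in> alt_tensors p (Suc m) n2"
    using z(1) coef_alternating[of p "Suc m" z] m tensor_pow_coef_in by (simp add: alt_tensors_def)
  then show ?thesis
    unfolding z(2) schur_hook_coef_sym_proj[OF m] schur_hook_ob[OF m] by blast
qed

lemma schur_map_in: "y \<in> ob (ext_pow lam) n \<Longrightarrow> schur_map lam n y \<in> ob (schur lam) n"
  by (simp add: schur_def spf_image_def)

lemma alt_tensors_subspace: "fvs.subspace (alt_tensors p r n)"
proof (rule fvs.subspaceI)
  note sub = spf_subspace[OF spf_tensor_pow[of p]]
  show "0 \<in> alt_tensors p r n"
    by (simp add: alt_tensors_def alternating_linear fvs.subspace_0[OF sub])
  show "u + v \<in> alt_tensors p r n" if "u \<in> alt_tensors p r n" "v \<in> alt_tensors p r n" for u v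
    using that fvs.subspace_add[OF sub, of u n v] alternating_linear(2)[of p r u v] by (simp add: alt_tensors_def)
  show "fscale c u \<in> alt_tensors p r n" if "u \<in> alt_tensors p r n" for c u
    using that fvs.subspace_scale[OF sub, of u n c] alternating_linear(3)[of p r u c] by (simp add: alt_tensors_def)
qed

lemma schur_hook_subspace:
  assumes m: "m < p"
  shows "fvs.subspace (ob (schur (hook p m) :: ('k::field, nat multiset list) spfun) n)"
proof -
  let ?f = "\<lambda>z. sym_proj p m n (\<lambda>w. z (permute_list (rotp m) w))"
  have lin: "?f 0 = 0" "?f (u + v) = ?f u + ?f v" "?f (fscale c u) = fscale c (?f u)" for c u v
    using sym_proj_linear(1)[of p m n] sym_proj_linear(2,3)[of p m n] by (simp_all add: zero_fun_def)
  show ?thesis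
    unfolding schur_hook_ob[OF m]
  proof (rule fvs.subspaceI)
    note A = alt_tensors_subspace[of p "Suc m" n]
    show "0 \<in> ?f ` alt_tensors p (Suc m) n" using lin(1) fvs.subspace_0[OF A] by (metis imageI)
    show "x + y \<in> ?f ` alt_tensors p (Suc m) n"
      if xy: "x \<in> ?f ` alt_tensors p (Suc m) n" "y \<in> ?f ` alt_tensors p (Suc m) n" for x y
    proof -
      obtain u v where "u \<in> alt_tensors p (Suc m) n" "v \<in> alt_tensors p (Suc m) n" "x = ?f u" "y = ?f v"
        using xy by blast
      then show ?thesis using lin(2)[of u v] fvs.subspace_add[OF A] by (intro image_eqI[of _ _ "u + v"]) simp_all
    qed
    show "fscale c x \<in> ?f ` alt_tensors p (Suc m) n" if x: "x \<in> ?f ` alt_tensors p (Suc m) n" for c x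
    proof -
      obtain u where "u \<in> alt_tensors p (Suc m) n" "x = ?f u" using x by blast
      then show ?thesis using lin(3)[of c u] fvs.subspace_scale[OF A] by (intro image_eqI[of _ _ "fscale c u"]) simp_all
    qed
  qed
qed

lemma weyl_ob: "\<phi> \<in> ob (weyl lam) n \<longleftrightarrow>
    (\<forall>v\<in>ob (schur lam) n. \<forall>w\<in>ob (schur lam) n. \<phi> (v + w) = \<phi> v + \<phi> w) \<and>
    (\<forall>c. \<forall>v\<in>ob (schur lam) n. \<phi> (fscale c v) = c * \<phi> v) \<and>
    (\<forall>v. v \<notin> ob (schur lam) n \<longrightarrow> \<phi> v = 0)"
  by (simp add: weyl_def kuhn_dual_def)

lemma weyl_coef: "coef (weyl lam) m n M \<phi> v =
    (if v \<in> ob (schur lam) n then \<phi> (coef (schur lam) n m (image_mset prod.swap M) v) else 0)"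
  by (simp add: weyl_def kuhn_dual_def)

text \<open>
  The epimorphism onto the Weyl functor is the Kuhn dual of the inclusion of the Schur functor into
  \<open>S\<^bsup>p-m\<^esup> \<otimes> I\<^bsup>\<otimes>m\<^esup>\<close>, restricted to \<open>\<Lambda>\<^sup>m \<otimes> \<Gamma>\<^bsup>p-m\<^esup>\<close>.
\<close>

definition weyl_map :: "nat \<Rightarrow> nat \<Rightarrow> ('k::field, nat list, nat multiset list \<Rightarrow> 'k) spmor" where
  "weyl_map p m n v s =
     (if v \<in> ob (koszul_term p m) n \<and> s \<in> ob (schur (hook p m)) n then pairing p m n v s else 0)"

lemma pairing_linear:
  "pairing p m n v (s + t) = pairing p m n v s + pairing p m n v t"
  "pairing p m n v (fscale c s) = c * pairing p m n v s"
  "pairing p m n (u + v) s = pairing p m n u s + pairing p m n v s"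
  "pairing p m n (fscale c v) s = c * pairing p m n v s"
  by (simp_all add: pairing_def algebra_simps sum.distrib sum_distrib_left)

lemma weyl_map_hom:
  assumes m: "m < p"
  shows "weyl_map p m \<in> spf_hom (koszul_term p m :: ('k::field, nat list) spfun) (weyl (hook p m))"
proof -
  have mp: "m \<le> p" using m by simp
  note subQ = spf_subspace[OF spf_koszul_term[OF mp]]
  note subS = schur_hook_subspace[OF m, where 'k = 'k]
  have lin: "linear_between (ob (koszul_term p m :: ('k, nat list) spfun) n) (ob (weyl (hook p m)) n) (weyl_map p m n)" for n
    unfolding linear_between_def
  proof (intro conjI ballI allI)
    fix v :: "nat list \<Rightarrow> 'k" assume v: "v \<in> ob (koszul_term p m) n"
    show "weyl_map p m n v \<in> ob (weyl (hook p m)) n"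
      unfolding weyl_ob using v fvs.subspace_add[OF subS] fvs.subspace_scale[OF subS]
      by (simp add: weyl_map_def pairing_linear)
    show "weyl_map p m n (fscale c v) = fscale c (weyl_map p m n v)" for c
      using v fvs.subspace_scale[OF subQ v, of c] by (auto simp: weyl_map_def fun_eq_iff pairing_linear)
    fix w :: "nat list \<Rightarrow> 'k" assume w: "w \<in> ob (koszul_term p m) n"
    show "weyl_map p m n (v + w) = weyl_map p m n v + weyl_map p m n w"
      using v w fvs.subspace_add[OF subQ v w] by (simp add: weyl_map_def fun_eq_iff pairing_linear)
  qed
  have nat: "weyl_map p m n2 (coef (koszul_term p m) n1 n2 M v) = coef (weyl (hook p m)) n1 n2 M (weyl_map p m n1 v)"
    if v: "v \<in> ob (koszul_term p m) n1" for n1 n2 M and v :: "nat list \<Rightarrow> 'k"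
  proof
    fix s
    have cv: "coef (koszul_term p m) n1 n2 M v \<in> ob (koszul_term p m) n2"
      by (rule linear_between_in[OF spf_linear_between[OF spf_koszul_term[OF mp]] v])
    show "weyl_map p m n2 (coef (koszul_term p m) n1 n2 M v) s = coef (weyl (hook p m)) n1 n2 M (weyl_map p m n1 v) s"
    proof (cases "s \<in> ob (schur (hook p m)) n2")
      case True
      then obtain z where z: "s = sym_proj p m n2 (\<lambda>w. z (permute_list (rotp m) w))"
        unfolding schur_hook_ob[OF m] by blast
      have "pairing p m n2 (coef (koszul_term p m) n1 n2 M v) s =
        (\<Sum>w\<in>words p n2. coef (tensor_pow p) n1 n2 M v w * z (permute_list (rotp m) w))"
        unfolding z by (subst pairing_sym_proj[OF cv mp]) (simp add: koszul_term_simps)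
      also have "\<dots> = (\<Sum>x\<in>words p n1. v x * coef (tensor_pow p) n2 n1 (image_mset prod.swap M) (\<lambda>w. z (permute_list (rotp m) w)) x)"
        by (rule coef_adjoint)
      also have "\<dots> = pairing p m n1 v (coef (schur (hook p m)) n2 n1 (image_mset prod.swap M) s)"
        unfolding z schur_hook_coef_sym_proj[OF m] pairing_sym_proj[OF v mp] coef_permute[OF rotp_permutes[OF m]] ..
      finally show ?thesis
        using True v cv schur_hook_coef_in[OF m True] by (simp add: weyl_map_def weyl_coef)
    qed (simp add: weyl_map_def weyl_coef)
  qed
  show ?thesis
    unfolding spf_hom_def using lin nat by (simp add: weyl_map_def fun_eq_iff)
qed

lemma kdiff_alt_tensors:
  assumes "v \<in> ob (koszul_term p m) n" "m < p"
  shows "kdiff p m v \<in> alt_tensors p (Suc m) n"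
  using kdiff_in[OF assms] by (simp add: alt_tensors_def koszul_term_simps)

text \<open>The Schur functor is spanned by Schur maps of basis vectors, and pairing with these
  reads off the entries of \<open>kdiff p m v\<close> at increasing words, which determine this
  alternating tensor.\<close>

lemma weyl_map_kernel:
  assumes m: "m < p" "of_nat (fact m) \<noteq> (0 :: 'k::field)"
    and v: "(v :: nat list \<Rightarrow> 'k) \<in> ob (koszul_term p m) n"
  shows "weyl_map p m n v = 0 \<longleftrightarrow> kdiff p m v = 0"
proof
  assume z: "kdiff p m v = 0"
  have "pairing p m n v (schur_map (hook p m) n y) = 0" for y
    unfolding pairing_schur_map[OF v m(1)] z by simp
  then show "weyl_map p m n v = 0"
    by (auto simp: weyl_map_def fun_eq_iff schur_def spf_image_def)
next
  assume z: "weyl_map p m n v = 0"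
  have "kdiff p m v (J @ b) = 0" if J: "J \<in> sorted_words (Suc m) n" and b: "b \<in> words (p - m - 1) n" for J b
  proof -
    let ?y = "\<lambda>T. if T = J # singles b then 1 else 0 :: 'k"
    have "?y \<in> ob (ext_pow (hook p m)) n"
      using J b by (auto simp: ext_pow_def matrix_spfun_def ext_basis_hook)
    then have "schur_map (hook p m) n ?y \<in> ob (schur (hook p m)) n" by (rule schur_map_in)
    then have "pairing p m n v (schur_map (hook p m) n ?y) = 0"
      using fun_cong[OF z, of "schur_map (hook p m) n ?y"] v by (simp add: weyl_map_def)
    then show ?thesis using pairing_schur_map_unit[OF v m(1) J b] m(2) by simp
  qed
  then have "ext_tensor p m n (\<lambda>_. 0) = kdiff p m v"
    by (intro ext_tensor_restrict[OF m(1) kdiff_alt_tensors[OF v m(1)]]) simp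
  moreover have "ext_tensor p m n (\<lambda>_. 0) = (0 :: nat list \<Rightarrow> 'k)" by (simp add: ext_tensor_def fun_eq_iff)
  ultimately show "kdiff p m v = 0" by simp
qed

text \<open>The rotation puts the corner letter first, so the first \<open>m\<close> letters move to
  the places 1 to \<open>m\<close>, inside the alternating range of \<open>z\<close>.\<close>

lemma alternating_rotp:
  assumes z: "alternating p (Suc m) z" and m: "m < p"
  shows "alternating p m (\<lambda>w. z (permute_list (rotp m) w))"
  unfolding alternating_def
proof (intro allI impI)
  fix P R :: "nat list" and x y
  assume "length P + length R + 2 = p \<and> length P + 2 \<le> m"
  then have l: "length P + length R + 2 = p" "length P + 2 \<le> m" by auto
  define R1 where "R1 = take (m - length P - 2) R"
  define R2 where "R2 = drop (m - length P - 2) R"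
  have R: "R = R1 @ R2" by (simp add: R1_def R2_def)
  have lR1: "length P + length R1 + 2 = m" using l m by (simp add: R1_def)
  have "R2 \<noteq> []" using l m lR1 R by auto
  then obtain i c where R2: "R2 = i # c" by (cases R2) auto
  have rot: "permute_list (rotp m) (P @ u # v # R) = (i # P) @ u # v # (R1 @ c)" for u v
    using rotp_append[of "P @ u # v # R1" m i c] lR1 by (simp add: R R2)
  have "length (i # P) + length (R1 @ c) + 2 = p" "length (i # P) + 2 \<le> Suc m" using l R R2 by auto
  note D = alternatingD[OF z this]
  show "z (permute_list (rotp m) (P @ y # x # R)) = - z (permute_list (rotp m) (P @ x # y # R)) \<and>
    z (permute_list (rotp m) (P @ x # x # R)) = 0"
    unfolding rot using D(1)[of y x] D(2)[of x] by simp
qed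

lemma word_type_swap_adj:
  assumes "length w = p" "m \<le> k" "Suc k < p"
  shows "word_type m (swap_adj k w) = word_type m w"
proof -
  have k: "k = length (take k w)" using assms by simp
  have w: "w = take k w @ w ! k # w ! Suc k # drop (Suc (Suc k)) w" using split_adj assms by metis
  then have s: "swap_adj k w = take k w @ w ! Suc k # w ! k # drop (Suc (Suc k)) w"
    using swap_adj_append[OF k] by metis
  have tk: "take m (take k w @ c) = take m w" for c using assms by (simp add: min_def)
  have "mset (swap_adj k w) = mset w"
    using assms by (intro mset_permute_list transpose_permutes) auto
  then have "mset (take m (swap_adj k w)) + mset (drop m (swap_adj k w)) = mset (take m w) + mset (drop m w)"
    by (simp flip: mset_append)
  moreover have "take m (swap_adj k w) = take m w" unfolding s by (rule tk)
  ultimately show ?thesis by (simp add: word_type_def)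
qed

text \<open>A functional on the Schur functor extends to the symmetric powers and gives a tensor
  \<open>v0\<close> that is symmetric in the last letters but need not alternate in the first
  \<open>m\<close>. The tensors behind the Schur functor do alternate there, so antisymmetrizing
  \<open>v0\<close> and dividing by \<open>fact m\<close> does not change its pairing with
  them.\<close>

lemma weyl_map_surj:
  assumes m: "m < p" "of_nat (fact m) \<noteq> (0 :: 'k::field)"
  shows "weyl_map p m n ` ob (koszul_term p m :: ('k, nat list) spfun) n = ob (weyl (hook p m)) n"
proof (intro subset_antisym subsetI)
  fix \<phi> :: "(nat multiset list \<Rightarrow> 'k) \<Rightarrow> 'k"
  assume "\<phi> \<in> weyl_map p m n ` ob (koszul_term p m) n"
  then show "\<phi> \<in> ob (weyl (hook p m)) n" using hom_in[OF weyl_map_hom[OF m(1)]] by blast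
next
  fix \<phi> :: "(nat multiset list \<Rightarrow> 'k) \<Rightarrow> 'k"
  assume \<phi>: "\<phi> \<in> ob (weyl (hook p m)) n"
  have mp: "m \<le> p" using m by simp
  let ?V = "ob (schur (hook p m) :: ('k, nat multiset list) spfun) n"
  let ?X = "sym_basis (hook_cols p m) n"
  have supp: "s \<alpha> = 0" if s: "s \<in> ?V" and \<alpha>: "\<alpha> \<notin> ?X" for s \<alpha>
  proof -
    obtain z where z: "s = sym_proj p m n (\<lambda>w. z (permute_list (rotp m) w))"
      using s unfolding schur_hook_ob[OF m(1)] by blast
    have "{w. w \<in> words p n \<and> word_type m w = \<alpha>} = {}" using \<alpha> unfolding sym_basis_hook[OF mp] by auto
    then show ?thesis unfolding z sym_proj_def by (simp only: sum.empty)
  qed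
  have finX: "finite ?X" unfolding sym_basis_hook[OF mp] by simp
  have "\<exists>\<kappa>. \<forall>s\<in>?V. \<phi> s = (\<Sum>\<alpha>\<in>?X. \<kappa> \<alpha> * s \<alpha>)"
  proof (rule functional_extend[OF schur_hook_subspace[OF m(1)] finX])
    show "s x = 0" if "s \<in> ?V" "x \<notin> ?X" for s x by (rule supp[OF that])
  qed (use \<phi> in \<open>auto simp: weyl_ob\<close>)
  then obtain \<kappa> where \<kappa>: "\<And>s. s \<in> ?V \<Longrightarrow> \<phi> s = (\<Sum>\<alpha>\<in>?X. \<kappa> \<alpha> * s \<alpha>)" by blast
  define v0 where "v0 w = (if w \<in> words p n then \<kappa> (word_type m w) else 0)" for w
  define v where "v = fscale (1 / of_nat (fact m)) (antisymmetrize m v0)"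
  have "symmetric p m v0"
    unfolding symmetric_iff
  proof (intro allI impI)
    fix k and w :: "nat list" assume kw: "length w = p \<and> m \<le> k \<and> Suc k < p"
    then have "swap_adj k w \<in> words p n \<longleftrightarrow> w \<in> words p n"
      by (intro permute_words transpose_permutes) auto
    then show "v0 (swap_adj k w) = v0 w" using word_type_swap_adj[of w p m k] kw by (simp add: v0_def)
  qed
  moreover have "antisymmetrize m v0 \<in> ob (tensor_pow p) n"
    unfolding tensor_pow_ob antisymmetrize_def
  proof (intro allI impI sum.neutral ballI)
    fix w \<sigma> assume "w \<notin> words p n" "\<sigma> \<in> {\<sigma>. \<sigma> permutes {..<m}}"
    then have "permute_list \<sigma> w \<notin> words p n" using permute_words[OF permutes_le[OF _ mp]] by simp
    then show "of_int (sign \<sigma>) * v0 (permute_list \<sigma> w) = 0" by (simp add: v0_def)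
  qed
  ultimately have "antisymmetrize m v0 \<in> ob (koszul_term p m) n"
    by (simp add: koszul_term_simps alternating_antisymmetrize[OF mp] symmetric_antisymmetrize)
  then have v: "v \<in> ob (koszul_term p m) n"
    unfolding v_def by (rule fvs.subspace_scale[OF spf_subspace[OF spf_koszul_term[OF mp]]])
  have "weyl_map p m n v s = \<phi> s" for s
  proof (cases "s \<in> ?V")
    case False
    then show ?thesis using \<phi> by (simp add: weyl_map_def weyl_ob)
  next
    case True
    then obtain z where z: "z \<in> alt_tensors p (Suc m) n" "s = sym_proj p m n (\<lambda>w. z (permute_list (rotp m) w))"
      unfolding schur_hook_ob[OF m(1)] by blast
    define g where "g w = z (permute_list (rotp m) w)" for w
    have g: "alternating p m g"
      unfolding g_def using alternating_rotp[of p m z] m(1) z(1) by (simp add: alt_tensors_def)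
    \<comment> \<open>Moving the permutation from \<open>v0\<close> to \<open>g\<close> costs its
      sign; in the antisymmetrization this sign cancels, and all summands agree.\<close>
    have perm: "(\<Sum>w\<in>words p n. v0 (permute_list \<sigma> w) * g w) = of_int (sign \<sigma>) * (\<Sum>w\<in>words p n. v0 w * g w)"
      if \<sigma>: "\<sigma> permutes {..<m}" for \<sigma>
    proof -
      note \<sigma>p = permutes_le[OF \<sigma> mp]
      have inv: "permute_list (inv_into UNIV \<sigma>) (permute_list \<sigma> w) = w" "permute_list \<sigma> (permute_list (inv_into UNIV \<sigma>) w) = w"
        if "w \<in> words p n" for w
        using permute_list_inverse[of \<sigma> w] \<sigma>p that by (simp_all add: words_def)
      have "(\<Sum>w\<in>words p n. v0 w * (of_int (sign \<sigma>) * g w)) = (\<Sum>w\<in>words p n. v0 (permute_list \<sigma> w) * g w)"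
      proof (rule sum.reindex_bij_witness[of _ "permute_list \<sigma>" "permute_list (inv_into UNIV \<sigma>)"])
        fix w assume w: "w \<in> words p n"
        show "permute_list \<sigma> (permute_list (inv_into UNIV \<sigma>) w) = w" "permute_list (inv_into UNIV \<sigma>) (permute_list \<sigma> w) = w"
          using inv w by simp_all
        show "permute_list (inv_into UNIV \<sigma>) w \<in> words p n" "permute_list \<sigma> w \<in> words p n"
          using w permute_words[OF \<sigma>p] permute_words[OF permutes_inv[OF \<sigma>p]] by simp_all
        have "g w = g (permute_list \<sigma> (permute_list (inv_into UNIV \<sigma>) w))" using inv w by simp
        also have "\<dots> = of_int (sign \<sigma>) * g (permute_list (inv_into UNIV \<sigma>) w)"
          by (rule alternating_permute[OF g mp \<sigma>]) (use w in \<open>simp add: words_def\<close>)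
        finally have "of_int (sign \<sigma>) * g w = g (permute_list (inv_into UNIV \<sigma>) w)"
          by (cases \<sigma> rule: sign_cases) simp_all
        then show "v0 (permute_list \<sigma> (permute_list (inv_into UNIV \<sigma>) w)) * g (permute_list (inv_into UNIV \<sigma>) w) =
            v0 w * (of_int (sign \<sigma>) * g w)" using inv w by simp
      qed
      then show ?thesis by (simp add: sum_distrib_left ac_simps)
    qed
    have "pairing p m n v s = (\<Sum>w\<in>words p n. v w * g w)"
      unfolding z(2) g_def by (rule pairing_sym_proj[OF v mp])
    also have "\<dots> = 1 / of_nat (fact m) * (\<Sum>w\<in>words p n. \<Sum>\<sigma> | \<sigma> permutes {..<m}. of_int (sign \<sigma>) * (v0 (permute_list \<sigma> w) * g w))"
      by (simp add: v_def antisymmetrize_def sum_distrib_left sum_distrib_right ac_simps)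
    also have "(\<Sum>w\<in>words p n. \<Sum>\<sigma> | \<sigma> permutes {..<m}. of_int (sign \<sigma>) * (v0 (permute_list \<sigma> w) * g w)) =
      (\<Sum>\<sigma> | \<sigma> permutes {..<m}. \<Sum>w\<in>words p n. of_int (sign \<sigma>) * (v0 (permute_list \<sigma> w) * g w))"
      by (rule sum.swap)
    also have "\<dots> = (\<Sum>\<sigma> | \<sigma> permutes {..<m}. \<Sum>w\<in>words p n. v0 w * g w)"
    proof (rule sum.cong[OF refl])
      fix \<sigma> assume "\<sigma> \<in> {\<sigma>. \<sigma> permutes {..<m}}"
      then have "(\<Sum>w\<in>words p n. of_int (sign \<sigma>) * (v0 (permute_list \<sigma> w) * g w)) =
        of_int (sign \<sigma>) * (of_int (sign \<sigma>) * (\<Sum>w\<in>words p n. v0 w * g w))"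
        using perm[of \<sigma>] by (simp flip: sum_distrib_left)
      then show "(\<Sum>w\<in>words p n. of_int (sign \<sigma>) * (v0 (permute_list \<sigma> w) * g w)) = (\<Sum>w\<in>words p n. v0 w * g w)"
        by (cases \<sigma> rule: sign_cases) simp_all
    qed
    also have "1 / of_nat (fact m) * \<dots> = (\<Sum>w\<in>words p n. v0 w * g w)"
      using card_permutations[of "{..<m}" m] m(2) by simp
    also have "\<dots> = (\<Sum>w\<in>words p n. \<kappa> (word_type m w) * g w)"
      by (intro sum.cong) (auto simp: v0_def)
    also have "\<dots> = (\<Sum>\<alpha>\<in>?X. \<kappa> \<alpha> * s \<alpha>)"
      unfolding z(2) g_def by (rule sum_word_type[OF mp, symmetric])
    also have "\<dots> = \<phi> s" using \<kappa>[OF True] by simp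
    finally show ?thesis using True v by (simp add: weyl_map_def)
  qed
  then have "weyl_map p m n v = \<phi>" by blast
  then show "\<phi> \<in> weyl_map p m n ` ob (koszul_term p m) n" using v by blast
qed

text \<open>The composite of \<open>weyl_map\<close>, \<open>weyl_to_ext\<close> and
  \<open>schur_map\<close>, by \<open>simple_map_eq\<close>; the scalar is the one of
  \<open>pairing_schur_map\<close>.\<close>

definition simple_map :: "nat \<Rightarrow> nat \<Rightarrow> ('k::field, nat list, nat multiset list) spmor" where
  "simple_map p m n v = (if v \<in> ob (koszul_term p m) n
     then sym_proj p m n (\<lambda>w. of_nat (fact m) * kdiff p m v (permute_list (rotp m) w)) else 0)"

lemma simple_map_eq:
  assumes m: "m < p" and v: "(v :: nat list \<Rightarrow> 'k::field) \<in> ob (koszul_term p m) n"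
  shows "schur_map (hook p m) n (weyl_to_ext (hook p m) n (weyl_map p m n v)) = simple_map p m n v"
proof -
  let ?y = "weyl_to_ext (hook p m) n (weyl_map p m n v)"
  have kd: "fscale (of_nat (fact m)) (kdiff p m v) \<in> alt_tensors p (Suc m) n"
    by (rule fvs.subspace_scale[OF alt_tensors_subspace kdiff_alt_tensors[OF v m]])
  have "ext_tensor p m n ?y = fscale (of_nat (fact m)) (kdiff p m v)"
  proof (rule ext_tensor_restrict[OF m kd])
    fix J b assume J: "J \<in> sorted_words (Suc m) n" and b: "b \<in> words (p - m - 1) n"
    let ?\<delta> = "\<lambda>T. if T = J # singles b then 1 else 0 :: 'k"
    have "J # singles b \<in> ext_basis (hook p m) n" using J b by (auto simp: ext_basis_hook)
    moreover from this have "?\<delta> \<in> ob (ext_pow (hook p m)) n" by (auto simp: ext_pow_def matrix_spfun_def)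
    ultimately show "?y (J # singles b) = fscale (of_nat (fact m)) (kdiff p m v) (J @ b)"
      using schur_map_in[of ?\<delta> "hook p m" n] pairing_schur_map_unit[OF v m J b] v
      by (simp add: weyl_to_ext_def weyl_map_def)
  qed
  then show ?thesis using v by (simp add: schur_map_hook[OF m] simple_map_def)
qed

lemma simple_functor_ob:
  assumes m: "m < p" "of_nat (fact m) \<noteq> (0 :: 'k::field)"
  shows "ob (simple_functor (hook p m)) n = simple_map p m n ` ob (koszul_term p m :: ('k, nat list) spfun) n"
proof -
  have "(ob (simple_functor (hook p m)) n :: (nat multiset list \<Rightarrow> 'k) set) = (\<lambda>\<phi>. schur_map (hook p m) n (weyl_to_ext (hook p m) n \<phi>)) ` ob (weyl (hook p m)) n"
    by (simp add: simple_functor_def spf_image_def)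
  also have "\<dots> = (\<lambda>v. schur_map (hook p m) n (weyl_to_ext (hook p m) n (weyl_map p m n v))) ` ob (koszul_term p m) n"
    unfolding weyl_map_surj[OF m, symmetric] by (rule image_image)
  also have "\<dots> = simple_map p m n ` ob (koszul_term p m) n"
    using simple_map_eq[OF m(1)] by (intro image_cong) auto
  finally show ?thesis .
qed

lemma simple_map_hom:
  assumes m: "m < p" "of_nat (fact m) \<noteq> (0 :: 'k::field)"
  shows "simple_map p m \<in> spf_hom (koszul_term p m :: ('k, nat list) spfun) (simple_functor (hook p m))"
proof -
  have mp: "m \<le> p" using m by simp
  note subQ = spf_subspace[OF spf_koszul_term[OF mp]]
  have lin: "linear_between (ob (koszul_term p m :: ('k, nat list) spfun) n) (ob (simple_functor (hook p m)) n) (simple_map p m n)" for n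
    unfolding linear_between_def
  proof (intro conjI ballI allI)
    fix v :: "nat list \<Rightarrow> 'k" assume v: "v \<in> ob (koszul_term p m) n"
    show "simple_map p m n v \<in> ob (simple_functor (hook p m)) n" using v simple_functor_ob[OF m] by blast
    show "simple_map p m n (fscale c v) = fscale c (simple_map p m n v)" for c
      using v fvs.subspace_scale[OF subQ v, of c]
      by (simp add: simple_map_def kdiff_linear mult.left_commute[of _ c] flip: sym_proj_linear(3))
    fix w :: "nat list \<Rightarrow> 'k" assume w: "w \<in> ob (koszul_term p m) n"
    show "simple_map p m n (v + w) = simple_map p m n v + simple_map p m n w"
      using v w fvs.subspace_add[OF subQ v w]
      by (simp add: simple_map_def kdiff_linear distrib_left flip: sym_proj_linear(2))
  qed
  have nat: "simple_map p m n2 (coef (koszul_term p m) n1 n2 M v) = coef (simple_functor (hook p m)) n1 n2 M (simple_map p m n1 v)"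
    if v: "v \<in> ob (koszul_term p m) n1" for n1 n2 M and v :: "nat list \<Rightarrow> 'k"
  proof -
    have cv: "coef (koszul_term p m) n1 n2 M v \<in> ob (koszul_term p m) n2"
      by (rule linear_between_in[OF spf_linear_between[OF spf_koszul_term[OF mp]] v])
    let ?z = "\<lambda>w. of_nat (fact m) * kdiff p m v w"
    have "coef (simple_functor (hook p m)) n1 n2 M (simple_map p m n1 v) =
      coef (schur (hook p m)) n1 n2 M (sym_proj p m n1 (\<lambda>w. ?z (permute_list (rotp m) w)))"
      using v by (simp add: simple_map_def simple_functor_def spf_image_def)
    also have "\<dots> = sym_proj p m n2 (\<lambda>w. coef (tensor_pow p) n1 n2 M ?z (permute_list (rotp m) w))"
      by (rule schur_hook_coef_sym_proj[OF m(1)])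
    also have "\<dots> = sym_proj p m n2 (\<lambda>w. of_nat (fact m) * coef (tensor_pow p) n1 n2 M (kdiff p m v) (permute_list (rotp m) w))"
      using coef_linear(1)[of p n1 n2 M "\<lambda>_. of_nat (fact m)" "\<lambda>_. kdiff p m v" "{()}"] by simp
    also have "\<dots> = simple_map p m n2 (coef (koszul_term p m) n1 n2 M v)"
      using cv by (simp add: simple_map_def koszul_term_simps(2) coef_kdiff[OF m(1)])
    finally show ?thesis by simp
  qed
  show ?thesis
    unfolding spf_hom_def using lin nat by (simp add: simple_map_def)
qed

lemma spf_simple_hook:
  assumes m: "m < p" "of_nat (fact m) \<noteq> (0 :: 'k::field)"
  shows "spf p (simple_functor (hook p m) :: ('k, nat multiset list) spfun)"
proof (rule spf_surj)
  show "spf p (koszul_term p m :: ('k, nat list) spfun)" using m by (intro spf_koszul_term) simp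
qed (use simple_functor_ob[OF m] hom_linear_between[OF simple_map_hom[OF m]] hom_coef[OF simple_map_hom[OF m]] in blast)+

section \<open>Morphisms into the simple functors\<close>

lemma zip_map_self: "zip xs (map f xs) = map (\<lambda>x. (x, f x)) xs"
  by (induction xs) auto

text \<open>The coefficient of this monomial projects to the weight of \<open>std_word\<close> and
  renames the letters by \<open>\<tau>\<close>. For \<open>\<tau> = id\<close> it is the weight
  projection; for a transposition it detects the sign under an exchange of letters.\<close>

lemma coef_letter_map:
  assumes j: "j \<le> p" and \<tau>: "\<And>l. l < Suc j \<Longrightarrow> \<tau> l < Suc j"
  shows "coef (tensor_pow p) (Suc j) (Suc j) (mset (zip (std_word p j) (map \<tau> (std_word p j)))) v w =
    (if w \<in> words p (Suc j) \<and> mset w = mset (std_word p j) then v (map \<tau> w) else (0 :: 'k::field))"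
proof (cases "w \<in> words p (Suc j)")
  case w: True
  let ?s = "std_word p j"
  have iff: "mset (zip w x) = mset (zip ?s (map \<tau> ?s)) \<longleftrightarrow> mset w = mset ?s \<and> x = map \<tau> w"
    if x: "x \<in> words p (Suc j)" for x
  proof
    assume eq: "mset (zip w x) = mset (zip ?s (map \<tau> ?s))"
    have len: "length w = length x" using w x by (simp add: words_def)
    have "mset (map fst (zip w x)) = mset (map fst (zip ?s (map \<tau> ?s)))"
      unfolding mset_map eq ..
    then have "mset w = mset ?s" using len by simp
    moreover have "x = map \<tau> w"
    proof (rule nth_equalityI)
      fix l assume l: "l < length x"
      then have "(w ! l, x ! l) \<in> set (zip w x)" using len by (auto simp: in_set_conv_nth)
      then have "(w ! l, x ! l) \<in> set (zip ?s (map \<tau> ?s))" using mset_eq_setD[OF eq] by blast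
      then show "x ! l = map \<tau> w ! l" using l len unfolding zip_map_self by auto
    qed (use len in simp)
    ultimately show "mset w = mset ?s \<and> x = map \<tau> w" ..
  next
    assume "mset w = mset ?s \<and> x = map \<tau> w"
    then show "mset (zip w x) = mset (zip ?s (map \<tau> ?s))" by (simp add: zip_map_self)
  qed
  have mw: "map \<tau> w \<in> words p (Suc j)" using w \<tau> by (auto simp: words_def)
  have "coef (tensor_pow p) (Suc j) (Suc j) (mset (zip ?s (map \<tau> ?s))) v w =
    (\<Sum>x\<in>words p (Suc j). if x = map \<tau> w then if mset w = mset ?s then v (map \<tau> w) else 0 else 0)"
    using w iff by (auto simp: tensor_pow_coef_sum intro!: sum.cong)
  then show ?thesis using w mw by simp
qed (simp add: tensor_pow_coef)

text \<open>A light letter \<open>i\<close> stands in \<open>std_word\<close> at place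
  \<open>i\<close> and nowhere else, so renaming letters and permuting places agree.\<close>

lemma map_transpose_std_word:
  assumes "i < j" "i' < j" "j \<le> p"
  shows "map (transpose i i') (std_word p j) = permute_list (transpose i i') (std_word p j)"
proof (rule nth_equalityI)
  fix l assume l: "l < length (map (transpose i i') (std_word p j))"
  have \<tau>: "transpose i i' permutes {..<length (std_word p j)}"
    using assms by (intro transpose_permutes) auto
  show "map (transpose i i') (std_word p j) ! l = permute_list (transpose i i') (std_word p j) ! l"
    using l assms by (auto simp: permute_list_nth[OF \<tau>] std_word_nth transpose_def)
qed simp

lemma generator_weight:
  assumes j: "j \<le> p" and ne: "mset w \<noteq> mset (std_word p j)"
  shows "generator p j w = 0"
  unfolding generator_def antisymmetrize_def
proof (intro sum.neutral ballI)
  fix \<sigma> assume "\<sigma> \<in> {\<sigma>. \<sigma> permutes {..<j}}"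
  then have \<sigma>: "\<sigma> permutes {..<p}" using permutes_le j by blast
  have "permute_list \<sigma> w \<noteq> std_word p j"
  proof
    assume eq: "permute_list \<sigma> w = std_word p j"
    have "length (permute_list \<sigma> w) = length (std_word p j)" unfolding eq ..
    then have "length w = p" unfolding length_permute_list length_std_word[OF j] .
    then have "mset (permute_list \<sigma> w) = mset w" using \<sigma> by simp
    then show False using eq ne by simp
  qed
  then show "of_int (sign \<sigma>) * (if permute_list \<sigma> w = std_word p j then 1 else 0) = 0" by simp
qed

text \<open>Renaming letters commutes with place permutations and on \<open>std_word\<close> is one
  itself; so it composes each \<open>\<sigma>\<close> with the transposition and flips its
  sign.\<close>

lemma generator_map:
  assumes i: "i < j" "i' < j" "i \<noteq> i'" and j: "j \<le> p" and w: "length w = p"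
  shows "generator p j (map (transpose i i') w) = - (generator p j w :: 'k::field)"
proof -
  let ?\<tau> = "transpose i i'" and ?s = "std_word p j"
  have \<tau>: "?\<tau> permutes {..<j}" "?\<tau> permutes {..<p}" using i j by (auto intro!: transpose_permutes)
  have sg: "sign (\<sigma> \<circ> ?\<tau>) = - sign \<sigma>" if "\<sigma> permutes {..<j}" for \<sigma>
    using permutes_imp_permutation[OF finite_lessThan that] permutation_swap_id[of i i'] i
    by (simp add: sign_compose sign_swap_id)
  have iff: "permute_list \<sigma> (map ?\<tau> w) = ?s \<longleftrightarrow> permute_list (\<sigma> \<circ> ?\<tau>) w = ?s" if \<sigma>: "\<sigma> permutes {..<j}" for \<sigma>
  proof -
    have "permute_list \<sigma> (map ?\<tau> w) = map ?\<tau> (permute_list \<sigma> w)"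
      by (rule permute_list_map) (use permutes_le[OF \<sigma> j] w in simp)
    also have "\<dots> = ?s \<longleftrightarrow> permute_list \<sigma> w = map ?\<tau> ?s"
    proof -
      have "map ?\<tau> (map ?\<tau> x) = x" for x by (induction x) auto
      then show ?thesis by metis
    qed
    also have "\<dots> \<longleftrightarrow> permute_list \<sigma> w = permute_list ?\<tau> ?s"
      by (simp only: map_transpose_std_word[OF i(1,2) j])
    also have "\<dots> \<longleftrightarrow> permute_list ?\<tau> (permute_list \<sigma> w) = ?s"
    proof -
      have "permute_list ?\<tau> (permute_list ?\<tau> x) = x" if "length x = p" for x :: "nat list"
        using permute_list_compose[of ?\<tau> x ?\<tau>] \<tau>(2) that by simp
      then have "permute_list ?\<tau> (permute_list ?\<tau> (permute_list \<sigma> w)) = permute_list \<sigma> w"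
        "permute_list ?\<tau> (permute_list ?\<tau> ?s) = ?s" using w j by simp_all
      then show ?thesis by metis
    qed
    also have "permute_list ?\<tau> (permute_list \<sigma> w) = permute_list (\<sigma> \<circ> ?\<tau>) w"
      by (rule permute_list_compose[symmetric]) (use \<tau>(2) w in simp)
    finally show ?thesis .
  qed
  have "generator p j (map ?\<tau> w) = (\<Sum>\<sigma> | \<sigma> permutes {..<j}. - (of_int (sign (\<sigma> \<circ> ?\<tau>)) *
      (if permute_list (\<sigma> \<circ> ?\<tau>) w = ?s then 1 else 0)) :: 'k)"
    unfolding generator_def antisymmetrize_def
  proof (rule sum.cong[OF refl])
    fix \<sigma> assume "\<sigma> \<in> {\<sigma>. \<sigma> permutes {..<j}}"
    then have \<sigma>: "\<sigma> permutes {..<j}" by simp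
    show "of_int (sign \<sigma>) * (if permute_list \<sigma> (map ?\<tau> w) = ?s then 1 else 0) =
      - (of_int (sign (\<sigma> \<circ> ?\<tau>)) * (if permute_list (\<sigma> \<circ> ?\<tau>) w = ?s then 1 else 0) :: 'k)"
      unfolding iff[OF \<sigma>] sg[OF \<sigma>] by simp
  qed
  also have "\<dots> = - (\<Sum>\<sigma> | \<sigma> permutes {..<j}. of_int (sign (\<sigma> \<circ> ?\<tau>)) *
      (if permute_list (\<sigma> \<circ> ?\<tau>) w = ?s then 1 else 0))"
    by (rule sum_negf)
  also have "(\<Sum>\<sigma> | \<sigma> permutes {..<j}. of_int (sign (\<sigma> \<circ> ?\<tau>)) *
      (if permute_list (\<sigma> \<circ> ?\<tau>) w = ?s then 1 else 0)) = (generator p j w :: 'k)"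
    unfolding generator_def antisymmetrize_def
    by (rule sum_permutations_compose_right[OF \<tau>(1), symmetric,
          where f = "\<lambda>\<sigma>. of_int (sign \<sigma>) * (if permute_list \<sigma> w = ?s then 1 else 0)"])
  finally show ?thesis .
qed

lemma generator_std_word:
  assumes j: "j \<le> p"
  shows "generator p j (std_word p j) = 1"
proof -
  have "permute_list \<sigma> (std_word p j) = std_word p j \<longleftrightarrow> \<sigma> = id" if \<sigma>: "\<sigma> permutes {..<j}" for \<sigma>
  proof
    assume eq: "permute_list \<sigma> (std_word p j) = std_word p j"
    have "\<sigma> l = l" for l
    proof (cases "l < j")
      case True
      then have "\<sigma> l < j" using permutes_in_image[OF \<sigma>, of l] by simp
      then have "permute_list \<sigma> (std_word p j) ! l = \<sigma> l"
        using permute_list_nth[of \<sigma> "std_word p j" l] permutes_le[OF \<sigma> j] True j by (simp add: std_word_nth)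
      then show ?thesis using eq True j by (simp add: std_word_nth)
    next
      case False
      then show ?thesis using permutes_not_in[OF \<sigma>, of l] by simp
    qed
    then show "\<sigma> = id" by auto
  qed simp
  then have "generator p j (std_word p j) = (\<Sum>\<sigma> | \<sigma> permutes {..<j}. if \<sigma> = id then 1 else 0)"
    unfolding generator_def antisymmetrize_def by (intro sum.cong) auto
  also have "\<dots> = 1" using permutes_id[of "{..<j}"] by (simp add: finite_permutations)
  finally show ?thesis .
qed

text \<open>A permutation of the first \<open>j\<close> places leaves the heavy letter among them,
  where \<open>std_word\<close> has only light ones.\<close>

lemma generator_heavy_head:
  assumes j: "0 < j" "j \<le> p" and w: "length w = p" "w ! 0 = j"
  shows "generator p j w = 0"
  unfolding generator_def antisymmetrize_def
proof (intro sum.neutral ballI)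
  fix \<sigma> assume "\<sigma> \<in> {\<sigma>. \<sigma> permutes {..<j}}"
  then have \<sigma>: "\<sigma> permutes {..<j}" by simp
  obtain l where l: "\<sigma> l = 0" using permutes_surj[OF \<sigma>] by (metis surjD)
  have "l < j" using permutes_in_image[OF \<sigma>, of l] l j by simp
  then have "permute_list \<sigma> w ! l = j" "std_word p j ! l = l"
    using permute_list_nth[of \<sigma> w l] permutes_le[OF \<sigma> j(2)] w j l by (simp_all add: std_word_nth)
  then have "permute_list \<sigma> w \<noteq> std_word p j" using \<open>l < j\<close> by auto
  then show "of_int (sign \<sigma>) * (if permute_list \<sigma> w = std_word p j then 1 else 0) = 0" by simp
qed

text \<open>
  The weight and the sign of the generator, which every morphism out of \<open>\<Lambda>\<^sup>j \<otimes> \<Gamma>\<^bsup>p-j\<^esup>\<close> preserves.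
\<close>

definition std_weight :: "nat \<Rightarrow> nat \<Rightarrow> (nat list \<Rightarrow> 'k::field) \<Rightarrow> bool" where
  "std_weight p j v \<longleftrightarrow> (\<forall>w. mset w \<noteq> mset (std_word p j) \<longrightarrow> v w = 0)"

definition letter_sign :: "nat \<Rightarrow> nat \<Rightarrow> (nat list \<Rightarrow> 'k::field) \<Rightarrow> bool" where
  "letter_sign p j v \<longleftrightarrow> (\<forall>i i' w. i < j \<and> i' < j \<and> i \<noteq> i' \<and> length w = p \<longrightarrow>
     v (map (transpose i i') w) = - v w)"

text \<open>By \<open>coef_letter_map\<close> both properties of the generator say how certain
  coefficients of the functor act on it, and morphisms commute with coefficients.\<close>

lemma hom_generator:
  assumes j: "j \<le> p" and n: "n \<le> p" and h: "h \<in> spf_hom (koszul_term p j) (koszul_term p n :: ('k::field, nat list) spfun)"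
  shows "std_weight p j (h (Suc j) (generator p j))" "letter_sign p j (h (Suc j) (generator p j))"
proof -
  let ?g = "generator p j :: nat list \<Rightarrow> 'k" and ?s = "std_word p j"
  let ?\<xi> = "h (Suc j) ?g"
  have g: "?g \<in> ob (koszul_term p j) (Suc j)" by (rule generator_in[OF j])
  have \<xi>: "?\<xi> \<in> ob (koszul_term p n) (Suc j)" by (rule hom_in[OF h g])
  have nat: "h (Suc j) (coef (tensor_pow p) (Suc j) (Suc j) M ?g) = coef (tensor_pow p) (Suc j) (Suc j) M ?\<xi>" for M
    using hom_coef[OF h g, of "Suc j" M] by (simp add: koszul_term_simps(2))
  have out: "w \<notin> words p (Suc j) \<Longrightarrow> ?g w = 0" "w \<notin> words p (Suc j) \<Longrightarrow> ?\<xi> w = 0" for w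
    using g \<xi> by (auto simp: koszul_term_simps tensor_pow_ob)
  have std: "w \<in> words p (Suc j)" if "mset w = mset ?s" for w
    using words_mset[OF that] std_word_in[OF j] by blast
  have "coef (tensor_pow p) (Suc j) (Suc j) (mset (zip ?s (map id ?s))) ?g = ?g"
  proof
    fix w show "coef (tensor_pow p) (Suc j) (Suc j) (mset (zip ?s (map id ?s))) ?g w = ?g w"
      using coef_letter_map[OF j, of id ?g w] out[of w] generator_weight[OF j, of w, where 'a = 'k] by auto
  qed
  from nat[of "mset (zip ?s (map id ?s))", unfolded this]
  have \<xi>id: "?\<xi> = coef (tensor_pow p) (Suc j) (Suc j) (mset (zip ?s (map id ?s))) ?\<xi>" .
  then have wt: "?\<xi> w = (if w \<in> words p (Suc j) \<and> mset w = mset ?s then ?\<xi> w else 0)" for w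
  proof -
    have "coef (tensor_pow p) (Suc j) (Suc j) (mset (zip ?s (map id ?s))) ?\<xi> w =
      (if w \<in> words p (Suc j) \<and> mset w = mset ?s then ?\<xi> (map id w) else 0)"
      by (rule coef_letter_map[OF j]) simp
    from trans[OF fun_cong[OF \<xi>id] this] show ?thesis by (simp only: list.map_id)
  qed
  show weight: "std_weight p j ?\<xi>" unfolding std_weight_def by (intro allI impI, rule trans[OF wt]) simp
  show "letter_sign p j ?\<xi>"
    unfolding letter_sign_def
  proof (intro allI impI)
    fix i i' and w :: "nat list"
    assume a: "i < j \<and> i' < j \<and> i \<noteq> i' \<and> length w = p"
    let ?\<tau> = "transpose i i'"
    have \<tau>: "?\<tau> l < Suc j" if "l < Suc j" for l using that a by (auto simp: transpose_def)
    have "coef (tensor_pow p) (Suc j) (Suc j) (mset (zip ?s (map ?\<tau> ?s))) ?g = fscale (-1) ?g"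
    proof
      fix w show "coef (tensor_pow p) (Suc j) (Suc j) (mset (zip ?s (map ?\<tau> ?s))) ?g w = fscale (-1) ?g w"
        using coef_letter_map[OF j, of ?\<tau> ?g w, OF \<tau>] out[of w] generator_weight[OF j, of w, where 'a = 'k]
          generator_map[of i j i' p w, where 'k = 'k] a j by (auto simp: words_def)
    qed
    from nat[of "mset (zip ?s (map ?\<tau> ?s))", unfolded this linear_between_scale[OF hom_linear_between[OF h] g]]
    have \<xi>\<tau>: "fscale (-1) ?\<xi> = coef (tensor_pow p) (Suc j) (Suc j) (mset (zip ?s (map ?\<tau> ?s))) ?\<xi>" .
    then have eq: "- ?\<xi> w = (if w \<in> words p (Suc j) \<and> mset w = mset ?s then ?\<xi> (map ?\<tau> w) else 0)"
    proof -
      have "coef (tensor_pow p) (Suc j) (Suc j) (mset (zip ?s (map ?\<tau> ?s))) ?\<xi> w =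
        (if w \<in> words p (Suc j) \<and> mset w = mset ?s then ?\<xi> (map ?\<tau> w) else 0)"
        by (rule coef_letter_map[OF j]) (rule \<tau>)
      from trans[OF fun_cong[OF \<xi>\<tau>] this] show ?thesis by (simp only: fscale_apply mult_minus1)
    qed
    show "?\<xi> (map ?\<tau> w) = - ?\<xi> w"
    proof (cases "mset w = mset ?s")
      case True
      then show ?thesis using eq std[OF True] by simp
    next
      case False
      have "mset (map ?\<tau> w) \<noteq> mset ?s"
      proof
        assume "mset (map ?\<tau> w) = mset ?s"
        then have "image_mset ?\<tau> (mset (map ?\<tau> w)) = image_mset ?\<tau> (mset ?s)" by simp
        moreover have "image_mset ?\<tau> (mset (map ?\<tau> w)) = mset w" by (simp add: multiset.map_comp o_def)
        moreover have "image_mset ?\<tau> (mset ?s) = mset ?s"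
        proof -
          have "mset (map ?\<tau> ?s) = mset ?s"
            unfolding map_transpose_std_word[OF conjunct1[OF a] conjunct1[OF conjunct2[OF a]] j]
            using a j by (intro mset_permute_list transpose_permutes) auto
          then show ?thesis by simp
        qed
        ultimately show False using False by simp
      qed
      then show ?thesis using weight False by (simp add: std_weight_def)
    qed
  qed
qed

lemma kdiff_std_weight:
  assumes "std_weight p j v" "n < p"
  shows "std_weight p j (kdiff p n v)"
  unfolding std_weight_def
proof (intro allI impI)
  fix w assume w: "mset w \<noteq> mset (std_word p j)"
  have "v (permute_list (cyc n t) w) = 0" if "t \<le> n" "length w = p" for t
  proof -
    have "mset (permute_list (cyc n t) w) = mset w" using cyc_permutes[OF that(1) assms(2)] that(2) by simp
    then show ?thesis using assms(1) w by (simp add: std_weight_def)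
  qed
  then show "kdiff p n v w = 0" by (simp add: kdiff_def)
qed

lemma kdiff_letter_sign:
  assumes "letter_sign p j v" "n < p"
  shows "letter_sign p j (kdiff p n v)"
  unfolding letter_sign_def
proof (intro allI impI)
  fix i i' and w :: "nat list"
  assume a: "i < j \<and> i' < j \<and> i \<noteq> i' \<and> length w = p"
  have "v (permute_list (cyc n t) (map (transpose i i') w)) = - v (permute_list (cyc n t) w)" if "t \<le> n" for t
  proof -
    have "permute_list (cyc n t) (map (transpose i i') w) = map (transpose i i') (permute_list (cyc n t) w)"
      by (rule permute_list_map) (use cyc_permutes[OF that assms(2)] a in simp)
    then show ?thesis using assms(1) a by (simp add: letter_sign_def)
  qed
  then show "kdiff p n v (map (transpose i i') w) = - kdiff p n v w" using a by (simp add: kdiff_def sum_negf)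
qed

text \<open>For \<open>j\<close> at least 2 the number 2 divides \<open>fact j\<close>, so
  invertibility of the factorial excludes characteristic 2. This allows sign arguments to end with
  division by 2.\<close>

lemma two_nonzero:
  assumes "of_nat (fact j) \<noteq> (0 :: 'k::field)" "2 \<le> j"
  shows "(2 :: 'k) \<noteq> 0"
proof
  assume z: "(2 :: 'k) = 0"
  have "2 dvd (fact j :: nat)" using assms(2) by (intro dvd_fact) auto
  then obtain k where "(fact j :: nat) = 2 * k" by blast
  then have "of_nat (fact j) = (2 :: 'k) * of_nat k" by (metis of_nat_mult of_nat_numeral)
  then show False using z assms(1) by simp
qed

lemma missing_letters:
  assumes "length L + 2 \<le> j"
  obtains i i' where "i < j" "i' < j" "i \<noteq> i'" "i \<notin> set L" "i' \<notin> set L"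
proof -
  let ?A = "{..<j} - set L"
  have "card ?A \<ge> j - length L"
    using diff_card_le_card_Diff[of "set L" "{..<j}"] card_length[of L] by simp
  then have "\<not> card ?A \<le> Suc 0" using assms by simp
  then obtain i i' where "i \<in> ?A" "i' \<in> ?A" "i \<noteq> i'" using card_le_Suc0_iff_eq[of ?A] by auto
  then show thesis using that by auto
qed

text \<open>Each of the two letters occurs once in \<open>w\<close>. If neither is in the head, both
  are in the tail, and exchanging them only rearranges it.\<close>

lemma map_transpose_tail:
  assumes j: "j \<le> p" and i: "i < j" "i' < j" "i \<notin> set (take n w)" "i' \<notin> set (take n w)"
    and w: "mset w = mset (std_word p j)"
  shows "map (transpose i i') (take n w) = take n w"
    "image_mset (transpose i i') (mset (drop n w)) = mset (drop n w)"
proof -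
  let ?\<tau> = "transpose i i'"
  show tk: "map ?\<tau> (take n w) = take n w"
    by (rule map_idI) (use i in \<open>auto simp: transpose_def\<close>)
  have "mset (map ?\<tau> (std_word p j)) = mset (std_word p j)"
    unfolding map_transpose_std_word[OF i(1,2) j]
    using i j by (intro mset_permute_list transpose_permutes) auto
  then have "image_mset ?\<tau> (mset (take n w @ drop n w)) = mset (take n w @ drop n w)" using w by simp
  then have "mset (map ?\<tau> (take n w)) + image_mset ?\<tau> (mset (drop n w)) = mset (take n w) + mset (drop n w)"
    by (simp only: mset_append image_mset_union mset_map)
  then show "image_mset ?\<tau> (mset (drop n w)) = mset (drop n w)" unfolding tk by simp
qed

text \<open>At least two light letters lie outside the first \<open>n\<close> places. Exchanging
  them negates the value by \<open>letter_sign\<close> and preserves it by symmetry.\<close>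

lemma weight_vector_zero:
  fixes \<xi> :: "nat list \<Rightarrow> 'k::field"
  assumes \<xi>: "\<xi> \<in> ob (koszul_term p n) (Suc j)" "std_weight p j \<xi>" "letter_sign p j \<xi>"
    and nj: "n + 2 \<le> j" "j \<le> p" and two: "(2 :: 'k) \<noteq> 0"
  shows "\<xi> = 0"
proof
  fix w
  show "\<xi> w = 0 w"
  proof (cases "mset w = mset (std_word p j)")
    case True
    have lw: "length w = p" using mset_eq_length[OF True] nj by simp
    have "length (take n w) + 2 \<le> j" using nj lw by simp
    then obtain i i' where i: "i < j" "i' < j" "i \<noteq> i'" "i \<notin> set (take n w)" "i' \<notin> set (take n w)"
      by (rule missing_letters)
    note tail = map_transpose_tail[OF nj(2) i(1,2,4,5) True]
    have "map (transpose i i') w = map (transpose i i') (take n w) @ map (transpose i i') (drop n w)"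
      by (simp flip: map_append)
    then have "\<xi> (map (transpose i i') w) = \<xi> (take n w @ map (transpose i i') (drop n w))"
      using tail(1) by simp
    also have "\<dots> = \<xi> (take n w @ drop n w)"
      by (rule symmetric_mset[of p n]) (use \<xi>(1) nj lw tail(2) in \<open>auto simp: koszul_term_simps\<close>)
    finally have "\<xi> (map (transpose i i') w) = \<xi> w" by simp
    moreover have "\<xi> (map (transpose i i') w) = - \<xi> w" using \<xi>(3) i lw by (simp add: letter_sign_def)
    ultimately have "2 * \<xi> w = 0" by simp
    then show ?thesis using two by simp
  next
    case False
    then show ?thesis using \<xi>(2) by (simp add: std_weight_def)
  qed
qed

text \<open>Pigeonhole: there are fewer letters than alternating places. It will dispose of
  \<open>j < n\<close>, where \<open>kdiff\<close> alternates in \<open>n + 1\<close> places but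
  only \<open>j + 1\<close> letters are available.\<close>

lemma alt_tensors_zero:
  assumes z: "z \<in> alt_tensors p r n" and r: "n < r" "r \<le> p"
  shows "z = 0"
proof
  fix w
  show "z w = 0 w"
  proof (cases "w \<in> words p n")
    case True
    have "\<not> distinct (take r w)"
    proof
      assume "distinct (take r w)"
      then have "card (set (take r w)) = r" using True r by (simp add: distinct_card words_def)
      moreover have "set (take r w) \<subseteq> {..<n}" using True by (auto simp: words_def dest: in_set_takeD)
      ultimately show False using card_mono[of "{..<n}" "set (take r w)"] r by simp
    qed
    then show ?thesis
      using alternating_repeat[of p r z w] z r True by (simp add: alt_tensors_def words_def)
  next
    case False
    then show ?thesis using z by (simp add: alt_tensors_def tensor_pow_ob)
  qed
qed

text \<open>With as many letters as alternating places, the first \<open>j + 1\<close> letters of a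
  relevant word are a permutation of all letters, and the weight forces the rest to be heavy. So one
  value decides, taken at the word that \<open>rotp\<close> makes out of
  \<open>std_word\<close>.\<close>

lemma alt_tensors_top_zero:
  assumes z: "z \<in> alt_tensors p (Suc j) (Suc j)" "std_weight p j z" and j: "j < p"
    and z0: "z ((j # [0..<j]) @ replicate (p - j - 1) j) = 0"
  shows "z = 0"
proof
  fix w
  show "z w = 0 w"
  proof (cases "w \<in> words p (Suc j) \<and> mset w = mset (std_word p j) \<and> distinct (take (Suc j) w)")
    case True
    let ?K = "take (Suc j) w" and ?b = "drop (Suc j) w" and ?J = "j # [0..<j]"
    have lw: "length w = p" using True by (simp add: words_def)
    have "set ?K \<subseteq> {..<Suc j}" using True by (auto simp: words_def dest: in_set_takeD)
    moreover have "card (set ?K) = Suc j" using True lw j by (simp add: distinct_card)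
    ultimately have "set ?K = {..<Suc j}" by (intro card_subset_eq) auto
    moreover have "set ?J = {..<Suc j}" by auto
    ultimately have mK: "mset ?K = mset ?J"
      using True by (intro set_eq_iff_mset_eq_distinct[THEN iffD1]) auto
    have "mset ?K + mset ?b = mset w" by (simp flip: mset_append)
    also have "\<dots> = mset ?J + replicate_mset (p - j - 1) j"
    proof -
      have "replicate_mset (p - j) j = add_mset j (replicate_mset (p - j - 1) j)"
        using j by (simp add: Suc_diff_Suc flip: replicate_mset_Suc)
      then show ?thesis using True by (simp add: std_word_def)
    qed
    finally have "mset ?b = replicate_mset (p - j - 1) j" unfolding mK by simp
    then have b: "?b = replicate (p - j - 1) j"
      by (intro replicate_eqI)
        (use mset_eq_length[of ?b "replicate (p - j - 1) j"] mset_eq_setD[of ?b "replicate (p - j - 1) j"]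
         in \<open>auto split: if_splits\<close>)
    obtain \<sigma> where \<sigma>: "\<sigma> permutes {..<length ?J}" "permute_list \<sigma> ?J = ?K"
      using mset_eq_permutation[OF mK] .
    have "w = ?K @ ?b" by simp
    also have "\<dots> = permute_list \<sigma> (?J @ ?b)" using permute_list_append[OF \<sigma>(1)] \<sigma>(2) by metis
    finally have "z w = z (permute_list \<sigma> (?J @ ?b))" by metis
    also have "\<dots> = of_int (sign \<sigma>) * z (?J @ ?b)"
      by (rule alternating_permute[of p "Suc j"]) (use z j \<sigma> lw in \<open>auto simp: alt_tensors_def\<close>)
    finally show ?thesis unfolding b z0 by simp
  next
    case False
    then show ?thesis
      using z alternating_repeat[of p "Suc j" z w] j
      by (auto simp: alt_tensors_def tensor_pow_ob std_weight_def words_def)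
  qed
qed

text \<open>Only the summand that extracts the leading heavy letter survives, by
  \<open>generator_heavy_head\<close>.\<close>

lemma kdiff_generator:
  assumes j: "j < p"
  shows "kdiff p j (generator p j) ((j # [0..<j]) @ replicate (p - j - 1) j) = 1"
proof -
  let ?J = "j # [0..<j]" and ?b = "replicate (p - j - 1) j"
  have jb: "j # ?b = replicate (p - j) j" using j by (simp flip: replicate_Suc)
  have "kdiff p j (generator p j) (?J @ ?b) = (\<Sum>t\<le>j. (-1) ^ t * generator p j (take t ?J @ drop (Suc t) ?J @ ?J ! t # ?b))"
    by (rule kdiff_append) (use j in auto)
  also have "\<dots> = generator p j ([0..<j] @ j # ?b) +
      (\<Sum>t<j. (-1) ^ Suc t * generator p j (take (Suc t) ?J @ drop (Suc (Suc t)) ?J @ ?J ! Suc t # ?b))"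
    by (subst sum.atMost_shift) simp
  also have "(\<Sum>t<j. (-1) ^ Suc t * generator p j (take (Suc t) ?J @ drop (Suc (Suc t)) ?J @ ?J ! Suc t # ?b)) = 0"
  proof (intro sum.neutral ballI)
    fix t assume t: "t \<in> {..<j}"
    have "generator p j (take (Suc t) ?J @ drop (Suc (Suc t)) ?J @ ?J ! Suc t # ?b) = 0"
      by (rule generator_heavy_head) (use t j in \<open>auto simp: min_def\<close>)
    then show "(-1) ^ Suc t * generator p j (take (Suc t) ?J @ drop (Suc (Suc t)) ?J @ ?J ! Suc t # ?b) = 0" by simp
  qed
  also have "[0..<j] @ j # ?b = std_word p j" unfolding jb std_word_def ..
  finally show ?thesis by (simp add: generator_std_word[OF less_imp_le[OF j]])
qed

lemma sym_proj_word_type: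
  assumes w: "w \<in> words p n" and m: "m \<le> p"
  shows "sym_proj p m n g (word_type m w) = (\<Sum>c | mset c = mset (drop m w). g (take m w @ c))"
  unfolding sym_proj_def word_type_fibre[OF w m] by (subst sum.reindex) (auto simp: inj_on_def)

text \<open>At the type of \<open>std_word\<close> the fibre is a single word, since the tail is
  constant; its rotation is the word of \<open>kdiff_generator\<close>, so the value is
  \<open>fact j\<close>.\<close>

lemma simple_map_generator_nonzero:
  assumes j: "j < p" "of_nat (fact j) \<noteq> (0 :: 'k::field)"
  shows "simple_map p j (Suc j) (generator p j) \<noteq> (0 :: nat multiset list \<Rightarrow> 'k)"
proof -
  let ?s = "std_word p j" and ?g = "generator p j :: nat list \<Rightarrow> 'k"
  have jp: "j \<le> p" using j by simp
  have d: "take j ?s = [0..<j]" "drop j ?s = replicate (p - j) j" by (simp_all add: std_word_def)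
  have only: "{c. mset c = mset (replicate (p - j) j)} = {replicate (p - j) j}"
  proof (intro subset_antisym subsetI)
    fix c assume "c \<in> {c. mset c = mset (replicate (p - j) j)}"
    then have c: "mset c = mset (replicate (p - j) j)" by simp
    have "c = replicate (p - j) j"
      by (rule replicate_eqI) (use mset_eq_length[OF c] mset_eq_setD[OF c] in \<open>auto split: if_splits\<close>)
    then show "c \<in> {replicate (p - j) j}" by simp
  qed simp
  have jb: "replicate (p - j) j = j # replicate (p - j - 1) j" using j by (simp flip: replicate_Suc)
  have rot: "permute_list (rotp j) ([0..<j] @ j # replicate (p - j - 1) j) = (j # [0..<j]) @ replicate (p - j - 1) j"
    using rotp_append[of "[0..<j]" j j "replicate (p - j - 1) j"] by simp
  have "simple_map p j (Suc j) ?g (word_type j ?s) =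
    of_nat (fact j) * kdiff p j ?g (permute_list (rotp j) ([0..<j] @ replicate (p - j) j))"
    using generator_in[OF jp, where 'k = 'k] sym_proj_word_type[OF std_word_in[OF jp] jp, where 'a = 'k]
    unfolding d only by (simp add: simple_map_def d only)
  also have "\<dots> = of_nat (fact j)" unfolding jb rot kdiff_generator[OF j(1)] by simp
  finally show ?thesis using j(2) by (metis zero_fun_apply)
qed

text \<open>
  In degree \<open>j = n + 1\<close> the weight vector \<open>\<xi>\<close> is, up to a scalar, the image of the generator under
  the de Rham differential. The two kinds of entries of its Koszul differential differ by the
  factor \<open>j\<close>, so that its image in the simple functor is a multiple of \<open>j + (p - j) = p\<close>.
\<close>

lemma kdiff_ratio:
  fixes \<xi> :: "nat list \<Rightarrow> 'k::field"
  assumes \<xi>: "\<xi> \<in> ob (koszul_term p n) (Suc (Suc n))" "letter_sign p (Suc n) \<xi>"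
    and n: "Suc n < p" and L: "length L = n" "distinct L" "set L \<subseteq> {..<Suc n}"
    and i: "i < Suc n" "i \<notin> set L"
  shows "kdiff p n \<xi> ((i # L) @ replicate (p - Suc n) (Suc n)) =
    of_nat (Suc n) * kdiff p n \<xi> ((Suc n # L) @ i # replicate (p - Suc n - 1) (Suc n))"
proof -
  let ?j = "Suc n" and ?b = "replicate (p - Suc n - 1) (Suc n)"
  let ?J = "?j # i # L" and ?z = "kdiff p n \<xi>"
  have sym: "symmetric p n \<xi>" using \<xi>(1) by (simp add: koszul_term_simps)
  have "?z \<in> alt_tensors p ?j (Suc ?j)" using kdiff_alt_tensors[OF \<xi>(1)] n by simp
  then have alt: "alternating p ?j ?z" by (simp add: alt_tensors_def)
  have sgn: "letter_sign p ?j ?z" using kdiff_letter_sign[OF \<xi>(2)] n by simp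
  have jb: "?j # ?b = replicate (p - ?j) ?j" using n by (simp flip: replicate_Suc)
  let ?Z = "?z ((?j # L) @ i # ?b)"
  \<comment> \<open>Exchanging \<open>L ! r\<close> with \<open>i\<close> costs a sign by
    \<open>letter_sign\<close>; moving \<open>L ! r\<close> back to its place in \<open>L\<close>
    costs \<open>(-1) ^ r\<close>. So each letter of \<open>L\<close> contributes to the relation
    below just as \<open>i\<close> does.\<close>
  have tail: "?z (?j # i # take r L @ drop (Suc r) L @ L ! r # ?b) = - ((-1) ^ r * ?Z)" if r: "r < n" for r
  proof -
    let ?x = "L ! r"
    have "?x \<in> set L" using r L(1) by simp
    then have x: "?x \<in> set L" "?x < ?j" using L(3) by auto
    have xi: "?x \<noteq> i" using x i by auto
    have sp: "L = take r L @ ?x # drop (Suc r) L" using id_take_nth_drop[of r L] r L by simp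
    have dis: "distinct (take r L @ ?x # drop (Suc r) L)" using L(2) sp by simp
    have fix1: "map (transpose i ?x) (take r L) = take r L" "map (transpose i ?x) (drop (Suc r) L) = drop (Suc r) L"
      using dis i by (auto intro!: map_idI simp: transpose_def dest: in_set_takeD in_set_dropD)
    have fix2: "map (transpose i ?x) ?b = ?b" "transpose i ?x ?j = ?j"
      using i x by (auto simp: transpose_def)
    have "?z (map (transpose i ?x) (?j # ?x # take r L @ drop (Suc r) L @ i # ?b)) =
       - ?z (?j # ?x # take r L @ drop (Suc r) L @ i # ?b)"
      by (rule sgn[unfolded letter_sign_def, rule_format]) (use i x xi L r n in auto)
    also have "map (transpose i ?x) (?j # ?x # take r L @ drop (Suc r) L @ i # ?b) =
        ?j # i # take r L @ drop (Suc r) L @ ?x # ?b"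
      using fix1 fix2 by simp
    also have "?z (?j # ?x # take r L @ drop (Suc r) L @ i # ?b) =
        ?z ([?j] @ ?x # take r L @ (drop (Suc r) L @ i # ?b))" by simp
    also have "\<dots> = (-1) ^ length (take r L) * ?z ([?j] @ take r L @ ?x # (drop (Suc r) L @ i # ?b))"
      by (rule alternating_move[OF alt]) (use r L n in auto)
    also have "[?j] @ take r L @ ?x # (drop (Suc r) L @ i # ?b) = (?j # L) @ i # ?b"
    proof -
      have "(take r L @ ?x # drop (Suc r) L) @ i # ?b = L @ i # ?b" by (simp only: sp[symmetric])
      then show ?thesis by simp
    qed
    finally show ?thesis using r L by simp
  qed
  \<comment> \<open>The relation comes from applying \<open>kdiff\<close> twice and evaluating at
    the word with the heavy letter, \<open>i\<close> and \<open>L\<close> in the exterior part: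
    extracting the heavy letter gives one kind of entry, extracting \<open>i\<close> or one of the
    \<open>n\<close> letters of \<open>L\<close> gives \<open>-?Z\<close> each.\<close>
  have "0 = kdiff p ?j ?z (?J @ ?b)" using kdiff_kdiff[OF sym n] by simp
  also have "\<dots> = (\<Sum>t\<le>?j. (-1) ^ t * ?z (take t ?J @ drop (Suc t) ?J @ ?J ! t # ?b))"
    by (rule kdiff_append) (use L n in auto)
  also have "\<dots> = ?z (i # L @ ?j # ?b) + (\<Sum>t\<le>n. (-1) ^ Suc t * ?z (take (Suc t) ?J @ drop (Suc (Suc t)) ?J @ ?J ! Suc t # ?b))"
    by (subst sum.atMost_Suc_shift) simp
  also have "(\<Sum>t\<le>n. (-1) ^ Suc t * ?z (take (Suc t) ?J @ drop (Suc (Suc t)) ?J @ ?J ! Suc t # ?b)) =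
      - ?Z + (\<Sum>r<n. (-1) ^ r * ?z (?j # i # take r L @ drop (Suc r) L @ L ! r # ?b))"
    by (subst sum.atMost_shift) simp
  also have "(\<Sum>r<n. (-1) ^ r * ?z (?j # i # take r L @ drop (Suc r) L @ L ! r # ?b)) = (\<Sum>r<n. - ?Z)"
  proof (rule sum.cong[OF refl])
    fix r assume "r \<in> {..<n}"
    then have r: "r < n" by simp
    have "(-1) ^ r * - ((-1) ^ r * ?Z) = - ?Z" by (simp flip: mult.assoc power_add)
    then show "(-1) ^ r * ?z (?j # i # take r L @ drop (Suc r) L @ L ! r # ?b) = - ?Z"
      unfolding tail[OF r] .
  qed
  finally have "?z (i # L @ ?j # ?b) = ?Z + of_nat n * ?Z" by (simp add: algebra_simps)
  then show ?thesis unfolding jb by (simp add: algebra_simps)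
qed

lemma mset_one_light:
  assumes "mset c = add_mset i (replicate_mset k j)"
  shows "\<exists>s\<le>k. c = replicate s j @ i # replicate (k - s) j"
proof -
  have "i \<in> set c" using arg_cong[OF assms, of set_mset] by simp
  then obtain A B where c: "c = A @ i # B" by (auto dest: split_list)
  then have AB: "mset (A @ B) = replicate_mset k j" using assms by simp
  have l: "length A + length B = k" using arg_cong[OF AB, of size] by simp
  have "set (A @ B) \<subseteq> {j}" using arg_cong[OF AB, of set_mset] by (auto split: if_splits)
  then have "A = replicate (length A) j" "B = replicate (length B) j"
    by (auto intro!: replicate_eqI)
  then show ?thesis using c l by (intro exI[of _ "length A"]) auto
qed

lemma sum_one_light:
  assumes ij: "i \<noteq> j"
  shows "(\<Sum>c | mset c = add_mset i (replicate_mset k j). F c) = (\<Sum>s\<le>k. F (replicate s j @ i # replicate (k - s) j))"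
proof -
  let ?f = "\<lambda>s. replicate s j @ i # replicate (k - s) j"
  have "{c. mset c = add_mset i (replicate_mset k j)} = ?f ` {..k}"
  proof (intro subset_antisym subsetI)
    fix c assume "c \<in> {c. mset c = add_mset i (replicate_mset k j)}"
    then show "c \<in> ?f ` {..k}" using mset_one_light[of c i k j] by auto
  next
    fix c assume "c \<in> ?f ` {..k}"
    then obtain s where s: "s \<le> k" "c = ?f s" by auto
    have "replicate_mset k j = replicate_mset s j + replicate_mset (k - s) j"
      using s(1) by (simp add: multiset_eq_iff)
    then show "c \<in> {c. mset c = add_mset i (replicate_mset k j)}" using s(2) by simp
  qed
  moreover have "inj_on ?f {..k}"
  proof (rule inj_onI)
    fix s t assume eq: "?f s = ?f t"
    have "length (takeWhile (\<lambda>x. x = j) (?f u)) = u" for u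
      using ij by (simp add: takeWhile_append)
    then show "s = t" using eq by metis
  qed
  ultimately show ?thesis by (simp add: sum.reindex)
qed

text \<open>The entry at the type of \<open>L @ a\<close> sums \<open>?z\<close> over all orders of
  the column \<open>a\<close>, whose first letter is the corner. It vanishes termwise for a wrong
  weight or a repeated letter in the arm \<open>L\<close>. If the heavy letter is in
  \<open>L\<close>, two light letters are in the column, and exchanging them negates the sum.
  Otherwise a single light letter \<open>i\<close> is in the column: as the corner it gives
  \<open>Suc n\<close> times \<open>?Z\<close> by \<open>kdiff_ratio\<close>, and in each of the
  \<open>p - Suc n\<close> lower places it gives \<open>?Z\<close>.\<close>

lemma simple_map_next_zero:
  fixes \<xi> :: "nat list \<Rightarrow> 'k::field"
  assumes \<xi>: "\<xi> \<in> ob (koszul_term p n) (Suc (Suc n))" "std_weight p (Suc n) \<xi>" "letter_sign p (Suc n) \<xi>"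
    and n: "Suc n < p" and p0: "of_nat p = (0 :: 'k)" and fac: "of_nat (fact (Suc n)) \<noteq> (0 :: 'k)"
  shows "simple_map p n (Suc (Suc n)) \<xi> = 0"
proof
  fix \<alpha>
  let ?j = "Suc n" and ?z = "kdiff p n \<xi>"
  have np: "n \<le> p" "n < p" "?j \<le> p" using n by auto
  have zin: "?z \<in> alt_tensors p ?j (Suc ?j)" using kdiff_alt_tensors[OF \<xi>(1) np(2)] .
  then have alt: "alternating p ?j ?z" by (simp add: alt_tensors_def)
  have sym: "symmetric p ?j ?z"
    using kdiff_symmetric[of p n \<xi>] \<xi>(1) np by (simp add: koszul_term_simps)
  have wt: "std_weight p ?j ?z" by (rule kdiff_std_weight[OF \<xi>(2) np(2)])
  have sgn: "letter_sign p ?j ?z" by (rule kdiff_letter_sign[OF \<xi>(3) np(2)])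
  show "simple_map p n (Suc ?j) \<xi> \<alpha> = 0 \<alpha>"
  proof (cases "\<exists>w\<in>words p (Suc ?j). \<alpha> = word_type n w")
    case False
    then have "{w. w \<in> words p (Suc ?j) \<and> word_type n w = \<alpha>} = {}" by auto
    then have "sym_proj p n (Suc ?j) (\<lambda>w. of_nat (fact n) * ?z (permute_list (rotp n) w)) \<alpha> = 0"
      unfolding sym_proj_def by (simp only: sum.empty)
    then show ?thesis using \<xi>(1) by (simp add: simple_map_def)
  next
    case True
    then obtain w where w: "w \<in> words p (Suc ?j)" "\<alpha> = word_type n w" by blast
    define L a where "L = take n w" and "a = drop n w"
    let ?C = "{c. mset c = mset a}"
    have lw: "length w = p" and lL: "length L = n" using w np by (simp_all add: L_def words_def)
    have wLa: "w = L @ a" by (simp add: L_def a_def)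
    have setL: "set L \<subseteq> {..<Suc ?j}" using w by (auto simp: L_def words_def dest: in_set_takeD)
    have lc: "length c = p - n" if "c \<in> ?C" for c
      using that mset_eq_length[of c a] lw by (simp add: a_def)
    have rot: "permute_list (rotp n) (L @ c) = (hd c # L) @ tl c" if "c \<in> ?C" for c
    proof -
      have "c \<noteq> []" using lc[OF that] np by auto
      then show ?thesis using rotp_append[OF lL, of "hd c" "tl c"] by simp
    qed
    have rotp': "rotp n permutes {..<p}" by (rule rotp_permutes[OF np(2)])
    have "(\<Sum>c\<in>?C. ?z (permute_list (rotp n) (L @ c))) = 0"
    proof (cases "mset w = mset (std_word p ?j) \<and> distinct L")
      case False
      have "?z (permute_list (rotp n) (L @ c)) = 0" if c: "c \<in> ?C" for c
      proof (cases "distinct L")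
        case True
        have "mset (permute_list (rotp n) (L @ c)) = mset (L @ c)"
          using lc[OF c] lL np rotp' by (intro mset_permute_list) simp
        also have "\<dots> = mset w" unfolding wLa using c by simp
        finally show ?thesis using True False wt by (simp add: std_weight_def)
      next
        case False
        then have "\<not> distinct (take ?j ((hd c # L) @ tl c))" using lL by simp
        then show ?thesis
          unfolding rot[OF c] by (intro alternating_repeat[OF alt]) (use lc[OF c] lL np in auto)
      qed
      then show ?thesis by simp
    next
      case True
      then have std: "mset w = mset (std_word p ?j)" and dL: "distinct L" by auto
      show ?thesis
      proof (cases "?j \<in> set L")
        case False
        then have sub: "set L \<subseteq> {..<?j}" using setL by (auto simp: less_Suc_eq)
        have "card (set L) = n" using dL lL by (simp add: distinct_card)
        then have "card ({..<?j} - set L) = 1" using sub by (simp add: card_Diff_subset)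
        then obtain i where i: "{..<?j} - set L = {i}" by (auto simp: card_1_singleton_iff)
        have "i \<in> {..<?j} - set L" unfolding i by simp
        then have ij: "i < ?j" "i \<notin> set L" by simp_all
        have "set (i # L) = ({..<?j} - set L) \<union> set L" unfolding i by simp
        also have "\<dots> = set [0..<?j]" using sub by (simp only: Un_Diff_cancel2 Un_absorb2 set_upt atLeast0LessThan)
        finally have s: "set (i # L) = set [0..<?j]" .
        have "distinct (i # L)" using dL ij by simp
        then have "mset (i # L) = mset [0..<?j]"
          using set_eq_iff_mset_eq_distinct[OF _ distinct_upt] s by blast
        moreover have "mset L + mset a = mset [0..<?j] + replicate_mset (p - ?j) ?j"
          using std unfolding wLa by (simp add: std_word_def)
        ultimately have "mset L + mset a = mset L + add_mset i (replicate_mset (p - ?j) ?j)" by simp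
        then have ma: "mset a = add_mset i (replicate_mset (p - ?j) ?j)" by simp
        let ?k = "p - ?j"
        let ?Z = "?z ((?j # L) @ i # replicate (?k - 1) ?j)"
        have "(\<Sum>c\<in>?C. ?z (permute_list (rotp n) (L @ c))) = (\<Sum>c\<in>?C. ?z ((hd c # L) @ tl c))"
          using rot by (intro sum.cong) auto
        also have "\<dots> = (\<Sum>s\<le>?k. (\<lambda>c. ?z ((hd c # L) @ tl c)) (replicate s ?j @ i # replicate (?k - s) ?j))"
          unfolding ma by (rule sum_one_light) (use ij in simp)
        also have "\<dots> = ?z ((i # L) @ replicate ?k ?j) +
            (\<Sum>s<?k. ?z ((?j # L) @ (replicate s ?j @ i # replicate (?k - Suc s) ?j)))"
          by (subst sum.atMost_shift) simp
        also have "(\<Sum>s<?k. ?z ((?j # L) @ (replicate s ?j @ i # replicate (?k - Suc s) ?j))) = (\<Sum>s<?k. ?Z)"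
        proof (rule sum.cong[OF refl])
          fix s assume "s \<in> {..<?k}"
          then have s: "s < ?k" by simp
          then have "replicate_mset (?k - 1) ?j = replicate_mset s ?j + replicate_mset (?k - Suc s) ?j"
            by (simp add: multiset_eq_iff)
          then show "?z ((?j # L) @ (replicate s ?j @ i # replicate (?k - Suc s) ?j)) = ?Z"
            by (intro symmetric_mset[OF sym]) (use lL s np in auto)
        qed
        also have "\<dots> = of_nat ?k * ?Z" by simp
        also have "?z ((i # L) @ replicate ?k ?j) = of_nat ?j * ?Z"
          by (rule kdiff_ratio[OF \<xi>(1,3) n lL dL sub ij])
        also have "of_nat ?j * ?Z + of_nat ?k * ?Z = of_nat (?j + ?k) * ?Z"
          by (simp only: of_nat_add distrib_right)
        also have "?j + ?k = p" using np by simp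
        finally show ?thesis using p0 by simp
      next
        case True
        \<comment> \<open>Without the heavy letter the arm has \<open>n - 1\<close> letters, so two
          of the \<open>n + 1\<close> light ones are missing from it.\<close>
        have "length (remove1 ?j L) + 2 \<le> ?j" using Suc_length_remove1[OF True] lL by simp
        then obtain i i' where ii: "i < ?j" "i' < ?j" "i \<noteq> i'" "i \<notin> set (remove1 ?j L)" "i' \<notin> set (remove1 ?j L)"
          by (rule missing_letters)
        have nL: "i \<notin> set (take n w)" "i' \<notin> set (take n w)"
          using ii dL by (auto simp: L_def set_remove1_eq)
        let ?\<tau> = "transpose i i'"
        note tail = map_transpose_tail[OF np(3) ii(1,2) nL std]
        have L\<tau>: "map ?\<tau> L = L" using tail(1) by (simp add: L_def)
        have inv: "map ?\<tau> (map ?\<tau> c) = c" for c by (induction c) auto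
        let ?S = "\<Sum>c\<in>?C. ?z (permute_list (rotp n) (L @ c))"
        have "?S = (\<Sum>c\<in>?C. - ?z (permute_list (rotp n) (L @ c)))"
        proof (rule sum.reindex_bij_witness[of _ "map ?\<tau>" "map ?\<tau>"])
          fix c assume c: "c \<in> ?C"
          show "map ?\<tau> (map ?\<tau> c) = c" "map ?\<tau> (map ?\<tau> c) = c" by (rule inv)+
          show "map ?\<tau> c \<in> ?C" "map ?\<tau> c \<in> ?C" using c tail(2) by (simp_all add: a_def)
          have "permute_list (rotp n) (L @ map ?\<tau> c) = permute_list (rotp n) (map ?\<tau> (L @ c))"
            using L\<tau> by simp
          also have "\<dots> = map ?\<tau> (permute_list (rotp n) (L @ c))"
            by (rule permute_list_map) (use rotp' lc[OF c] lL np in simp)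
          finally have "?z (permute_list (rotp n) (L @ map ?\<tau> c)) = - ?z (permute_list (rotp n) (L @ c))"
            using sgn ii lc[OF c] lL np unfolding letter_sign_def by simp
          then show "- ?z (permute_list (rotp n) (L @ map ?\<tau> c)) = ?z (permute_list (rotp n) (L @ c))" by simp
        qed
        also have "\<dots> = - ?S" by (rule sum_negf)
        finally have "2 * ?S = 0" by simp
        moreover have "(2 :: 'k) \<noteq> 0" by (rule two_nonzero[OF fac]) (use ii in linarith)
        ultimately show ?thesis by (metis mult_eq_0_iff)
      qed
    qed
    then have "sym_proj p n (Suc ?j) (\<lambda>w. of_nat (fact n) * ?z (permute_list (rotp n) w)) \<alpha> = 0"
      unfolding w(2) sym_proj_word_type[OF w(1) np(1)] L_def[symmetric] a_def[symmetric]
      by (simp flip: sum_distrib_left)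
    then show ?thesis using \<xi>(1) by (simp add: simple_map_def)
  qed
qed

section \<open>Morphisms from Koszul terms to simple functors\<close>

lemma simple_map_kdiff_zero: "kdiff p n \<xi> = 0 \<Longrightarrow> simple_map p n m \<xi> = 0"
  by (auto simp: simple_map_def sym_proj_def fun_eq_iff)

lemma hom_simple_lift:
  assumes j: "j < p" "of_nat (fact j) \<noteq> (0 :: 'k::field)" and n: "n < p" "of_nat (fact n) \<noteq> (0 :: 'k)"
    and f: "f \<in> spf_hom (koszul_term p j) (simple_functor (hook p n) :: ('k, nat multiset list) spfun)"
  obtains \<xi> where "\<xi> \<in> ob (koszul_term p n) (Suc j)" "std_weight p j \<xi>" "letter_sign p j \<xi>"
    "f (Suc j) (generator p j) = simple_map p n (Suc j) \<xi>"
proof -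
  have jn: "j \<le> p" "n \<le> p" using j n by auto
  have "\<exists>h\<in>spf_hom (koszul_term p j) (koszul_term p n :: ('k, nat list) spfun).
      \<forall>m. \<forall>v\<in>ob (koszul_term p j) m. simple_map p n m (h m v) = f m v"
    by (rule koszul_term_lift[OF jn(1) j(2) spf_koszul_term[OF jn(2)] spf_simple_hook[OF n] simple_map_hom[OF n] _ f])
      (rule simple_functor_ob[OF n, symmetric])
  then obtain h where h: "h \<in> spf_hom (koszul_term p j) (koszul_term p n :: ('k, nat list) spfun)"
    "\<forall>m. \<forall>v\<in>ob (koszul_term p j) m. simple_map p n m (h m v) = f m v"
    by blast
  let ?\<xi> = "h (Suc j) (generator p j)"
  show thesis
  proof (rule that[of ?\<xi>])
    show "?\<xi> \<in> ob (koszul_term p n) (Suc j)" by (rule hom_in[OF h(1) generator_in[OF jn(1)]])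
    show "std_weight p j ?\<xi>" by (rule hom_generator(1)[OF jn h(1)])
    show "letter_sign p j ?\<xi>" by (rule hom_generator(2)[OF jn h(1)])
    show "f (Suc j) (generator p j) = simple_map p n (Suc j) ?\<xi>"
      using bspec[OF spec[OF h(2)] generator_in[OF jn(1)]] by (rule sym)
  qed
qed

lemma hom_simple_zero:
  assumes j: "j < p" "of_nat (fact j) \<noteq> (0 :: 'k::field)" and n: "n < p" "of_nat (fact n) \<noteq> (0 :: 'k)"
    and p0: "of_nat p = (0 :: 'k)" and ne: "j \<noteq> n"
  shows "spf_hom (koszul_term p j) (simple_functor (hook p n) :: ('k, nat multiset list) spfun) = {0}"
proof -
  have jn: "j \<le> p" "n \<le> p" using j n by auto
  note spfT = spf_simple_hook[OF n]
  have "f = 0" if f: "f \<in> spf_hom (koszul_term p j) (simple_functor (hook p n) :: ('k, nat multiset list) spfun)" for f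
  proof -
    obtain \<xi> where \<xi>: "\<xi> \<in> ob (koszul_term p n) (Suc j)" "std_weight p j \<xi>" "letter_sign p j \<xi>"
      "f (Suc j) (generator p j) = simple_map p n (Suc j) \<xi>"
      by (rule hom_simple_lift[OF j n f])
    consider "j < n" | "j = Suc n" | "n + 2 \<le> j" using ne by linarith
    then have "simple_map p n (Suc j) \<xi> = 0"
    proof cases
      case 1
      then have "kdiff p n \<xi> = 0"
        by (intro alt_tensors_zero[OF kdiff_alt_tensors[OF \<xi>(1) n(1)]]) (use n in auto)
      then show ?thesis by (rule simple_map_kdiff_zero)
    next
      case 2
      then show ?thesis using simple_map_next_zero[of \<xi> p n] \<xi> j p0 by simp
    next
      case 3
      have "(2 :: 'k) \<noteq> 0" by (rule two_nonzero[OF j(2)]) (use 3 in simp)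
      then have "\<xi> = 0" by (intro weight_vector_zero[OF \<xi>(1-3) 3 jn(1)])
      then show ?thesis by (simp add: simple_map_kdiff_zero kdiff_linear)
    qed
    then show ?thesis
      using koszul_term_hom_eqI[OF jn(1) j(2) f zero_hom[OF spfT]] \<xi>(4) by simp
  qed
  then show ?thesis using zero_hom[OF spfT] by blast
qed

lemma hom_simple_line:
  assumes j: "j < p" "of_nat (fact j) \<noteq> (0 :: 'k::field)"
    and f: "f \<in> spf_hom (koszul_term p j) (simple_functor (hook p j) :: ('k, nat multiset list) spfun)"
  shows "\<exists>t. f = hom_scale t (simple_map p j)"
proof -
  have jp: "j \<le> p" using j by simp
  obtain \<xi> where \<xi>: "\<xi> \<in> ob (koszul_term p j) (Suc j)" "std_weight p j \<xi>" "letter_sign p j \<xi>"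
    "f (Suc j) (generator p j) = simple_map p j (Suc j) \<xi>"
    by (rule hom_simple_lift[OF j j f])
  let ?w = "(j # [0..<j]) @ replicate (p - j - 1) j" and ?g = "generator p j :: nat list \<Rightarrow> 'k"
  \<comment> \<open>The multiple of the generator for which \<open>kdiff\<close> of the difference
    vanishes at the one word that decides, by \<open>kdiff_generator\<close> and
    \<open>alt_tensors_top_zero\<close>.\<close>
  define t where "t = kdiff p j \<xi> ?w"
  let ?d = "\<xi> - fscale t ?g"
  note sub = spf_subspace[OF spf_koszul_term[OF jp]]
  have g: "?g \<in> ob (koszul_term p j) (Suc j)" by (rule generator_in[OF jp])
  have tg: "fscale t ?g \<in> ob (koszul_term p j) (Suc j)" by (rule fvs.subspace_scale[OF sub g])
  have d: "?d \<in> ob (koszul_term p j) (Suc j)" by (rule fvs.subspace_diff[OF sub \<xi>(1) tg])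
  have "kdiff p j \<xi> = kdiff p j (?d + fscale t ?g)" by simp
  also have "\<dots> = kdiff p j ?d + fscale t (kdiff p j ?g)" by (simp only: kdiff_linear)
  finally have kd: "kdiff p j \<xi> = kdiff p j ?d + fscale t (kdiff p j ?g)" .
  have "kdiff p j ?d = 0"
  proof (rule alt_tensors_top_zero[OF kdiff_alt_tensors[OF d j(1)] _ j(1)])
    have "std_weight p j ?d"
      using \<xi>(2) generator_weight[OF jp, where 'a = 'k] by (simp add: std_weight_def)
    then show "std_weight p j (kdiff p j ?d)" by (rule kdiff_std_weight[OF _ j(1)])
    show "kdiff p j ?d ?w = 0"
      using fun_cong[OF kd, of ?w] kdiff_generator[OF j(1), where 'a = 'k] by (simp add: t_def)
  qed
  note sm = simple_map_hom[OF j]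
  have "simple_map p j (Suc j) \<xi> = simple_map p j (Suc j) (?d + fscale t ?g)" by simp
  also have "\<dots> = simple_map p j (Suc j) ?d + fscale t (simple_map p j (Suc j) ?g)"
    by (simp only: linear_between_add[OF hom_linear_between[OF sm] d tg] linear_between_scale[OF hom_linear_between[OF sm] g])
  also have "simple_map p j (Suc j) ?d = 0" by (rule simple_map_kdiff_zero) fact
  also have "0 + fscale t (simple_map p j (Suc j) ?g) = fscale t (simple_map p j (Suc j) ?g)" by (rule add_0_left)
  finally have "f (Suc j) ?g = hom_scale t (simple_map p j) (Suc j) ?g"
    unfolding \<xi>(4) hom_scale_def .
  then show ?thesis
    using koszul_term_hom_eqI[OF jp j(2) f hom_combine(3)[OF spf_simple_hook[OF j] sm sm]] by blast
qed

section \<open>The resolution of the Weyl functors\<close>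

text \<open>
  Resolutions are required to take values in subspaces of \<open>nat \<Rightarrow> 'k\<close>, so the Koszul complex,
  which lives on functions of words, is transported along isomorphisms.
\<close>

definition spf_iso_pair ::
    "nat \<Rightarrow> ('k::field, 'b) spfun \<Rightarrow> ('k, nat) spfun \<Rightarrow> ('k, 'b, nat) spmor \<Rightarrow> ('k, nat, 'b) spmor \<Rightarrow> bool" where
  "spf_iso_pair e S T \<iota> \<kappa> \<longleftrightarrow> spf e T \<and> \<iota> \<in> spf_hom S T \<and> \<kappa> \<in> spf_hom T S \<and>
     (\<forall>n. \<forall>v\<in>ob S n. \<kappa> n (\<iota> n v) = v) \<and> (\<forall>n. \<forall>v\<in>ob T n. \<iota> n (\<kappa> n v) = v)"

lemma iso_pairD:
  assumes "spf_iso_pair e S T \<iota> \<kappa>"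
  shows "spf e T" "\<iota> \<in> spf_hom S T" "\<kappa> \<in> spf_hom T S"
    "v \<in> ob S n \<Longrightarrow> \<kappa> n (\<iota> n v) = v" "x \<in> ob T n \<Longrightarrow> \<iota> n (\<kappa> n x) = x"
  using assms by (simp_all add: spf_iso_pair_def)

lemma iso_pair_image:
  assumes i: "spf_iso_pair e S T \<iota> \<kappa>"
  shows "\<kappa> n ` ob T n = ob S n"
proof (intro subset_antisym subsetI)
  fix v assume v: "v \<in> ob S n"
  then show "v \<in> \<kappa> n ` ob T n"
    by (intro image_eqI[of _ _ "\<iota> n v"]) (simp_all add: iso_pairD(4)[OF i] hom_in[OF iso_pairD(2)[OF i]])
qed (auto intro: hom_in[OF iso_pairD(3)[OF i]])

lemma iso_pair_kernel:
  assumes i: "spf_iso_pair e S T \<iota> \<kappa>"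
  shows "\<iota> n ` {v \<in> ob S n. Q v} = {x \<in> ob T n. Q (\<kappa> n x)}"
proof (intro subset_antisym subsetI)
  fix x assume "x \<in> {x \<in> ob T n. Q (\<kappa> n x)}"
  then show "x \<in> \<iota> n ` {v \<in> ob S n. Q v}"
    by (intro image_eqI[of _ _ "\<kappa> n x"]) (simp_all add: iso_pairD(5)[OF i] hom_in[OF iso_pairD(3)[OF i]])
next
  fix x assume "x \<in> \<iota> n ` {v \<in> ob S n. Q v}"
  then show "x \<in> {x \<in> ob T n. Q (\<kappa> n x)}"
    by (auto simp: iso_pairD(4)[OF i] hom_in[OF iso_pairD(2)[OF i]])
qed

lemma iso_pair_projective:
  fixes S :: "('k::field, 'b) spfun" and T :: "('k, nat) spfun"
  assumes i: "spf_iso_pair e S T \<iota> \<kappa>"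
    and lift: "\<And>(X :: ('k, nat) spfun) (Y :: ('k, nat) spfun) g f. spf e X \<Longrightarrow> spf e Y \<Longrightarrow>
      g \<in> spf_hom X Y \<Longrightarrow> (\<And>n. g n ` ob X n = ob Y n) \<Longrightarrow> f \<in> spf_hom S Y \<Longrightarrow>
      \<exists>h\<in>spf_hom S X. \<forall>n. \<forall>v\<in>ob S n. g n (h n v) = f n v"
  shows "projective_spf e T"
  unfolding projective_spf_def
proof (intro conjI allI impI)
  show "spf e T" by (rule iso_pairD(1)[OF i])
  fix X Y :: "('k, nat) spfun" and g f
  assume a: "spf e X \<and> spf e Y \<and> g \<in> spf_hom X Y \<and> (\<forall>n. g n ` ob X n = ob Y n) \<and> f \<in> spf_hom T Y"
  then have X: "spf e X" and Y: "spf e Y" and g: "g \<in> spf_hom X Y" and s: "\<And>n. g n ` ob X n = ob Y n"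
    and f: "f \<in> spf_hom T Y"
    by simp_all
  have fi: "(\<lambda>n v. f n (\<iota> n v)) \<in> spf_hom S Y" by (rule hom_comp[OF iso_pairD(2)[OF i] f])
  obtain h where h: "h \<in> spf_hom S X" "\<forall>n. \<forall>v\<in>ob S n. g n (h n v) = f n (\<iota> n v)"
    by (rule bexE[OF lift[OF X Y g s fi]])
  have "(\<lambda>n v. h n (\<kappa> n v)) \<in> spf_hom T X" by (rule hom_comp[OF iso_pairD(3)[OF i] h(1)])
  moreover have "g n (h n (\<kappa> n v)) = f n v" if v: "v \<in> ob T n" for n v
    using h(2) hom_in[OF iso_pairD(3)[OF i] v] iso_pairD(5)[OF i v] by simp
  ultimately show "\<exists>h\<in>spf_hom T X. \<forall>n. \<forall>v\<in>ob T n. g n (h n v) = f n v"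
    by (intro bexI[of _ "\<lambda>n v. h n (\<kappa> n v)"]) simp_all
qed

lemma nat_resolution:
  fixes R :: "nat \<Rightarrow> ('k::field, 'b) spfun" and A :: "('k, 'c) spfun"
  assumes R: "\<And>i. spf e (R i)"
    and lift: "\<And>i (X :: ('k, nat) spfun) (Y :: ('k, nat) spfun) g f. spf e X \<Longrightarrow> spf e Y \<Longrightarrow>
      g \<in> spf_hom X Y \<Longrightarrow> (\<And>n. g n ` ob X n = ob Y n) \<Longrightarrow> f \<in> spf_hom (R i) Y \<Longrightarrow>
      \<exists>h\<in>spf_hom (R i) X. \<forall>n. \<forall>v\<in>ob (R i) n. g n (h n v) = f n v"
    and D: "\<And>i. D i \<in> spf_hom (R (Suc i)) (R i)" and a: "a \<in> spf_hom (R 0) A"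
    and surj: "\<And>n. a n ` ob (R 0) n = ob A n"
    and ex0: "\<And>n. D 0 n ` ob (R (Suc 0)) n = {v \<in> ob (R 0) n. a n v = 0}"
    and ex: "\<And>i n. D (Suc i) n ` ob (R (Suc (Suc i))) n = {v \<in> ob (R (Suc i)) n. D i n v = 0}"
  shows "\<exists>P d b \<iota> \<kappa>. projective_resolution e A P d b \<and> (\<forall>i. spf_iso_pair e (R i) (P i) (\<iota> i) (\<kappa> i))"
proof -
  \<comment> \<open>Packing the functor and both isomorphisms into one triple lets a single choice
    over \<open>i\<close> produce all of them.\<close>
  have "\<exists>x. spf_iso_pair e (R i) (fst x) (fst (snd x)) (snd (snd x))" for i
  proof -
    show ?thesis
    proof (rule nat_model[OF R[of i]])
      fix T :: "('k, nat) spfun" and \<iota> \<kappa>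
      assume "spf e T" "\<iota> \<in> spf_hom (R i) T" "\<kappa> \<in> spf_hom T (R i)"
        "\<And>n v. v \<in> ob (R i) n \<Longrightarrow> \<kappa> n (\<iota> n v) = v" "\<And>n v. v \<in> ob T n \<Longrightarrow> \<iota> n (\<kappa> n v) = v"
      then show ?thesis by (intro exI[of _ "(T, \<iota>, \<kappa>)"]) (simp add: spf_iso_pair_def)
    qed
  qed
  then obtain F where F: "\<And>i. spf_iso_pair e (R i) (fst (F i)) (fst (snd (F i))) (snd (snd (F i)))"
    by metis
  define P \<iota> \<kappa> where "P i = fst (F i)" and "\<iota> i = fst (snd (F i))" and "\<kappa> i = snd (snd (F i))" for i
  have iso: "spf_iso_pair e (R i) (P i) (\<iota> i) (\<kappa> i)" for i using F by (simp add: P_def \<iota>_def \<kappa>_def)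
  note i2 = iso_pairD(2)[OF iso] and i3 = iso_pairD(3)[OF iso]
  define d where "d i = (\<lambda>n v. \<iota> i n (D i n (\<kappa> (Suc i) n v)))" for i
  define b where "b = (\<lambda>n v. a n (\<kappa> 0 n v))"
  have im: "d i n ` ob (P (Suc i)) n = \<iota> i n ` (D i n ` ob (R (Suc i)) n)" for i n
    unfolding d_def iso_pair_image[OF iso, symmetric] by (simp add: image_image)
  have "projective_resolution e A P d b"
    unfolding projective_resolution_def
  proof (intro conjI allI)
    show "projective_spf e (P i)" for i by (rule iso_pair_projective[OF iso lift])
    show "d i \<in> spf_hom (P (Suc i)) (P i)" for i
      unfolding d_def using hom_comp[OF hom_comp[OF i3 D] i2] .
    show "b \<in> spf_hom (P 0) A" unfolding b_def using hom_comp[OF i3 a] .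
    show "b n ` ob (P 0) n = ob A n" for n
      unfolding b_def surj[symmetric] iso_pair_image[OF iso, symmetric] by (simp add: image_image)
    show "d 0 n ` ob (P (Suc 0)) n = {v \<in> ob (P 0) n. b n v = 0}" for n
      unfolding im ex0 iso_pair_kernel[OF iso] b_def ..
    show "d (Suc i) n ` ob (P (Suc (Suc i))) n = {v \<in> ob (P (Suc i)) n. d i n v = 0}" for i n
    proof -
      \<comment> \<open>Kernels survive the transport because \<open>\<iota> i n\<close> is
        injective.\<close>
      have "\<iota> i n y = 0 \<longleftrightarrow> y = 0" if "y \<in> ob (R i) n" for y
        using iso_pairD(4)[OF iso that] hom_zero[OF i2] hom_zero[OF i3] by metis
      then have "D i n (\<kappa> (Suc i) n v) = 0 \<longleftrightarrow> d i n v = 0" if "v \<in> ob (P (Suc i)) n" for v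
        unfolding d_def using hom_in[OF D hom_in[OF i3 that]] by blast
      then show ?thesis unfolding im ex iso_pair_kernel[OF iso] by blast
    qed
  qed
  then show ?thesis using iso by blast
qed

text \<open>Fills the resolution beyond its length, as resolutions are indexed by all natural
  numbers.\<close>

definition zero_spf :: "('k::field, 'b) spfun" where
  "zero_spf = \<lparr>ob = (\<lambda>_. {0}), coef = (\<lambda>_ _ _ _. 0)\<rparr>"

lemma zero_spf_simps [simp]: "ob zero_spf n = {0}" "coef zero_spf m n M v = 0"
  by (simp_all add: zero_spf_def)

lemma spf_zero_spf: "spf e zero_spf"
  unfolding spf_def
proof (intro conjI allI ballI impI)
  show "fd_space (ob zero_spf n)" for n
    unfolding fd_space_def by (intro exI[of _ "{}"]) simp
qed (auto simp: linear_between_def spf_eval_def)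

lemma zero_spf_hom:
  assumes "spf e T"
  shows "spf_hom zero_spf T = {0}"
proof -
  have "f = 0" if f: "f \<in> spf_hom zero_spf T" for f
    by (rule hom_eqI[OF f zero_hom[OF assms]]) (simp add: hom_zero[OF f])
  then show ?thesis using zero_hom[OF assms] by blast
qed

definition kdiff_mor :: "nat \<Rightarrow> nat \<Rightarrow> ('k::field, nat list, nat list) spmor" where
  "kdiff_mor p j n v = (if v \<in> ob (koszul_term p j) n then kdiff p j v else 0)"

lemma kdiff_mor_hom:
  assumes j: "Suc j \<le> p"
  shows "kdiff_mor p j \<in> spf_hom (koszul_term p j) (koszul_term p (Suc j) :: ('k::field, nat list) spfun)"
proof -
  have jp: "j \<le> p" "j < p" using j by auto
  note Q = spf_koszul_term[OF jp(1), where 'k = 'k]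
  note sub = spf_subspace[OF Q]
  show ?thesis
    unfolding spf_hom_def linear_between_def
    using kdiff_in[OF _ jp(2)] fvs.subspace_add[OF sub] fvs.subspace_scale[OF sub] linear_between_in[OF spf_linear_between[OF Q]]
    by (auto simp: kdiff_mor_def kdiff_linear koszul_term_simps(2) coef_kdiff[OF jp(2)])
qed

lemma kdiff_mor_exact:
  assumes i: "Suc i < p"
  shows "kdiff_mor p i n ` ob (koszul_term p i) n =
    {v \<in> ob (koszul_term p (Suc i) :: ('k::field, nat list) spfun) n. kdiff p (Suc i) v = 0}"
proof (intro subset_antisym subsetI)
  fix v :: "nat list \<Rightarrow> 'k" assume "v \<in> kdiff_mor p i n ` ob (koszul_term p i) n"
  then obtain u where u: "u \<in> ob (koszul_term p i) n" "v = kdiff p i u" by (auto simp: kdiff_mor_def)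
  have "v \<in> ob (koszul_term p (Suc i)) n" unfolding u(2) using kdiff_in[OF u(1)] i by simp
  moreover have "kdiff p (Suc i) v = 0"
    unfolding u(2) using kdiff_kdiff[of p i u] u(1) i by (simp add: koszul_term_simps fun_eq_iff)
  ultimately show "v \<in> {v \<in> ob (koszul_term p (Suc i)) n. kdiff p (Suc i) v = 0}" by simp
next
  fix v :: "nat list \<Rightarrow> 'k" assume "v \<in> {v \<in> ob (koszul_term p (Suc i)) n. kdiff p (Suc i) v = 0}"
  then have v: "v \<in> ob (koszul_term p (Suc i)) n" "kdiff p (Suc i) v = 0" by auto
  show "v \<in> kdiff_mor p i n ` ob (koszul_term p i) n"
    using kdiff_exact[OF v(1) i v(2)] by (intro image_eqI[of _ _ "cone i v"]) (simp_all add: kdiff_mor_def)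
qed

text \<open>Homological degree \<open>i\<close> carries exterior degree \<open>m - i\<close>, so
  that \<open>kdiff\<close>, which raises the exterior degree, lowers the homological one.\<close>

definition weyl_terms :: "nat \<Rightarrow> nat \<Rightarrow> nat \<Rightarrow> ('k::field, nat list) spfun" where
  "weyl_terms p m i = (if i \<le> m then koszul_term p (m - i) else zero_spf)"

lemma weyl_resolution:
  assumes m: "m < p" and fac: "\<And>j. j < p \<Longrightarrow> of_nat (fact j) \<noteq> (0 :: 'k::field)"
  shows "\<exists>P d b \<iota> \<kappa>. projective_resolution p (weyl (hook p m) :: ('k, nat multiset list \<Rightarrow> 'k) spfun) P d b \<and>
    (\<forall>i. spf_iso_pair p (weyl_terms p m i) (P i) (\<iota> i) (\<kappa> i))"
proof (rule nat_resolution)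
  let ?R = "weyl_terms p m :: nat \<Rightarrow> ('k, nat list) spfun"
  let ?D = "\<lambda>i. if i < m then kdiff_mor p (m - Suc i) else 0"
  show "spf p (?R i)" for i using m by (simp add: weyl_terms_def spf_koszul_term spf_zero_spf)
  then have R0: "0 \<in> spf_hom S (?R i)" for S :: "('k, nat list) spfun" and i by (rule zero_hom)
  show "\<exists>h\<in>spf_hom (?R i) X. \<forall>n. \<forall>v\<in>ob (?R i) n. g n (h n v) = f n v"
    if "spf p X" "spf p Y" "g \<in> spf_hom X Y" "\<And>n. g n ` ob X n = ob Y n" "f \<in> spf_hom (?R i) Y"
    for i g f and X Y :: "('k, nat) spfun"
  proof (cases "i \<le> m")
    case True
    then show ?thesis
      using koszul_term_lift[OF _ fac that(1-4), of "m - i" f] that(5) m by (simp add: weyl_terms_def)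
  next
    case False
    have "f \<in> spf_hom zero_spf Y" using that(5) False by (simp add: weyl_terms_def)
    then have "f = 0" using zero_spf_hom[OF that(2)] by blast
    then show ?thesis
      using zero_hom[OF that(1), of "?R i"] hom_zero[OF that(3)] by (intro bexI[of _ 0]) simp_all
  qed
  show "?D i \<in> spf_hom (?R (Suc i)) (?R i)" for i
  proof (cases "i < m")
    case True
    then have "m - i = Suc (m - Suc i)" by simp
    then show ?thesis using True kdiff_mor_hom[of "m - Suc i" p, where 'k = 'k] m by (simp add: weyl_terms_def)
  next
    case False
    then show ?thesis using R0 by simp
  qed
  show "weyl_map p m \<in> spf_hom (?R 0) (weyl (hook p m))"
    using weyl_map_hom[OF m] by (simp add: weyl_terms_def)
  show "weyl_map p m n ` ob (?R 0) n = ob (weyl (hook p m)) n" for n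
    using weyl_map_surj[OF m fac[OF m]] by (simp add: weyl_terms_def)
  \<comment> \<open>The augmentation has the kernel of the next Koszul differential, so exactness at
    degree 0 is exactness of the Koszul complex at exterior degree \<open>m\<close>.\<close>
  have ker: "{v \<in> ob (koszul_term p m :: ('k, nat list) spfun) n. weyl_map p m n v = 0} =
      {v \<in> ob (koszul_term p m) n. kdiff p m v = 0}" for n
    using weyl_map_kernel[OF m fac[OF m]] by blast
  \<comment> \<open>\<open>kdiff p 0\<close> is injective: this is exactness at the last nonzero
    term, and for \<open>m = 0\<close> it makes the augmentation itself injective.\<close>
  have bot: "{v \<in> ob (koszul_term p 0 :: ('k, nat list) spfun) n. kdiff p 0 v = 0} = {0}" for n
    using kdiff_exact_0 m spf_subspace[OF spf_koszul_term, of 0 p n, THEN fvs.subspace_0]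
    by (auto simp: kdiff_linear)
  show "?D 0 n ` ob (?R (Suc 0)) n = {v \<in> ob (?R 0) n. weyl_map p m n v = 0}" for n
  proof (cases m)
    case 0
    then show ?thesis using bot[of n] ker[of n] by (simp add: weyl_terms_def)
  next
    case (Suc l)
    then show ?thesis using kdiff_mor_exact[of l p n, where 'k = 'k] ker[of n] m by (simp add: weyl_terms_def)
  qed
  show "?D (Suc i) n ` ob (?R (Suc (Suc i))) n = {v \<in> ob (?R (Suc i)) n. ?D i n v = 0}" for i n
  proof -
    consider "Suc i < m" | "Suc i = m" | "m \<le> i" by linarith
    then show ?thesis
    proof cases
      case 1
      then have e: "m - Suc i = Suc (m - Suc (Suc i))" by simp
      have "{v \<in> ob (?R (Suc i)) n. ?D i n v = 0} =
        {v \<in> ob (koszul_term p (m - Suc i)) n. kdiff p (m - Suc i) v = 0}"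
        using 1 by (auto simp: weyl_terms_def kdiff_mor_def)
      then show ?thesis
        using 1 kdiff_mor_exact[of "m - Suc (Suc i)" p n, where 'k = 'k] m unfolding e by (simp add: weyl_terms_def)
    next
      case 2
      have "{v \<in> ob (?R (Suc i)) n. ?D i n v = 0} = {v \<in> ob (koszul_term p 0) n. kdiff p 0 v = 0}"
        using 2 by (auto simp: weyl_terms_def kdiff_mor_def)
      then show ?thesis using 2 bot[of n] by (simp add: weyl_terms_def)
    next
      case 3
      then show ?thesis by (auto simp: weyl_terms_def)
    qed
  qed
qed

section \<open>Assembling the Ext groups\<close>

lemma iso_pair_hom_zero:
  assumes i: "spf_iso_pair e S T \<iota> \<kappa>" and B: "spf e B" and S: "spf_hom S B = {0}"
  shows "spf_hom T B = {0}"
proof -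
  have "f = 0" if f: "f \<in> spf_hom T B" for f
  proof (rule hom_eqI[OF f zero_hom[OF B]])
    fix n v assume v: "v \<in> ob T n"
    have "(\<lambda>n v. f n (\<iota> n v)) \<in> spf_hom S B" by (rule hom_comp[OF iso_pairD(2)[OF i] f])
    then have "f n (\<iota> n (\<kappa> n v)) = 0" using S by (auto simp: fun_eq_iff)
    then show "f n v = 0 n v" using iso_pairD(5)[OF i v] by simp
  qed
  then show ?thesis using zero_hom[OF B] by blast
qed

theorem corollary2p2:
  fixes p m n q :: nat
  assumes "p = CHAR('k::field)" and "p > 0"
    and "m \<le> p - 1" and "n \<le> p - 1"
  shows "let E = Ext p q (weyl (hook p m) :: ('k, nat multiset list \<Rightarrow> 'k) spfun)
                         (simple_functor (hook p n))
         in if m \<ge> n \<and> q = m - n then iso_to_field E else zero_space E"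
proof -
  have prime: "prime p" using prime_CHAR_semidom[where 'a = 'k] assms(1,2) by simp
  have p0: "of_nat p = (0 :: 'k)" using assms(1) by simp
  have fac: "of_nat (fact j) \<noteq> (0 :: 'k)" if "j < p" for j
    using that prime_dvd_fact_iff[OF prime, of j] assms(1) by (simp add: of_nat_eq_0_iff_char_dvd)
  have m: "m < p" and n: "n < p" using assms(2-4) by auto
  let ?W = "weyl (hook p m) :: ('k, nat multiset list \<Rightarrow> 'k) spfun"
  let ?F = "simple_functor (hook p n) :: ('k, nat multiset list) spfun"
  note F = spf_simple_hook[OF n fac[OF n]]
  obtain P d b \<iota> \<kappa> where P: "projective_resolution p ?W P d b"
    and iso: "\<And>i. spf_iso_pair p (weyl_terms p m i) (P i) (\<iota> i) (\<kappa> i)"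
    using weyl_resolution[OF m fac] by blast
  \<comment> \<open>The term in homological degree \<open>i\<close> is a model of
    \<open>koszul_term p (m - i)\<close>, so a nonzero morphism to F_n requires
    \<open>m - i = n\<close>.\<close>
  have zero: "spf_hom (P i) ?F = {0}" if "\<not> (n \<le> m \<and> i = m - n)" for i
  proof (rule iso_pair_hom_zero[OF iso F])
    show "spf_hom (weyl_terms p m i) ?F = {0}"
    proof (cases "i \<le> m")
      case True
      have "m - i < p" "m - i \<noteq> n" using True that m by auto
      then show ?thesis
        using hom_simple_zero[OF _ fac n fac[OF n] p0, of "m - i"] True by (simp add: weyl_terms_def)
    next
      case False
      then show ?thesis using zero_spf_hom[OF F] by (simp add: weyl_terms_def)
    qed
  qed
  show ?thesis
  proof (cases "n \<le> m \<and> q = m - n")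
    case True
    then have R: "weyl_terms p m q = (koszul_term p n :: ('k, nat list) spfun)" by (simp add: weyl_terms_def)
    note sm = simple_map_hom[OF n fac[OF n]]
    note iq = iso[of q, unfolded R]
    let ?y = "\<lambda>N v. simple_map p n N (\<kappa> q N v)"
    have y: "?y \<in> spf_hom (P q) ?F" by (rule hom_comp[OF iso_pairD(3)[OF iq] sm])
    have "?y (Suc n) (\<iota> q (Suc n) (generator p n)) \<noteq> 0"
      using iso_pairD(4)[OF iq generator_in] simple_map_generator_nonzero[OF n fac[OF n]] n by simp
    then have "?y \<noteq> 0" by (auto simp: fun_eq_iff)
    moreover have "\<exists>t. x = hom_scale t ?y" if x: "x \<in> spf_hom (P q) ?F" for x
    proof -
      have "(\<lambda>N v. x N (\<iota> q N v)) \<in> spf_hom (koszul_term p n) ?F"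
        by (rule hom_comp[OF iso_pairD(2)[OF iq] x])
      then obtain t where t: "(\<lambda>N v. x N (\<iota> q N v)) = hom_scale t (simple_map p n)"
        using hom_simple_line[OF n fac[OF n]] by blast
      have "x = hom_scale t ?y"
      proof (rule hom_eqI[OF x hom_combine(3)[OF F y y]])
        fix N v assume v: "v \<in> ob (P q) N"
        have "x N v = x N (\<iota> q N (\<kappa> q N v))" using iso_pairD(5)[OF iq v] by simp
        also have "\<dots> = hom_scale t (simple_map p n) N (\<kappa> q N v)" by (rule fun_cong[OF fun_cong[OF t]])
        finally show "x N v = hom_scale t ?y N v" by (simp add: hom_scale_def)
      qed
      then show ?thesis by blast
    qed
    ultimately have "iso_to_field (Ext p q ?W ?F)"
      using zero True y by (intro Ext_field[OF P F, where y = ?y]) auto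
    then show ?thesis using True by simp
  next
    case False
    then have "zero_space (Ext p q ?W ?F)" by (intro Ext_zero[OF P F] zero)
    then show ?thesis unfolding Let_def if_not_P[OF False] .
  qed
qed

end
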